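(* Let $(a_j)_{j\ge1}$ be positive weights and $v:\{1,2,\dots\}\to\mathbb R$ a function satisfying the profile assumption stated in the context, and let $\gamma_c$, $q_\gamma$, $\alpha_\gamma,\rho_\gamma$, $\alpha_c,\rho_c$, $k_n(\rho)$ and $\mu^{\rho,[r]}_{n,k}$ be as defined there. Let $\gamma\le\gamma_c$ be such that $\rho=\rho_\gamma>0$. As $n\to\infty$: (i) If $\gamma<\gamma_c$, then \[ \left|\frac{k_n(\rho)}{n}-\alpha_\gamma\right|=O_\gamma(n^{-1/2}). \] (ii) At $\gamma=\gamma_c$, \[ \left|\frac{k_n(\rho_c)}{n}-\alpha_c\right|=O\!\left(\left(\frac{\log n}{n}\right)^{1/2}\right). \] (iii) For every $\gamma\le\gamma_c$ (with $\rho=\rho_\gamma>0$) and every fixed $r\ge1$, \[ d_{\mathrm{TV}}\!\left(\mu^{\rho,[r]}_{n,k_n(\rho)},q_\gamma^{\otimes r}\right)=O_{\gamma,r}\!\left(\left(\frac{\log n}{n}\right)^{1/2}\right). \]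
   Context: Profile assumption on $(a,v)$: the weights $a_j$ are positive; $v$ is increasing and, with $\Delta v(j)=v(j+1)-v(j)$ and $\Delta^2v(j)=\Delta v(j+1)-\Delta v(j)$, \[ \frac{v(j)}j\to\infty,\qquad \frac{\Delta v(j)}{v(j)}\to0,\qquad \Delta^2v(j)\to0\qquad(j\to\infty); \] the limit $\gamma_c=\lim_{j\to\infty}[-\log a_j]/v(j)$ exists and is finite; and, with $Z_\gamma(x)=\sum_{j\ge1}a_jx^je^{\gamma v(j)}\in(0,\infty]$ for $x>0$, the set $\{x>0:Z_{\gamma_c}(x)<\infty\}$ is nonempty and open (i.e. the family in $x$ with $\gamma=\gamma_c$ fixed is nonempty and regular). Canonical quantities: for every $\gamma\le\gamma_c$ the equation $Z_\gamma(x)=1$ has a unique solution $x=x_\gamma>0$. Let $q_\gamma(j)=a_jx_\gamma^je^{\gamma v(j)}$, a probability law on $\{1,2,\dots\}$, write $\mathbb E_\gamma$ for expectation when $J\sim q_\gamma$, and set \[ \alpha_\gamma=\frac1{\mathbb E_\gamma J},\qquad \rho_\gamma=\frac{\mathbb E_\gamma v(J)}{\mathbb E_\gamma J}. \] Write $\alpha_c=\alpha_{\gamma_c}$, $\rho_c=\rho_{\gamma_c}$. Microcanonical quantities: for $\rho>0$ and $1\le k\le n$, \[ W^{(a,v)}_{n,k}(\rho)=\sum_{\substack{j_1+\cdots+j_k=n,\ j_i\ge1\\ |\sum_i v(j_i)-\rho n|\le 1}}\ \prod_{i=1}^k a_{j_i}. \] Whenever $W^{(a,v)}_{n,k}(\rho)>0$,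 $\mu^\rho_{n,k}$ is the probability law of $(J_1,\dots,J_k)$ on the constraint set $\{j_i\ge 1,\ \sum_i j_i=n,\ |\sum_iv(j_i)-\rho n|\le1\}$ with weights proportional to $\prod_ia_{j_i}$, and for $1\le r\le k$, $\mu^{\rho,[r]}_{n,k}$ is the joint law of its first $r$ coordinates. $k_n(\rho)$ is any maximizer of $k\mapsto W^{(a,v)}_{n,k}(\rho)$ over $1\le k\le n$. $d_{\mathrm{TV}}(\mu,\pi)=\frac12\sum_z|\mu(z)-\pi(z)|$. The model $(a,v)$ is fixed; implicit constants may depend on it, and subscripts record any additional dependence. *)

theory Defs
  imports "HOL-Probability.Probability" "HOL-Library.Landau_Symbols"
begin

text \<open>
  Sequences indexed by the positive integers are functions on \<^typ>\<open>nat\<close>; every definition below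
  is guarded so that the values at \<open>0\<close> are irrelevant.
\<close>

definition fdiff :: "(nat \<Rightarrow> real) \<Rightarrow> nat \<Rightarrow> real" where
  "fdiff v j = v (j + 1) - v j"

definition gamma_crit :: "(nat \<Rightarrow> real) \<Rightarrow> (nat \<Rightarrow> real) \<Rightarrow> real" where
  "gamma_crit a v = lim (\<lambda>j. - ln (a j) / v j)"

definition tilted_weight :: "(nat \<Rightarrow> real) \<Rightarrow> (nat \<Rightarrow> real) \<Rightarrow> real \<Rightarrow> real \<Rightarrow> nat \<Rightarrow> real" where
  "tilted_weight a v \<gamma> x j = (if 1 \<le> j then a j * x ^ j * exp (\<gamma> * v j) else 0)"

definition partition_fun :: "(nat \<Rightarrow> real) \<Rightarrow> (nat \<Rightarrow> real) \<Rightarrow> real \<Rightarrow> real \<Rightarrow> ennreal" where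
  "partition_fun a v \<gamma> x = (\<Sum>j. ennreal (tilted_weight a v \<gamma> x j))"

definition profile :: "(nat \<Rightarrow> real) \<Rightarrow> (nat \<Rightarrow> real) \<Rightarrow> bool" where
  "profile a v \<longleftrightarrow>
     (\<forall>j\<ge>1. 0 < a j) \<and>
     mono_on {1..} v \<and>
     filterlim (\<lambda>j. v j / real j) at_top sequentially \<and>
     (\<lambda>j. fdiff v j / v j) \<longlonglongrightarrow> 0 \<and>
     fdiff (fdiff v) \<longlonglongrightarrow> 0 \<and>
     convergent (\<lambda>j. - ln (a j) / v j) \<and>
     {x. 0 < x \<and> partition_fun a v (gamma_crit a v) x < \<infinity>} \<noteq> {} \<and>
     open {x. 0 < x \<and> partition_fun a v (gamma_crit a v) x < \<infinity>}"

definition canon_x :: "(nat \<Rightarrow> real) \<Rightarrow> (nat \<Rightarrow> real) \<Rightarrow> real \<Rightarrow> real" where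
  "canon_x a v \<gamma> = (THE x. 0 < x \<and> partition_fun a v \<gamma> x = 1)"

definition canon_law :: "(nat \<Rightarrow> real) \<Rightarrow> (nat \<Rightarrow> real) \<Rightarrow> real \<Rightarrow> nat pmf" where
  "canon_law a v \<gamma> = embed_pmf (tilted_weight a v \<gamma> (canon_x a v \<gamma>))"

definition canon_alpha :: "(nat \<Rightarrow> real) \<Rightarrow> (nat \<Rightarrow> real) \<Rightarrow> real \<Rightarrow> real" where
  "canon_alpha a v \<gamma> = 1 / measure_pmf.expectation (canon_law a v \<gamma>) real"

definition canon_rho :: "(nat \<Rightarrow> real) \<Rightarrow> (nat \<Rightarrow> real) \<Rightarrow> real \<Rightarrow> real" where
  "canon_rho a v \<gamma> = measure_pmf.expectation (canon_law a v \<gamma>) v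
                      / measure_pmf.expectation (canon_law a v \<gamma>) real"

text \<open>Tuples \<open>(j\<^sub>1, \<dots>, j\<^sub>k)\<close> are represented as lists of length \<open>k\<close>.\<close>

definition micro_set :: "(nat \<Rightarrow> real) \<Rightarrow> real \<Rightarrow> nat \<Rightarrow> nat \<Rightarrow> nat list set" where
  "micro_set v \<rho> n k =
     {js. length js = k \<and> (\<forall>j\<in>set js. 1 \<le> j) \<and> sum_list js = n \<and>
          \<bar>(\<Sum>j\<leftarrow>js. v j) - \<rho> * real n\<bar> \<le> 1}"

definition micro_weight :: "(nat \<Rightarrow> real) \<Rightarrow> (nat \<Rightarrow> real) \<Rightarrow> real \<Rightarrow> nat \<Rightarrow> nat \<Rightarrow> real" where
  "micro_weight a v \<rho> n k = (\<Sum>js\<in>micro_set v \<rho> n k. \<Prod>j\<leftarrow>js. a j)"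

text \<open>Meaningful only when \<open>micro_weight a v \<rho> n k > 0\<close>; see \<open>pmf_micro_law\<close> below.\<close>

definition micro_law :: "(nat \<Rightarrow> real) \<Rightarrow> (nat \<Rightarrow> real) \<Rightarrow> real \<Rightarrow> nat \<Rightarrow> nat \<Rightarrow> nat list pmf" where
  "micro_law a v \<rho> n k =
     embed_pmf (\<lambda>js. if js \<in> micro_set v \<rho> n k
                     then (\<Prod>j\<leftarrow>js. a j) / micro_weight a v \<rho> n k else 0)"

definition micro_marginal ::
    "(nat \<Rightarrow> real) \<Rightarrow> (nat \<Rightarrow> real) \<Rightarrow> real \<Rightarrow> nat \<Rightarrow> nat \<Rightarrow> nat \<Rightarrow> nat list pmf" where
  "micro_marginal a v \<rho> n k r = map_pmf (take r) (micro_law a v \<rho> n k)"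

definition micro_maximizer :: "(nat \<Rightarrow> real) \<Rightarrow> (nat \<Rightarrow> real) \<Rightarrow> real \<Rightarrow> nat \<Rightarrow> nat \<Rightarrow> bool" where
  "micro_maximizer a v \<rho> n k \<longleftrightarrow> is_arg_max (micro_weight a v \<rho> n) (\<lambda>k. k \<in> {1..n}) k"

definition tv_dist :: "'a pmf \<Rightarrow> 'a pmf \<Rightarrow> real" where
  "tv_dist p q = (\<Sum>\<^sub>\<infinity>z. \<bar>pmf p z - pmf q z\<bar>) / 2"

lemma finite_micro_set: "finite (micro_set v \<rho> n k)"
proof (rule finite_subset)
  show "micro_set v \<rho> n k \<subseteq> {js. set js \<subseteq> {..n} \<and> length js = k}"
    by (auto simp: micro_set_def dest: member_le_sum_list)
qed (simp add: finite_lists_length_eq)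

lemma pmf_micro_law:
  assumes pos: "\<And>j. 1 \<le> j \<Longrightarrow> 0 < a j" and W: "micro_weight a v \<rho> n k > 0"
  shows "pmf (micro_law a v \<rho> n k) js =
           (if js \<in> micro_set v \<rho> n k then (\<Prod>j\<leftarrow>js. a j) / micro_weight a v \<rho> n k else 0)"
proof -
  let ?C = "micro_set v \<rho> n k" and ?W = "micro_weight a v \<rho> n k"
  let ?f = "\<lambda>js. if js \<in> ?C then (\<Prod>j\<leftarrow>js. a j) / ?W else 0"
  have nonneg: "0 \<le> ?f xs" for xs
  proof (cases "xs \<in> ?C")
    case True
    then have "0 \<le> (\<Prod>j\<leftarrow>xs. a j)"
      by (auto simp: micro_set_def intro!: prod_list_nonneg less_imp_le[OF pos])
    with True W show ?thesis by simp
  qed simp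
  have "(\<integral>\<^sup>+xs. ennreal (?f xs) \<partial>count_space UNIV) = (\<Sum>xs\<in>?C. ennreal (?f xs))"
    by (subst nn_integral_count_space'[where A = ?C])
       (auto simp: finite_micro_set)
  also have "\<dots> = ennreal (\<Sum>xs\<in>?C. ?f xs)"
    by (intro sum_ennreal nonneg)
  also have "(\<Sum>xs\<in>?C. ?f xs) = (\<Sum>xs\<in>?C. (\<Prod>j\<leftarrow>xs. a j) / ?W)"
    by simp
  also have "\<dots> = ?W / ?W"
    by (subst sum_divide_distrib[symmetric]) (simp add: micro_weight_def)
  also have "\<dots> = 1"
    using W by simp
  finally have "(\<integral>\<^sup>+xs. ennreal (?f xs) \<partial>count_space UNIV) = 1"
    by simp
  then show ?thesis
    unfolding micro_law_def by (subst pmf_embed_pmf) (simp_all only: nonneg)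
qed

end

theory Submission
  imports Defs
begin

text \<open>
  Let \<open>x\<close> be the canonical fugacity, \<open>q\<close> the canonical law, and let \<open>J\<close> have law \<open>q\<close>.  On
  configurations \<open>(j\<^sub>1, \<dots>, j\<^sub>k)\<close> with sum \<open>n\<close> whose \<open>v\<close>-sum is within \<open>1\<close> of \<open>\<rho> n\<close>, the product
  of the weights \<open>a\<close> becomes, after multiplication by \<open>x ^ n * exp (\<gamma> * \<rho> * n)\<close> and up to a factor
  between \<open>exp (- \<bar>\<gamma>\<bar>)\<close> and \<open>exp \<bar>\<gamma>\<bar>\<close>, the probability of the configuration under \<open>k\<close> independent
  draws from \<open>q\<close>.  Hence the microcanonical weight of \<open>(n, k)\<close> is comparable, uniformly in \<open>k\<close>, with
  the probability \<open>P\<^sub>k\<close> that the planar random walk with steps \<open>(J, v J)\<close> is at time \<open>k\<close> in the strip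
  \<open>{n} \<times> [\<rho> n - 1, \<rho> n + 1]\<close>, and maximizing the weight is almost the same as maximizing \<open>P\<^sub>k\<close>.

  Three estimates for such a walk with finite second moments carry the first two claims.
  Every strip has probability at most \<open>C / (k + 1)\<close> (\<open>prob_strip_le\<close>); a strip at bounded distance
  from the mean has probability at least \<open>c / k\<close> for large \<open>k\<close> (\<open>prob_strip_ge\<close>); and a strip whose first
  coordinate is \<open>\<Delta>\<close> away from the mean has probability at most \<open>C / \<Delta>\<^sup>2\<close>, whatever \<open>k\<close> is
  (\<open>prob_strip_far_le\<close>).  The last one follows from the first by cutting the walk into halves: one
  half must deviate, which Chebyshev's inequality penalizes by \<open>k / \<Delta>\<^sup>2\<close>, and the other half must
  then hit a prescribed strip.  At \<open>k = \<lfloor>\<alpha> n\<rfloor>\<close> the strip is at bounded distance from the mean, so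
  \<open>P\<^sub>k \<ge> c / n\<close> there, hence also at the maximizer up to a constant, and the third estimate gives
  \<open>(n - k\<^sub>n E J)\<^sup>2 = O(n)\<close> (\<open>maximizer_prob\<close>).  This is the rate \<open>n powr (-1/2)\<close> for \<open>k\<^sub>n / n\<close>, both
  below and at the critical parameter.

  The local estimates need no Fourier analysis.  A fraction of the steps can be realized by fair
  coins.  One step may take the values \<open>1\<close> and \<open>2\<close>, and a coin deciding between them moves the first
  coordinate by \<open>1\<close>.  Two steps may take the values \<open>(j, j + 2)\<close> and \<open>(j + 1, j + 1)\<close>, and a
  coin deciding between these moves only the second coordinate, by a second difference \<open>d\<close> of \<open>v\<close>.
  Since the second differences tend to \<open>0\<close> but cannot vanish eventually (\<open>v\<close> grows superlinearly),
  some \<open>d\<close> satisfies \<open>0 < \<bar>d\<bar> \<le> 1\<close>, so that multiples of \<open>d\<close> cannot jump over the strip.  Conditionally on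
  everything but the coins, the walk is an affine image of two independent binomial variables, each
  with about \<open>k\<close> trials, and each contributes a factor \<open>1 / sqrt k\<close>.

  For the marginals, \<open>P\<^sub>k \<ge> c / n\<close> says that the microcanonical law has a density of order at most \<open>n\<close> with
  respect to the product law.  It is also invariant under rotation, so the average of a bounded
  function \<open>f\<close> of \<open>r\<close> consecutive entries over \<open>L = k div r\<close> disjoint blocks has the same
  microcanonical mean as \<open>f\<close> of the first block.  Under the product law this average is
  concentrated with Gaussian exponential moments, by Hoeffding's lemma; since passing to the
  microcanonical law multiplies exponential moments by at most \<open>O(n)\<close>, Jensen's inequality bounds
  the bias of \<open>f\<close> by \<open>O(sqrt (ln n / L))\<close> (\<open>tv_dist_le\<close>).  The logarithm in the third claim is
  the logarithm of the density bound.
\<close>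

section \<open>Central binomial estimates\<close>

lemma central_binomial_Suc:
  "real (Suc m) * real ((2 * Suc m) choose Suc m) = 2 * real (2 * m + 1) * real ((2 * m) choose m)"
proof -
  have "Suc m * ((2 * Suc m) choose Suc m) = (2 * Suc m) * ((2 * m + 1) choose m)"
    using Suc_times_binomial[of m "2 * m + 1"] by (simp add: algebra_simps)
  moreover have "Suc m * ((2 * m + 1) choose Suc m) = (2 * m + 1) * ((2 * m) choose m)"
    using Suc_times_binomial[of m "2 * m"] by (simp add: algebra_simps)
  moreover have "(2 * m + 1) choose Suc m = (2 * m + 1) choose m"
    using binomial_symmetric[of "Suc m" "2 * m + 1"] by simp
  ultimately have "Suc m * (Suc m * ((2 * Suc m) choose Suc m))
      = Suc m * (2 * ((2 * m + 1) * ((2 * m) choose m)))"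
    by (metis mult.assoc mult.left_commute)
  then have "Suc m * ((2 * Suc m) choose Suc m) = 2 * ((2 * m + 1) * ((2 * m) choose m))"
    by (simp only: mult_cancel1) simp
  then have "real (Suc m * ((2 * Suc m) choose Suc m)) = real (2 * ((2 * m + 1) * ((2 * m) choose m)))"
    by (simp only:)
  then show ?thesis by (simp only: of_nat_mult of_nat_numeral mult.assoc)
qed

lemma central_binomial_ratio:
  "real ((2 * Suc m) choose Suc m) / 4 ^ Suc m
     = (real (2 * m + 1) / real (2 * m + 2)) * (real ((2 * m) choose m) / 4 ^ m)"
proof -
  define X where "X = real ((2 * Suc m) choose Suc m)"
  define Y where "Y = real ((2 * m) choose m)"
  have "real (Suc m) * X = 2 * real (2 * m + 1) * Y"
    unfolding X_def Y_def by (rule central_binomial_Suc)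
  then have "X = 2 * real (2 * m + 1) * Y / real (Suc m)"
    by (simp add: eq_divide_eq mult.commute del: of_nat_Suc)
  then have "X / 4 ^ Suc m = (real (2 * m + 1) / real (2 * m + 2)) * (Y / 4 ^ m)"
    by (simp add: divide_simps) (simp add: algebra_simps)
  then show ?thesis unfolding X_def Y_def .
qed

text \<open>
  Induction with the exact ratio of consecutive terms: \<open>(2m+1) / (2m+2)\<close> is at most
  \<open>sqrt ((2m+1) / (2m+3))\<close> because \<open>(2m+1) (2m+3) \<le> (2m+2)\<^sup>2\<close>.
\<close>

lemma central_binomial_le: "real ((2 * m) choose m) / 4 ^ m \<le> 1 / sqrt (2 * m + 1)"
proof (induction m)
  case (Suc m)
  have "real (2 * m + 1) * real (2 * m + 3) \<le> (real (2 * m + 2))\<^sup>2"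
    by (simp add: power2_eq_square algebra_simps)
  then have "sqrt (real (2 * m + 1) * real (2 * m + 3)) \<le> real (2 * m + 2)"
    by (metis of_nat_0_le_iff real_sqrt_abs abs_of_nonneg real_sqrt_le_iff)
  then have *: "sqrt (real (2 * m + 1)) * sqrt (real (2 * m + 3)) \<le> real (2 * m + 2)"
    by (simp only: real_sqrt_mult)
  have "real ((2 * Suc m) choose Suc m) / 4 ^ Suc m
      \<le> (real (2 * m + 1) / real (2 * m + 2)) * (1 / sqrt (2 * m + 1))"
    unfolding central_binomial_ratio by (intro mult_left_mono Suc) auto
  also have "\<dots> = sqrt (real (2 * m + 1)) / real (2 * m + 2)"
  proof -
    define a where "a = sqrt (real (2 * m + 1))"
    have "a > 0" "real (2 * m + 1) = a * a" by (simp_all add: a_def)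
    then show ?thesis unfolding a_def[symmetric] by (simp add: divide_simps)
  qed
  also have "\<dots> \<le> 1 / sqrt (real (2 * m + 3))"
    using * by (simp add: field_simps)
  finally show ?case by (simp add: algebra_simps)
qed simp

lemma central_binomial_ge:
  assumes "m \<ge> 1"
  shows "1 / (2 * sqrt m) \<le> real ((2 * m) choose m) / 4 ^ m"
  using assms
proof (induction m rule: nat_induct_at_least)
  case base
  then show ?case by (simp add: numeral_2_eq_2)
next
  case (Suc m)
  have "(2 * sqrt (m * (m + 1)))\<^sup>2 \<le> (real (2 * m + 1))\<^sup>2"
    by (simp add: power2_eq_square algebra_simps)
  then have "2 * sqrt (m * (m + 1)) \<le> real (2 * m + 1)"
    by (rule power2_le_imp_le) simp
  then have *: "2 * (sqrt m * sqrt (m + 1)) \<le> real (2 * m + 1)"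
    by (simp only: real_sqrt_mult of_nat_mult)
  have "1 / (2 * sqrt (real (Suc m))) = sqrt (m + 1) / (2 * (m + 1))"
  proof -
    define a where "a = sqrt (real (m + 1))"
    have "a > 0" "real m + 1 = a * a" "sqrt (real (Suc m)) = a" by (simp_all add: a_def add.commute)
    then have "1 / (2 * sqrt (real (Suc m))) = a / (2 * (a * a))" by simp
    then show ?thesis by (simp only: \<open>real m + 1 = a * a\<close>) (simp add: a_def add.commute)
  qed
  also have "\<dots> \<le> (real (2 * m + 1) / (2 * sqrt m)) / (2 * (m + 1))"
    using * Suc by (intro divide_right_mono) (simp_all add: field_simps)
  also have "\<dots> = (real (2 * m + 1) / real (2 * m + 2)) * (1 / (2 * sqrt m))"
    by (simp add: field_simps)
  also have "\<dots> \<le> (real (2 * m + 1) / real (2 * m + 2)) * (real ((2 * m) choose m) / 4 ^ m)"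
    by (intro mult_left_mono Suc) auto
  finally show ?case unfolding central_binomial_ratio .
qed

text \<open>
  By symmetry, a middle coefficient of an odd row is half of the middle coefficient of the next row, so
  odd numbers of trials inherit the estimates of the even ones.
\<close>

lemma odd_central_binomial:
  "real ((2 * m + 1) choose m) / 2 ^ (2 * m + 1) = real ((2 * Suc m) choose Suc m) / 4 ^ Suc m"
proof -
  have "Suc m * ((2 * Suc m) choose Suc m) = Suc m * (2 * ((2 * m + 1) choose m))"
    using Suc_times_binomial[of m "2 * m + 1"] by (simp add: algebra_simps)
  then have "(2 * Suc m) choose Suc m = 2 * ((2 * m + 1) choose m)"
    by (simp only: mult_cancel1) simp
  then show ?thesis by (simp add: power_mult)
qed

lemma pmf_fair_binomial: "pmf (binomial_pmf M (1/2)) b = real (M choose b) / 2 ^ M"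
proof (cases "b \<le> M")
  case True
  then have "(1/2::real) ^ b * (1/2) ^ (M - b) = 1 / 2 ^ M"
    by (simp add: power_add[symmetric] power_divide)
  then show ?thesis by (simp add: mult.assoc)
qed (simp add: binomial_eq_0)

lemma fair_binomial_le: "pmf (binomial_pmf M (1/2)) b \<le> 1 / sqrt (M + 1)"
proof -
  have "real (M choose b) / 2 ^ M \<le> real (M choose (M div 2)) / 2 ^ M"
    by (intro divide_right_mono of_nat_mono binomial_maximum) auto
  also have "\<dots> \<le> 1 / sqrt (M + 1)"
  proof (cases "even M")
    case True
    then obtain m where "M = 2 * m" by (elim evenE)
    then show ?thesis using central_binomial_le[of m] by (simp add: power_mult add.commute)
  next
    case False
    then obtain m where m: "M = 2 * m + 1" by (elim oddE)
    have "real (M choose (M div 2)) / 2 ^ M \<le> 1 / sqrt (2 * Suc m + 1)"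
      using central_binomial_le[of "Suc m"] unfolding odd_central_binomial[symmetric] m by simp
    also have "\<dots> \<le> 1 / sqrt (M + 1)" unfolding m by (intro divide_left_mono) auto
    finally show ?thesis .
  qed
  finally show ?thesis by (simp only: pmf_fair_binomial)
qed

lemma fair_binomial_mid_ge:
  assumes "M \<ge> 1"
  shows "1 / (2 * sqrt M) \<le> pmf (binomial_pmf M (1/2)) (M div 2)"
proof (cases "even M")
  case True
  then obtain m where m: "M = 2 * m" by (elim evenE)
  with assms have "m \<ge> 1" by simp
  have "1 / (2 * sqrt M) \<le> 1 / (2 * sqrt m)"
    unfolding m using \<open>m \<ge> 1\<close> by (intro divide_left_mono) auto
  also have "\<dots> \<le> pmf (binomial_pmf M (1/2)) (M div 2)"
    using central_binomial_ge[OF \<open>m \<ge> 1\<close>] unfolding pmf_fair_binomial m by (simp add: power_mult)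
  finally show ?thesis .
next
  case False
  then obtain m where m: "M = 2 * m + 1" by (elim oddE)
  have "1 / (2 * sqrt M) \<le> 1 / (2 * sqrt (Suc m))"
    unfolding m by (intro divide_left_mono) auto
  also have "\<dots> \<le> pmf (binomial_pmf M (1/2)) (M div 2)"
    using central_binomial_ge[of "Suc m"]
    unfolding odd_central_binomial[symmetric] pmf_fair_binomial m by simp
  finally show ?thesis .
qed

lemma exp_le_one_minus: "exp (- 2 * x) \<le> 1 - x" if "0 \<le> x" "x \<le> 1/2" for x :: real
proof -
  have "- 2 * x \<le> - x - 2 * x\<^sup>2"
    using that mult_right_mono[of "2 * x" 1 x] by (simp add: power2_eq_square)
  also have "\<dots> \<le> ln (1 - x)" using ln_one_minus_pos_lower_bound[of x] that by simp
  finally show ?thesis using that by (subst (asm) ln_ge_iff) auto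
qed

text \<open>
  Moving one place to the right multiplies the probability by \<open>(M - b) / (b + 1)\<close>, which within
  \<open>K * sqrt M\<close> of the centre is at least \<open>1 - 4 * K / sqrt M\<close>.  Only \<open>O(K * sqrt M)\<close> such moves
  are needed, so the total loss is a constant depending on \<open>K\<close>.
\<close>

lemma fair_binomial_right_ge:
  fixes K :: real
  assumes K: "K \<ge> 1" and M: "sqrt M \<ge> 8 * K" and t: "real (M div 2 + t) \<le> M / 2 + K * sqrt M"
  shows "exp (- 16 * K\<^sup>2) / (2 * sqrt M) \<le> pmf (binomial_pmf M (1/2)) (M div 2 + t)"
proof -
  have sM: "sqrt M > 0" using K M by linarith
  then have M1: "M \<ge> 1" by (cases M) auto
  have sq: "sqrt M * sqrt M = M" by simp
  define y where "y = 2 * K / sqrt M"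
  have y: "0 \<le> y" "y \<le> 1/4" using K M sM by (auto simp: y_def field_simps)
  have yM: "y * (M / 2) = K * sqrt M"
    using sM sq unfolding y_def by (simp add: field_simps)
  define r where "r = 1 - 2 * y"
  have r: "0 \<le> r" using y by (simp add: r_def)
  let ?p = "\<lambda>b. pmf (binomial_pmf M (1/2)) b"
  have "real (M div 2 + s) \<le> M / 2 + K * sqrt M \<Longrightarrow> ?p (M div 2) * r ^ s \<le> ?p (M div 2 + s)" for s
  proof (induction s)
    case (Suc s)
    define b where "b = M div 2 + s"
    have bM: "real b + 1 \<le> M / 2 * (1 + y)" using Suc.prems yM by (simp add: b_def algebra_simps)
    have "M / 2 * (1 + y) \<le> M / 2 * 2" using y by (intro mult_left_mono) auto
    then have bM': "b < M" using bM by simp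
    have "r * (real b + 1) \<le> r * (M / 2 * (1 + y))" using bM r by (intro mult_left_mono)
    also have "\<dots> \<le> (1 - y) * (M / 2)"
    proof -
      have "r * (1 + y) \<le> 1 - y" unfolding r_def using y by (simp add: algebra_simps)
      then have "(r * (1 + y)) * (M / 2) \<le> (1 - y) * (M / 2)" by (intro mult_right_mono) auto
      then show ?thesis by (simp add: mult.commute mult.left_commute)
    qed
    also have "(1 - y) * (M / 2) = real M - M / 2 * (1 + y)" by (simp add: field_simps)
    also have "\<dots> \<le> real M - b" using bM by linarith
    finally have ratio: "r * (real b + 1) \<le> real M - b" .
    have "Suc b * (M choose Suc b) = (M - b) * (M choose b)"
      using binomial_absorb_comp[of M b] Suc_times_binomial_eq[of "M-1" b] bM'
      by (metis binomial_absorption mult.commute)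
    then have "real (Suc b) * real (M choose Suc b) = real (M - b) * real (M choose b)"
      by (metis of_nat_mult)
    then have eq: "?p (Suc b) * (real b + 1) = (real M - b) * ?p b"
      using bM' unfolding pmf_fair_binomial by (simp add: field_simps of_nat_diff)
    have "?p (M div 2) * r ^ Suc s * (real b + 1) = (?p (M div 2) * r ^ s) * (r * (real b + 1))"
      by simp
    also have "\<dots> \<le> ?p b * (r * (real b + 1))"
      using Suc r unfolding b_def by (intro mult_right_mono) auto
    also have "\<dots> \<le> ?p b * (real M - b)" using ratio by (intro mult_left_mono) auto
    also have "\<dots> = ?p (Suc b) * (real b + 1)" using eq by (simp add: mult.commute)
    finally have "?p (M div 2) * r ^ Suc s \<le> ?p (Suc b)"
      by (rule mult_right_le_imp_le) simp
    then show ?case by (simp add: b_def)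
  qed simp
  note step = this[OF t]
  have tb: "real t \<le> 2 * K * sqrt M"
  proof -
    have "real (M div 2) \<ge> M / 2 - 1 / 2" by linarith
    moreover have "1/2 \<le> K * sqrt M"
    proof -
      have "1 * 1 \<le> K * sqrt M" using K M by (intro mult_mono) linarith+
      then show ?thesis by simp
    qed
    ultimately show ?thesis using t by simp
  qed
  have "exp (- 16 * K\<^sup>2) \<le> exp (- 2 * (2 * y)) ^ t"
  proof -
    have "4 * y * t \<le> 4 * y * (2 * K * sqrt M)" using tb y by (intro mult_left_mono) auto
    also have "\<dots> = 16 * K\<^sup>2" using sM by (simp add: y_def power2_eq_square)
    finally show ?thesis by (simp add: exp_of_nat_mult[symmetric] algebra_simps)
  qed
  also have "\<dots> \<le> r ^ t"
    using exp_le_one_minus[of "2 * y"] y unfolding r_def by (intro power_mono) auto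
  finally have "exp (- 16 * K\<^sup>2) \<le> r ^ t" .
  then have "1 / (2 * sqrt M) * exp (- 16 * K\<^sup>2) \<le> ?p (M div 2) * r ^ t"
    using fair_binomial_mid_ge[OF M1] by (intro mult_mono) auto
  with step show ?thesis by simp
qed

lemma fair_binomial_ge:
  fixes K :: real
  assumes K: "K \<ge> 1" and M: "sqrt M \<ge> 8 * K" and b: "\<bar>real b - M / 2\<bar> \<le> K * sqrt M"
  shows "exp (- 16 * K\<^sup>2) / (2 * sqrt M) \<le> pmf (binomial_pmf M (1/2)) b"
proof (cases "b \<ge> M div 2")
  case True
  then obtain t where t: "b = M div 2 + t" using le_Suc_ex by blast
  show ?thesis unfolding t using b unfolding t by (intro fair_binomial_right_ge K M) linarith
next
  case False
  then have bM: "b \<le> M" "M - b \<ge> M div 2" by auto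
  then obtain t where t: "M - b = M div 2 + t" using le_Suc_ex by blast
  have "exp (- 16 * K\<^sup>2) / (2 * sqrt M) \<le> pmf (binomial_pmf M (1/2)) (M div 2 + t)"
    using b bM unfolding t[symmetric] by (subst t, intro fair_binomial_right_ge K M)
      (simp add: t[symmetric] of_nat_diff abs_if split: if_splits)
  also have "\<dots> = pmf (binomial_pmf M (1/2)) b"
    unfolding t[symmetric] pmf_fair_binomial using bM by (simp add: binomial_symmetric[symmetric])
  finally show ?thesis .
qed

text \<open>
  The mean of \<open>1 / (i + 1)\<close> is explicit, because \<open>(k choose i) / (i + 1) = (Suc k choose Suc i) / (k + 1)\<close>
  turns it into an incomplete binomial sum; the mean of the square root is then controlled by the
  inequality of arithmetic and geometric means.
\<close>

lemma nn_integral_inverse_sqrt_binomial: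
  assumes \<beta>: "0 < \<beta>" "\<beta> < 1"
  shows "(\<integral>\<^sup>+i. ennreal (1 / sqrt (real i + 1)) \<partial>binomial_pmf k \<beta>)
           \<le> ennreal ((1 / \<beta> + 1) / (2 * sqrt (real k + 1)))"
proof -
  let ?c = "sqrt (real k + 1)"
  have c: "?c > 0" by simp
  have amgm: "1 / sqrt (real i + 1) \<le> (?c * (1 / (real i + 1)) + 1 / ?c) / 2" for i
  proof -
    define z where "z = 1 / sqrt (real i + 1)"
    have z2: "z * z = 1 / (real i + 1)" by (simp add: z_def)
    have "0 \<le> (?c * z - 1)\<^sup>2" by simp
    then have "2 * ?c * z \<le> ?c * ?c * (z * z) + 1"
      by (simp add: power2_eq_square algebra_simps)
    then have "z \<le> (?c * (z * z) + 1 / ?c) / 2"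
      using c by (simp add: field_simps del: real_sqrt_mult_self)
    then show ?thesis by (simp only: z2) (simp add: z_def)
  qed
  have E: "measure_pmf.expectation (binomial_pmf k \<beta>) (\<lambda>i. 1 / (real i + 1)) \<le> 1 / (\<beta> * (real k + 1))"
  proof -
    have "measure_pmf.expectation (binomial_pmf k \<beta>) (\<lambda>i. 1 / (real i + 1))
        = (\<Sum>i\<le>k. real (k choose i) * \<beta> ^ i * (1 - \<beta>) ^ (k - i) * (1 / (real i + 1)))"
      using \<beta> by (subst expectation_binomial_pmf') auto
    also have "\<dots> = (\<Sum>i\<le>k. real (Suc k choose Suc i) * \<beta> ^ Suc i * (1 - \<beta>) ^ (Suc k - Suc i)) / (\<beta> * (real k + 1))"
    proof (subst sum_divide_distrib, intro sum.cong refl)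
      fix i
      have "real (Suc i) * real (Suc k choose Suc i) = real (Suc k) * real (k choose i)"
        by (metis Suc_times_binomial of_nat_mult)
      then have *: "real (k choose i) / (real i + 1) = real (Suc k choose Suc i) / (real k + 1)"
        by (simp add: field_simps del: binomial_Suc_Suc)
      have "real (k choose i) * \<beta> ^ i * (1 - \<beta>) ^ (k - i) * (1 / (real i + 1))
          = (real (k choose i) / (real i + 1)) * (\<beta> ^ i * (1 - \<beta>) ^ (k - i))" by simp
      also have "\<dots> = real (Suc k choose Suc i) * \<beta> ^ Suc i * (1 - \<beta>) ^ (Suc k - Suc i) / (\<beta> * (real k + 1))"
        unfolding * using \<beta> by (simp add: divide_simps del: binomial_Suc_Suc)
      finally show "real (k choose i) * \<beta> ^ i * (1 - \<beta>) ^ (k - i) * (1 / (real i + 1)) = \<dots>" .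
    qed
    also have "(\<Sum>i\<le>k. real (Suc k choose Suc i) * \<beta> ^ Suc i * (1 - \<beta>) ^ (Suc k - Suc i))
        \<le> (\<Sum>i\<le>Suc k. real (Suc k choose i) * \<beta> ^ i * (1 - \<beta>) ^ (Suc k - i))"
      using \<beta> by (simp add: sum.atMost_Suc_shift[of _ k] del: binomial_Suc_Suc sum.atMost_Suc)
    also have "\<dots> = (\<beta> + (1 - \<beta>)) ^ Suc k" by (subst binomial_ring) simp
    finally show ?thesis using \<beta> by (simp add: divide_right_mono)
  qed
  have int: "integrable (measure_pmf (binomial_pmf k \<beta>)) (f :: nat \<Rightarrow> real)" for f
    using \<beta> by (intro integrable_binomial_pmf) auto
  have "measure_pmf.expectation (binomial_pmf k \<beta>) (\<lambda>i. 1 / sqrt (real i + 1))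
      \<le> measure_pmf.expectation (binomial_pmf k \<beta>) (\<lambda>i. (?c * (1 / (real i + 1)) + 1 / ?c) / 2)"
    by (intro integral_mono int amgm)
  also have "\<dots> = (?c * measure_pmf.expectation (binomial_pmf k \<beta>) (\<lambda>i. 1 / (real i + 1)) + 1 / ?c) / 2"
  proof -
    have "measure_pmf.expectation (binomial_pmf k \<beta>) (\<lambda>i. ?c * (1 / (real i + 1)) + 1 / ?c)
        = measure_pmf.expectation (binomial_pmf k \<beta>) (\<lambda>i. ?c * (1 / (real i + 1))) + 1 / ?c"
      by (subst Bochner_Integration.integral_add[OF int int]) simp
    also have "measure_pmf.expectation (binomial_pmf k \<beta>) (\<lambda>i. ?c * (1 / (real i + 1)))
        = ?c * measure_pmf.expectation (binomial_pmf k \<beta>) (\<lambda>i. 1 / (real i + 1))"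
      by (rule integral_mult_right_zero)
    finally show ?thesis by (subst integral_divide_zero) (rule arg_cong[where f = "\<lambda>x. x / 2"])
  qed
  also have "\<dots> \<le> (?c * (1 / (\<beta> * (real k + 1))) + 1 / ?c) / 2"
    using E c by (intro divide_right_mono add_right_mono mult_left_mono) auto
  also have "\<dots> = (1 / \<beta> + 1) / (2 * ?c)"
  proof -
    have alg: "(s * (1 / (\<beta> * (s * s))) + 1 / s) / 2 = (1 / \<beta> + 1) / (2 * s)" if "s > 0" for s :: real
      using that \<beta> by (simp add: field_simps)
    have "?c * ?c = real k + 1" by simp
    from alg[OF c, unfolded this] show ?thesis .
  qed
  finally show ?thesis
    by (subst nn_integral_eq_integral) (auto intro: int ennreal_leI)
qed

section \<open>Convolution powers, mixtures and Chebyshev's inequality\<close>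

definition conv_pmf :: "'a::comm_monoid_add pmf \<Rightarrow> 'a pmf \<Rightarrow> 'a pmf" where
  "conv_pmf p q = bind_pmf p (\<lambda>x. map_pmf (\<lambda>y. x + y) q)"

primrec conv_pow :: "nat \<Rightarrow> 'a::comm_monoid_add pmf \<Rightarrow> 'a pmf" where
  "conv_pow 0 p = return_pmf 0"
| "conv_pow (Suc n) p = conv_pmf p (conv_pow n p)"

lemma conv_pmf_commute: "conv_pmf p q = conv_pmf q p"
  unfolding conv_pmf_def map_pmf_def by (subst bind_commute_pmf) (simp add: add.commute)

lemma conv_pmf_assoc: "conv_pmf (conv_pmf p q) r = conv_pmf p (conv_pmf q r)"
  by (simp add: conv_pmf_def map_pmf_def bind_assoc_pmf bind_return_pmf add.assoc)

lemma conv_pmf_left_commute: "conv_pmf p (conv_pmf q r) = conv_pmf q (conv_pmf p r)"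
  by (metis conv_pmf_assoc conv_pmf_commute)

lemmas conv_pmf_ac = conv_pmf_assoc conv_pmf_commute conv_pmf_left_commute

lemma conv_pmf_return_0 [simp]: "conv_pmf (return_pmf 0) p = p" "conv_pmf p (return_pmf 0) = p"
  by (simp_all add: conv_pmf_def bind_return_pmf map_pmf_def bind_return_pmf')

lemma conv_pow_add: "conv_pow (m + n) p = conv_pmf (conv_pow m p) (conv_pow n p)"
  by (induction m) (simp_all add: conv_pmf_assoc)

lemma conv_pow_conv: "conv_pow n (conv_pmf p q) = conv_pmf (conv_pow n p) (conv_pow n q)"
  by (induction n) (simp_all add: conv_pmf_ac)

lemma conv_pow_double: "conv_pow (2 * n) p = conv_pow n (conv_pmf p p)"
  by (simp add: conv_pow_conv mult_2 conv_pow_add)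

lemma conv_bind1: "conv_pmf (bind_pmf p f) q = bind_pmf p (\<lambda>x. conv_pmf (f x) q)"
  by (simp add: conv_pmf_def bind_assoc_pmf)

lemma conv_bind2: "conv_pmf q (bind_pmf p f) = bind_pmf p (\<lambda>x. conv_pmf q (f x))"
  by (subst (1 2) conv_pmf_commute) (rule conv_bind1)

definition mix_pmf :: "real \<Rightarrow> 'a pmf \<Rightarrow> 'a pmf \<Rightarrow> 'a pmf" where
  "mix_pmf \<beta> p q = bind_pmf (bernoulli_pmf \<beta>) (\<lambda>b. if b then p else q)"

text \<open>
  Independent steps from a mixture: first decide how many steps come from \<open>p\<close>; by commutativity
  their positions do not matter.
\<close>

lemma conv_pow_mix:
  assumes "\<beta> \<in> {0..1}"
  shows "conv_pow k (mix_pmf \<beta> p q) =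
    bind_pmf (binomial_pmf k \<beta>) (\<lambda>i. conv_pmf (conv_pow i p) (conv_pow (k - i) q))"
proof (induction k)
  case 0
  show ?case by (subst binomial_pmf_0[OF assms]) (simp add: bind_return_pmf)
next
  case (Suc k)
  have "conv_pow (Suc k) (mix_pmf \<beta> p q) =
      bind_pmf (bernoulli_pmf \<beta>) (\<lambda>b. bind_pmf (binomial_pmf k \<beta>)
        (\<lambda>i. conv_pmf (if b then p else q) (conv_pmf (conv_pow i p) (conv_pow (k - i) q))))"
    unfolding conv_pow.simps Suc by (simp only: mix_pmf_def conv_bind1) (simp only: conv_bind2)
  also have "\<dots> = bind_pmf (bernoulli_pmf \<beta>) (\<lambda>b. bind_pmf (binomial_pmf k \<beta>)
        (\<lambda>i. conv_pmf (conv_pow (if b then Suc i else i) p)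
              (conv_pow (Suc k - (if b then Suc i else i)) q)))"
  proof (intro bind_pmf_cong refl)
    fix b i assume "i \<in> set_pmf (binomial_pmf k \<beta>)"
    then have "i \<le> k" using assms by (auto simp: set_pmf_binomial_eq split: if_splits)
    then show "conv_pmf (if b then p else q) (conv_pmf (conv_pow i p) (conv_pow (k - i) q))
        = conv_pmf (conv_pow (if b then Suc i else i) p) (conv_pow (Suc k - (if b then Suc i else i)) q)"
      by (simp add: conv_pmf_ac Suc_diff_le)
  qed
  also have "\<dots> = bind_pmf (binomial_pmf (Suc k) \<beta>) (\<lambda>i. conv_pmf (conv_pow i p) (conv_pow (Suc k - i) q))"
    unfolding binomial_pmf_Suc[OF assms] bind_assoc_pmf bind_return_pmf
    by (intro bind_pmf_cong refl) auto
  finally show ?case .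
qed

text \<open>
  Any two atoms of a distribution contain a fair coin: a small multiple of the uniform law on the
  two atoms lies below the distribution, and the normalized difference is the other component.
\<close>

lemma mixture_with_coin:
  assumes u: "u \<in> set_pmf D" and w: "w \<in> set_pmf D" and uw: "u \<noteq> w"
  shows "\<exists>\<beta> R. 0 < \<beta> \<and> \<beta> < 1 \<and> D = mix_pmf \<beta> (pmf_of_set {u, w}) R"
proof -
  \<comment> \<open>Dividing by \<open>2\<close> ensures \<open>\<beta> < 1\<close> so that the other component can be normalized.\<close>
  define \<beta> where "\<beta> = min (pmf D u) (pmf D w) / 2"
  let ?U = "pmf_of_set {u, w}"
  have pos: "pmf D u > 0" "pmf D w > 0" using u w by (simp_all add: pmf_positive)
  then have \<beta>: "0 < \<beta>" "\<beta> < 1"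
    using pmf_le_1[of D u] by (auto simp: \<beta>_def min_def split: if_splits intro: order.strict_trans1)
  have le: "\<beta> * pmf ?U x \<le> pmf D x" for x
    using pos uw by (auto simp: \<beta>_def indicator_def min_def split: if_splits)
  define f where "f x = (pmf D x - \<beta> * pmf ?U x) / (1 - \<beta>)" for x
  have f0: "f x \<ge> 0" for x using le[of x] \<beta> by (simp add: f_def)
  have "(\<integral>\<^sup>+x. ennreal (f x) \<partial>count_space UNIV) = 1"
  proof -
    have "(\<integral>\<^sup>+x. ennreal (f x) \<partial>count_space UNIV) * ennreal (1 - \<beta>)
         + ennreal \<beta> * (\<integral>\<^sup>+x. ennreal (pmf ?U x) \<partial>count_space UNIV)
        = (\<integral>\<^sup>+x. ennreal (f x) * ennreal (1 - \<beta>) + ennreal \<beta> * ennreal (pmf ?U x) \<partial>count_space UNIV)"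
      by (subst nn_integral_add) (auto simp: nn_integral_cmult nn_integral_multc)
    also have "\<dots> = (\<integral>\<^sup>+x. ennreal (pmf D x) \<partial>count_space UNIV)"
      using \<beta> f0 le
      by (intro nn_integral_cong) (auto simp: ennreal_mult[symmetric] ennreal_plus[symmetric] f_def
        simp del: ennreal_plus pmf_of_set)
    finally have eq: "(\<integral>\<^sup>+x. ennreal (f x) \<partial>count_space UNIV) * ennreal (1 - \<beta>) + ennreal \<beta> = 1"
      by (simp add: nn_integral_pmf_eq_1 del: pmf_of_set)
    let ?I = "\<integral>\<^sup>+x. ennreal (f x) \<partial>count_space UNIV"
    have "?I \<noteq> top"
      using eq \<beta> by (auto simp: ennreal_top_mult)
    then obtain r where r: "?I = ennreal r" "r \<ge> 0" by (metis ennreal_cases)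
    from eq have "ennreal (r * (1 - \<beta>) + \<beta>) = ennreal 1"
      using r \<beta> by (simp add: ennreal_mult ennreal_plus)
    then have "r * (1 - \<beta>) + \<beta> = 1" using r \<beta> by (subst (asm) ennreal_inj) auto
    then have "(r - 1) * (1 - \<beta>) = 0" by (simp add: algebra_simps)
    then have "r = 1" using \<beta> by simp
    then show ?thesis using r by simp
  qed
  note R = pmf_embed_pmf[OF f0 this]
  have "D = mix_pmf \<beta> ?U (embed_pmf f)"
  proof (rule pmf_eqI)
    fix x
    have "pmf (mix_pmf \<beta> ?U (embed_pmf f)) x = \<beta> * pmf ?U x + (1 - \<beta>) * f x"
      using \<beta> unfolding mix_pmf_def by (simp add: pmf_bind R del: pmf_of_set)
    then show "pmf D x = pmf (mix_pmf \<beta> ?U (embed_pmf f)) x"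
      using \<beta> by (simp add: f_def del: pmf_of_set)
  qed
  with \<beta> show ?thesis by blast
qed

lemma conv_pow_coin:
  fixes u1 e1 :: int and u2 e2 :: real
  assumes "(e1, e2) \<noteq> (0, 0)"
  shows "conv_pow i (pmf_of_set {(u1, u2), (u1 + e1, u2 + e2)}) =
    map_pmf (\<lambda>b. (int i * u1 + int b * e1, real i * u2 + real b * e2)) (binomial_pmf i (1/2))"
proof (induction i)
  case 0
  then show ?case by (simp add: binomial_pmf_0 zero_prod_def)
next
  case (Suc i)
  have coin: "pmf_of_set {(u1, u2), (u1 + e1, u2 + e2)} =
      map_pmf (\<lambda>b. (u1 + of_bool b * e1, u2 + of_bool b * e2)) (bernoulli_pmf (1/2))" (is "_ = map_pmf ?f _")
  proof -
    have "map_pmf ?f (bernoulli_pmf (1/2)) = map_pmf ?f (pmf_of_set UNIV)"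
      by (simp add: bernoulli_pmf_half_conv_pmf_of_set)
    also have "\<dots> = pmf_of_set (?f ` UNIV)"
      using assms by (intro map_pmf_of_set_inj) (auto simp: inj_on_def of_bool_def split: if_splits)
    also have "?f ` UNIV = {(u1, u2), (u1 + e1, u2 + e2)}" by (auto simp: UNIV_bool)
    finally show ?thesis by simp
  qed
  show ?case
    unfolding conv_pow.simps Suc unfolding coin
    by (simp add: conv_pmf_def bind_map_pmf binomial_pmf_Suc map_bind_pmf map_pmf_comp)
       (intro bind_pmf_cong refl, simp add: map_pmf_def bind_return_pmf,
        auto intro!: bind_pmf_cong simp: algebra_simps)
qed

lemma emeasure_conv_pmf:
  "emeasure (conv_pmf p q) A = (\<integral>\<^sup>+x. emeasure q {y. x + y \<in> A} \<partial>p)"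
  by (simp add: conv_pmf_def vimage_def)

lemma emeasure_conv_le:
  assumes "\<And>x. emeasure (measure_pmf q) {y. x + y \<in> A} \<le> B"
  shows "emeasure (conv_pmf p q) A \<le> B"
proof -
  have "emeasure (conv_pmf p q) A \<le> (\<integral>\<^sup>+x. B \<partial>p)"
    unfolding emeasure_conv_pmf by (intro nn_integral_mono assms)
  then show ?thesis by simp
qed

text \<open>
  Centred independent variables are orthogonal, so second moments add.  The statement also
  carries integrability and centring along, which makes it iterable.
\<close>

lemma sum_second_moment_pair:
  fixes X :: "'a \<Rightarrow> real" and Y :: "'b \<Rightarrow> real"
  assumes X2: "integrable (measure_pmf p) (\<lambda>x. (X x)\<^sup>2)" and X: "integrable (measure_pmf p) X"
    and Y2: "integrable (measure_pmf q) (\<lambda>x. (Y x)\<^sup>2)" and Y: "integrable (measure_pmf q) Y"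
    and EX: "measure_pmf.expectation p X = 0" and EY: "measure_pmf.expectation q Y = 0"
  shows "integrable (pair_pmf p q) (\<lambda>z. X (fst z) + Y (snd z))"
    and "measure_pmf.expectation (pair_pmf p q) (\<lambda>z. X (fst z) + Y (snd z)) = 0"
    and "integrable (pair_pmf p q) (\<lambda>z. (X (fst z) + Y (snd z))\<^sup>2)"
    and "measure_pmf.expectation (pair_pmf p q) (\<lambda>z. (X (fst z) + Y (snd z))\<^sup>2)
       = measure_pmf.expectation p (\<lambda>x. (X x)\<^sup>2) + measure_pmf.expectation q (\<lambda>x. (Y x)\<^sup>2)"
proof -
  have I1: "integrable (pair_pmf p q) (\<lambda>z. f (fst z))" if "integrable (measure_pmf p) f" for f :: "'a \<Rightarrow> real"
    using that integrable_map_pmf_eq[of fst "pair_pmf p q" f] by (simp add: map_fst_pair_pmf)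
  have I2: "integrable (pair_pmf p q) (\<lambda>z. f (snd z))" if "integrable (measure_pmf q) f" for f :: "'b \<Rightarrow> real"
    using that integrable_map_pmf_eq[of snd "pair_pmf p q" f] by (simp add: map_snd_pair_pmf)
  show "integrable (pair_pmf p q) (\<lambda>z. X (fst z) + Y (snd z))"
    by (intro Bochner_Integration.integrable_add I1 I2 X Y)
  show "measure_pmf.expectation (pair_pmf p q) (\<lambda>z. X (fst z) + Y (snd z)) = 0"
    by (subst Bochner_Integration.integral_add) (simp_all add: I1 I2 X Y EX EY)
  have IXY: "integrable (pair_pmf p q) (\<lambda>z. X (fst z) * Y (snd z))"
  proof (rule Bochner_Integration.integrable_bound)
    show "integrable (pair_pmf p q) (\<lambda>z. (X (fst z))\<^sup>2 + (Y (snd z))\<^sup>2)"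
      by (intro Bochner_Integration.integrable_add I1[OF X2] I2[OF Y2])
    show "AE z in pair_pmf p q. norm (X (fst z) * Y (snd z)) \<le> norm ((X (fst z))\<^sup>2 + (Y (snd z))\<^sup>2)"
    proof (intro always_eventually allI)
      fix z
      have "2 * (\<bar>X (fst z)\<bar> * \<bar>Y (snd z)\<bar>) \<le> (X (fst z))\<^sup>2 + (Y (snd z))\<^sup>2"
        using zero_le_power2[of "\<bar>X (fst z)\<bar> - \<bar>Y (snd z)\<bar>"] by (simp add: power2_eq_square algebra_simps)
      moreover have "0 \<le> \<bar>X (fst z)\<bar> * \<bar>Y (snd z)\<bar>" by simp
      ultimately show "norm (X (fst z) * Y (snd z)) \<le> norm ((X (fst z))\<^sup>2 + (Y (snd z))\<^sup>2)"
        unfolding real_norm_def abs_mult using zero_le_power2[of "X (fst z)"] zero_le_power2[of "Y (snd z)"]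
        by linarith
    qed
  qed simp
  have EXY: "measure_pmf.expectation (pair_pmf p q) (\<lambda>z. X (fst z) * Y (snd z)) = 0"
  proof -
    have sp: "Infinite_Set_Sum.abs_summable_on (\<lambda>x. pmf p x * X x) (set_pmf p)"
      using X unfolding measure_pmf_eq_density[of p]
      by (subst (asm) integrable_density)
        (auto simp: abs_summable_on_def[symmetric] intro: abs_summable_on_subset)
    have sq: "Infinite_Set_Sum.abs_summable_on (\<lambda>x. pmf q x * Y x) (set_pmf q)"
      using Y unfolding measure_pmf_eq_density[of q]
      by (subst (asm) integrable_density)
        (auto simp: abs_summable_on_def[symmetric] intro: abs_summable_on_subset)
    have "measure_pmf.expectation (pair_pmf p q) (\<lambda>z. X (fst z) * Y (snd z))
        = infsetsum (\<lambda>(x, y). (pmf p x * X x) * (pmf q y * Y y)) (set_pmf p \<times> set_pmf q)"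
      unfolding pmf_expectation_eq_infsetsum
      by (intro infsetsum_cong_neutral) (auto simp: pmf_pair set_pmf_iff)
    also have "\<dots> = infsetsum (\<lambda>x. pmf p x * X x) (set_pmf p) * infsetsum (\<lambda>y. pmf q y * Y y) (set_pmf q)"
      by (rule infsetsum_product[OF countable_set_pmf countable_set_pmf sp sq])
    also have "infsetsum (\<lambda>x. pmf p x * X x) (set_pmf p) = 0"
      using EX unfolding pmf_expectation_eq_infsetsum
      by (subst (asm) infsetsum_cong_neutral[of UNIV "set_pmf p" _ "\<lambda>x. pmf p x * X x"])
        (auto simp: set_pmf_iff)
    also have "0 * infsetsum (\<lambda>y. pmf q y * Y y) (set_pmf q) = 0" by simp
    finally show ?thesis .
  qed
  have eq: "(\<lambda>z. (X (fst z) + Y (snd z))\<^sup>2) = (\<lambda>z. (X (fst z))\<^sup>2 + (Y (snd z))\<^sup>2 + 2 * (X (fst z) * Y (snd z)))"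
    by (auto simp: power2_eq_square algebra_simps)
  show "integrable (pair_pmf p q) (\<lambda>z. (X (fst z) + Y (snd z))\<^sup>2)"
    unfolding eq by (intro Bochner_Integration.integrable_add I1[OF X2] I2[OF Y2] integrable_mult_right IXY)
  have "measure_pmf.expectation (pair_pmf p q) (\<lambda>z. (X (fst z) + Y (snd z))\<^sup>2)
     = measure_pmf.expectation (pair_pmf p q) (\<lambda>z. (X (fst z))\<^sup>2)
     + measure_pmf.expectation (pair_pmf p q) (\<lambda>z. (Y (snd z))\<^sup>2)
     + 2 * measure_pmf.expectation (pair_pmf p q) (\<lambda>z. X (fst z) * Y (snd z))"
    unfolding eq
    by (simp only: Bochner_Integration.integral_add Bochner_Integration.integrable_add I1[OF X2] I2[OF Y2]
         integrable_mult_right IXY integral_mult_right_zero)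
  also have "\<dots> = measure_pmf.expectation p (\<lambda>x. (X x)\<^sup>2) + measure_pmf.expectation q (\<lambda>x. (Y x)\<^sup>2)"
    using EXY expectation_pair_pmf_fst[of p q "\<lambda>x. (X x)\<^sup>2"] expectation_pair_pmf_snd[of p q "\<lambda>x. (Y x)\<^sup>2"]
    by simp
  finally show "measure_pmf.expectation (pair_pmf p q) (\<lambda>z. (X (fst z) + Y (snd z))\<^sup>2) = \<dots>" .
qed

lemma conv_pmf_altdef: "conv_pmf p q = map_pmf (\<lambda>z. fst z + snd z) (pair_pmf p q)"
  by (simp add: conv_pmf_def pair_pmf_def map_pmf_def bind_assoc_pmf bind_return_pmf)

lemma conv_pow_moments:
  fixes f :: "'a::comm_monoid_add \<Rightarrow> real"
  assumes add: "\<And>x y. f (x + y) = f x + f y"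
    and f2: "integrable (measure_pmf D) (\<lambda>x. (f x)\<^sup>2)"
  defines "\<mu> \<equiv> measure_pmf.expectation D f"
  shows "integrable (measure_pmf (conv_pow k D)) (\<lambda>x. f x - k * \<mu>) \<and>
    measure_pmf.expectation (conv_pow k D) (\<lambda>x. f x - k * \<mu>) = 0 \<and>
    integrable (measure_pmf (conv_pow k D)) (\<lambda>x. (f x - k * \<mu>)\<^sup>2) \<and>
    measure_pmf.expectation (conv_pow k D) (\<lambda>x. (f x - k * \<mu>)\<^sup>2)
      = k * measure_pmf.expectation D (\<lambda>x. (f x - \<mu>)\<^sup>2)"
proof (induction k)
  case 0
  have "f 0 = 0" using add[of 0 0] by simp
  then show ?case by (simp add: integrable_measure_pmf_finite)
next
  case (Suc k)
  have f1: "integrable (measure_pmf D) f"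
    by (rule measure_pmf.square_integrable_imp_integrable[OF _ f2]) simp
  have I1: "integrable (measure_pmf D) (\<lambda>x. f x - \<mu>)" using f1 by simp
  have E1: "measure_pmf.expectation D (\<lambda>x. f x - \<mu>) = 0" using f1 by (simp add: \<mu>_def)
  have I2: "integrable (measure_pmf D) (\<lambda>x. (f x - \<mu>)\<^sup>2)"
    unfolding power2_diff using f1 f2 by simp
  have eq: "f (fst z + snd z) - Suc k * \<mu> = (f (fst z) - \<mu>) + (f (snd z) - k * \<mu>)" for z
    by (simp add: add algebra_simps)
  note S = sum_second_moment_pair[OF I2 I1 conjunct1[OF conjunct2[OF conjunct2[OF Suc]]] conjunct1[OF Suc] E1
     conjunct1[OF conjunct2[OF Suc]]]
  show ?case
    unfolding conv_pow.simps conv_pmf_altdef integrable_map_pmf_eq integral_map_pmf eq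
    using S Suc by (simp add: algebra_simps)
qed

lemma conv_pow_chebyshev:
  fixes f :: "'a::comm_monoid_add \<Rightarrow> real"
  assumes add: "\<And>x y. f (x + y) = f x + f y"
    and f2: "integrable (measure_pmf D) (\<lambda>x. (f x)\<^sup>2)" and t: "t > 0"
  shows "measure_pmf.prob (conv_pow k D) {x. \<bar>f x - real k * measure_pmf.expectation D f\<bar> \<ge> t}
     \<le> real k * measure_pmf.expectation D (\<lambda>x. (f x - measure_pmf.expectation D f)\<^sup>2) / t\<^sup>2"
proof -
  let ?g = "\<lambda>x. (f x - real k * measure_pmf.expectation D f)\<^sup>2"
  note M = conv_pow_moments[of f D k, OF add f2]
  have "{x. \<bar>f x - real k * measure_pmf.expectation D f\<bar> \<ge> t} = {x \<in> space (measure_pmf (conv_pow k D)). ?g x \<ge> t\<^sup>2}"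
    using t abs_le_square_iff[of t] by auto
  also have "measure_pmf.prob (conv_pow k D) \<dots> \<le> measure_pmf.expectation (conv_pow k D) ?g / t\<^sup>2"
    using M t by (intro integral_Markov_inequality_measure[where A = "{}"]) auto
  finally show ?thesis using M by simp
qed

section \<open>A planar walk smoothed by fair coins\<close>

text \<open>
  The half-width \<open>1\<close> is that of the microcanonical constraint on the \<open>v\<close>-sum.
\<close>

definition strip :: "int \<Rightarrow> real \<Rightarrow> (int \<times> real) set" where
  "strip s x = {z. fst z = s \<and> \<bar>snd z - x\<bar> \<le> 1}"

lemma strip_shift: "{z. w + z \<in> strip s x} = strip (s - fst w) (x - snd w)"
  by (auto simp: strip_def algebra_simps)

lemma card_nat_diameter:
  fixes A :: "nat set" and L :: real
  assumes diam: "\<And>a b. a \<in> A \<Longrightarrow> b \<in> A \<Longrightarrow> \<bar>real a - real b\<bar> \<le> L" and L: "L \<ge> 0"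
  shows "finite A" and "real (card A) \<le> L + 1"
proof -
  have "finite A \<and> real (card A) \<le> L + 1"
  proof (cases "A = {}")
    case False
    define m where "m = (LEAST a. a \<in> A)"
    have m: "m \<in> A" "\<And>a. a \<in> A \<Longrightarrow> m \<le> a"
      using False unfolding m_def by (auto intro: LeastI Least_le)
    have sub: "A \<subseteq> {m..m + nat \<lfloor>L\<rfloor>}"
    proof
      fix a assume a: "a \<in> A"
      with m have "real a - real m \<le> L" "m \<le> a" using diam[OF a m(1)] by auto
      then have "int a - int m \<le> \<lfloor>L\<rfloor>" by (simp add: le_floor_iff)
      then show "a \<in> {m..m + nat \<lfloor>L\<rfloor>}" using \<open>m \<le> a\<close> L by auto
    qed
    then have "finite A" by (rule finite_subset) simp
    moreover have "card A \<le> nat \<lfloor>L\<rfloor> + 1" using card_mono[OF _ sub] by simp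
    moreover have "real (nat \<lfloor>L\<rfloor>) \<le> L" using L by (simp add: of_nat_nat)
    ultimately show ?thesis by (auto intro: order_trans[OF of_nat_mono])
  qed (use L in simp)
  then show "finite A" "real (card A) \<le> L + 1" by blast+
qed

lemma fair_binomial_window:
  fixes d z :: real
  assumes "d \<noteq> 0"
  shows "emeasure (binomial_pmf l (1/2)) {b. \<bar>z + real b * d\<bar> \<le> 1}
    \<le> ennreal ((2 / \<bar>d\<bar> + 1) / sqrt (real l + 1))"
proof -
  let ?A = "{b. \<bar>z + real b * d\<bar> \<le> 1}"
  have diam: "\<bar>real a - real b\<bar> \<le> 2 / \<bar>d\<bar>" if "a \<in> ?A" "b \<in> ?A" for a b
  proof -
    have "\<bar>(real a - real b) * d\<bar> \<le> 2"
      using that by (simp add: left_diff_distrib)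
    then have "\<bar>real a - real b\<bar> * \<bar>d\<bar> \<le> 2" by (simp only: abs_mult)
    then show ?thesis using assms by (subst pos_le_divide_eq) auto
  qed
  note A = card_nat_diameter[of ?A, OF diam]
  have "measure_pmf.prob (binomial_pmf l (1/2)) ?A = (\<Sum>b\<in>?A. pmf (binomial_pmf l (1/2)) b)"
    using A assms by (intro measure_measure_pmf_finite) auto
  also have "\<dots> \<le> (\<Sum>b\<in>?A. 1 / sqrt (real l + 1))"
    using fair_binomial_le[of l] by (intro sum_mono) (simp add: add.commute)
  also have "\<dots> = real (card ?A) / sqrt (real l + 1)" by simp
  also have "\<dots> \<le> (2 / \<bar>d\<bar> + 1) / sqrt (real l + 1)"
    using A assms by (intro divide_right_mono) auto
  finally show ?thesis by (simp add: measure_pmf.emeasure_eq_measure ennreal_leI)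
qed

text \<open>
  Coins of the first kind sit on single steps and move the walk by \<open>(1, h)\<close>; coins of the second
  kind sit on pairs of steps and move it by \<open>(0, d)\<close>.  As \<open>\<bar>d\<bar> \<le> 1\<close>, every translate of the lattice
  of multiples of \<open>d\<close> meets each interval of length \<open>2\<close>.
\<close>

locale coin_walk =
  fixes D :: "(int \<times> real) pmf" and u1 y1 :: int and u2 y2 h d \<beta>1 \<beta>2 :: real
    and R1 R2 :: "(int \<times> real) pmf"
  assumes D: "D = mix_pmf \<beta>1 (pmf_of_set {(u1, u2), (u1 + 1, u2 + h)}) R1"
    and DD: "conv_pmf D D = mix_pmf \<beta>2 (pmf_of_set {(y1, y2), (y1 + 0, y2 + d)}) R2"
    and \<beta>1: "0 < \<beta>1" "\<beta>1 < 1" and \<beta>2: "0 < \<beta>2" "\<beta>2 < 1"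
    and d: "d \<noteq> 0" "\<bar>d\<bar> \<le> 1"
begin

text \<open>
  The contribution of \<open>i\<close> coins of the first kind and \<open>l\<close> coins of the second kind, of
  which \<open>b\<close> and \<open>c\<close> respectively show the second alternative.
\<close>

definition coin_sum :: "nat \<Rightarrow> nat \<Rightarrow> nat \<times> nat \<Rightarrow> int \<times> real" where
  "coin_sum i l = (\<lambda>(b, c). (int i * u1 + int b + int l * y1,
                     real i * u2 + real b * h + real l * y2 + real c * d))"

definition coins :: "nat \<Rightarrow> nat \<Rightarrow> (nat \<times> nat) pmf" where
  "coins i l = pair_pmf (binomial_pmf i (1/2)) (binomial_pmf l (1/2))"

definition rest :: "nat \<Rightarrow> nat \<Rightarrow> nat \<Rightarrow> nat \<Rightarrow> (int \<times> real) pmf" where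
  "rest k1 k2 i l = conv_pmf (conv_pow (k1 - i) R1) (conv_pow (k2 - l) R2)"

text \<open>
  The first \<open>k1\<close> steps are used one at a time and the last \<open>2 * k2\<close> in pairs.  The numbers \<open>i\<close> and
  \<open>l\<close> of coins are binomial, and given them the coins are independent of everything else.
\<close>

lemma conv_pow_decomp:
  "conv_pow (k1 + 2 * k2) D =
     bind_pmf (binomial_pmf k1 \<beta>1) (\<lambda>i. bind_pmf (binomial_pmf k2 \<beta>2) (\<lambda>l.
       conv_pmf (rest k1 k2 i l) (map_pmf (coin_sum i l) (coins i l))))"
proof -
  have coin_sum: "conv_pmf (conv_pow i (pmf_of_set {(u1, u2), (u1 + 1, u2 + h)}))
      (conv_pow l (pmf_of_set {(y1, y2), (y1 + 0, y2 + d)})) = map_pmf (coin_sum i l) (coins i l)" for i l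
    using d by (subst (1 2) conv_pow_coin)
      (auto simp: conv_pmf_altdef map_pair[symmetric] map_pmf_comp coins_def coin_sum_def case_prod_unfold algebra_simps)
  have "conv_pow (k1 + 2 * k2) D = conv_pmf (conv_pow k1 D) (conv_pow k2 (conv_pmf D D))"
    by (simp add: conv_pow_add conv_pow_double)
  also have "conv_pow k1 D = bind_pmf (binomial_pmf k1 \<beta>1) (\<lambda>i.
      conv_pmf (conv_pow i (pmf_of_set {(u1, u2), (u1 + 1, u2 + h)})) (conv_pow (k1 - i) R1))"
    unfolding D using \<beta>1 by (subst conv_pow_mix) auto
  also have "conv_pow k2 (conv_pmf D D) = bind_pmf (binomial_pmf k2 \<beta>2) (\<lambda>l.
      conv_pmf (conv_pow l (pmf_of_set {(y1, y2), (y1 + 0, y2 + d)})) (conv_pow (k2 - l) R2))"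
    unfolding DD using \<beta>2 by (subst conv_pow_mix) auto
  also have "conv_pmf (bind_pmf (binomial_pmf k1 \<beta>1) (\<lambda>i.
      conv_pmf (conv_pow i (pmf_of_set {(u1, u2), (u1 + 1, u2 + h)})) (conv_pow (k1 - i) R1)))
     (bind_pmf (binomial_pmf k2 \<beta>2) (\<lambda>l.
      conv_pmf (conv_pow l (pmf_of_set {(y1, y2), (y1 + 0, y2 + d)})) (conv_pow (k2 - l) R2)))
    = bind_pmf (binomial_pmf k1 \<beta>1) (\<lambda>i. bind_pmf (binomial_pmf k2 \<beta>2) (\<lambda>l.
       conv_pmf (rest k1 k2 i l) (map_pmf (coin_sum i l) (coins i l))))"
    unfolding conv_bind1 unfolding conv_bind2 unfolding coin_sum[symmetric] rest_def
    by (intro bind_pmf_cong refl) (simp add: conv_pmf_ac)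
  finally show ?thesis .
qed

text \<open>
  The first coordinate determines \<open>b\<close>, and then the second coordinate confines \<open>c\<close> to an interval
  of length \<open>2 / \<bar>d\<bar>\<close>.
\<close>

lemma coins_strip_le:
  "emeasure (map_pmf (coin_sum i l) (coins i l)) (strip s x)
     \<le> ennreal (1 / sqrt (real i + 1)) * ennreal ((2 / \<bar>d\<bar> + 1) / sqrt (real l + 1))"
proof -
  let ?c = "ennreal ((2 / \<bar>d\<bar> + 1) / sqrt (real l + 1))"
  define b0 where "b0 = nat (s - int i * u1 - int l * y1)"
  have "emeasure (map_pmf (coin_sum i l) (coins i l)) (strip s x)
      = (\<integral>\<^sup>+b. emeasure (binomial_pmf l (1/2)) {c. coin_sum i l (b, c) \<in> strip s x} \<partial>binomial_pmf i (1/2))"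
    by (simp add: coins_def pair_pmf_def vimage_def map_pmf_def[symmetric])
  also have "\<dots> \<le> (\<integral>\<^sup>+b. ?c * indicator {b0} b \<partial>binomial_pmf i (1/2))"
  proof (rule nn_integral_mono)
    fix b
    show "emeasure (binomial_pmf l (1/2)) {c. coin_sum i l (b, c) \<in> strip s x} \<le> ?c * indicator {b0} b"
    proof (cases "b = b0")
      case True
      have "emeasure (binomial_pmf l (1/2)) {c. coin_sum i l (b, c) \<in> strip s x}
        \<le> emeasure (binomial_pmf l (1/2)) {c. \<bar>(real i * u2 + real b * h + real l * y2 - x) + real c * d\<bar> \<le> 1}"
        by (intro emeasure_mono) (auto simp: coin_sum_def strip_def algebra_simps)
      also have "\<dots> \<le> ?c" by (rule fair_binomial_window) (rule d)
      finally show ?thesis using True by simp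
    next
      case False
      then have "{c. coin_sum i l (b, c) \<in> strip s x} = {}" by (auto simp: coin_sum_def strip_def b0_def)
      then show ?thesis by simp
    qed
  qed
  also have "\<dots> = ?c * ennreal (pmf (binomial_pmf i (1/2)) b0)"
    by (simp add: nn_integral_cmult emeasure_pmf_single del: pmf_binomial)
  also have "\<dots> \<le> ?c * ennreal (1 / sqrt (real i + 1))"
    using fair_binomial_le[of i b0] by (intro mult_left_mono ennreal_leI) (auto simp: add.commute)
  finally show ?thesis by (simp add: mult.commute)
qed

text \<open>
  Average \<open>coins_strip_le\<close> over the numbers of coins, which are binomial with about \<open>k / 3\<close> trials
  each; each of the two factors contributes \<open>O(1 / sqrt k)\<close>.
\<close>

lemma prob_strip_le:
  "\<exists>C>0. \<forall>k s x. measure_pmf.prob (conv_pow k D) (strip s x) \<le> C / (real k + 1)"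
proof -
  define N where "N = 2 / \<bar>d\<bar> + 1"
  have N: "N > 0" using d by (simp add: N_def add_pos_pos)
  define C1 where "C1 = (1 / \<beta>1 + 1) / 2"
  define C2 where "C2 = (1 / \<beta>2 + 1) / 2"
  have C: "C1 > 0" "C2 > 0" using \<beta>1 \<beta>2 by (auto simp: C1_def C2_def add_pos_pos)
  have "measure_pmf.prob (conv_pow k D) (strip s x) \<le> (3 * C1 * C2 * N) / (real k + 1)" for k s x
  proof -
    define k2 where "k2 = k div 3"
    define k1 where "k1 = k - 2 * k2"
    have k: "k = k1 + 2 * k2" by (simp add: k1_def k2_def)
    have "real (k1 + 1) \<ge> (real k + 1) / 3" "real (k2 + 1) \<ge> (real k + 1) / 3"
    proof -
      obtain t where "k = 3 * k2 + t" "t < 3"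
        using that[of "k mod 3"] unfolding k2_def by simp
      then have "k + 1 \<le> 3 * (k1 + 1)" "k + 1 \<le> 3 * (k2 + 1)" using k by simp_all
      then have "real (k + 1) \<le> real (3 * (k1 + 1))" "real (k + 1) \<le> real (3 * (k2 + 1))"
        by (simp_all only: of_nat_le_iff)
      then show "real (k1 + 1) \<ge> (real k + 1) / 3" "real (k2 + 1) \<ge> (real k + 1) / 3" by simp_all
    qed
    then have "sqrt ((real k + 1) / 3 * ((real k + 1) / 3)) \<le> sqrt ((real k1 + 1) * (real k2 + 1))"
      by (intro real_sqrt_le_mono mult_mono) auto
    then have kk: "(real k + 1) / 3 \<le> sqrt (real k1 + 1) * sqrt (real k2 + 1)"
      by (simp only: real_sqrt_mult real_sqrt_mult_self)
    have "emeasure (conv_pow k D) (strip s x)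
       \<le> (\<integral>\<^sup>+i. \<integral>\<^sup>+l. ennreal (1 / sqrt (real i + 1)) * (ennreal N * ennreal (1 / sqrt (real l + 1)))
             \<partial>binomial_pmf k2 \<beta>2 \<partial>binomial_pmf k1 \<beta>1)"
      unfolding k conv_pow_decomp emeasure_bind_pmf
    proof (intro nn_integral_mono emeasure_conv_le)
      fix i l w
      have "ennreal ((2 / \<bar>d\<bar> + 1) / sqrt (real l + 1)) = ennreal N * ennreal (1 / sqrt (real l + 1))"
        using N by (subst ennreal_mult[symmetric]) (auto simp: N_def)
      with coins_strip_le[of i l "s - fst w" "x - snd w"]
      show "emeasure (map_pmf (coin_sum i l) (coins i l)) {z. w + z \<in> strip s x}
        \<le> ennreal (1 / sqrt (real i + 1)) * (ennreal N * ennreal (1 / sqrt (real l + 1)))"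
        unfolding strip_shift by simp
    qed
    also have "\<dots> = (\<integral>\<^sup>+i. ennreal (1 / sqrt (real i + 1)) \<partial>binomial_pmf k1 \<beta>1) *
         (ennreal N * (\<integral>\<^sup>+l. ennreal (1 / sqrt (real l + 1)) \<partial>binomial_pmf k2 \<beta>2))"
      by (simp add: nn_integral_cmult nn_integral_multc)
    also have "\<dots> \<le> ennreal (C1 / sqrt (real k1 + 1)) * (ennreal N * ennreal (C2 / sqrt (real k2 + 1)))"
      using nn_integral_inverse_sqrt_binomial[OF \<beta>1, of k1] nn_integral_inverse_sqrt_binomial[OF \<beta>2, of k2]
      unfolding C1_def C2_def divide_divide_eq_left by (intro mult_mono) auto
    also have "\<dots> = ennreal (C1 * C2 * N / (sqrt (real k1 + 1) * sqrt (real k2 + 1)))"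
      using C N by (simp add: ennreal_mult[symmetric] mult_ac)
    also have "\<dots> \<le> ennreal (C1 * C2 * N / ((real k + 1) / 3))"
      using C N kk by (intro ennreal_leI divide_left_mono mult_pos_pos mult_nonneg_nonneg) auto
    also have "C1 * C2 * N / ((real k + 1) / 3) = (3 * C1 * C2 * N) / (real k + 1)" by simp
    finally show ?thesis
      using C N by (subst (asm) measure_pmf.emeasure_eq_measure) (simp add: ennreal_le_iff)
  qed
  then show ?thesis using C N by (intro exI[of _ "3 * C1 * C2 * N"]) auto
qed

text \<open>
  The point \<open>(b, c)\<close> is any typical outcome of the coins for which the walk ends within
  \<open>O(sqrt k)\<close> of the target.  Correcting \<open>b\<close> so that the first coordinate is exact, and then \<open>c\<close> so
  that the second one is off by at most \<open>\<bar>d\<bar> / 2\<close>, changes them by \<open>O(sqrt k)\<close> only.  The corrected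
  outcome is still in the range where binomial probabilities are of order \<open>1 / sqrt k\<close>.
\<close>

lemma coins_strip_ge:
  fixes s :: int and x K \<delta> :: real and k :: nat
  defines "L \<equiv> (3 * K + 2 * K * (1 + \<bar>h\<bar>) / \<bar>d\<bar> + 1) / sqrt \<delta>"
  assumes K: "K \<ge> 1" and k: "k \<ge> 1" and \<delta>: "0 < \<delta>" "\<delta> \<le> 1"
    and i: "\<delta> * k \<le> i" "i \<le> k" and l: "\<delta> * k \<le> l" "l \<le> k"
    and big: "8 * L \<le> sqrt \<delta> * sqrt k"
    and b: "\<bar>real b - i / 2\<bar> \<le> K * sqrt k" and c: "\<bar>real c - l / 2\<bar> \<le> K * sqrt k"
    and T1: "\<bar>of_int (s - fst (w + coin_sum i l (b, c)))\<bar> \<le> 2 * K * sqrt k"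
    and T2: "\<bar>x - snd (w + coin_sum i l (b, c))\<bar> \<le> 2 * K * sqrt k"
  shows "(exp (- 16 * L\<^sup>2) / 2)\<^sup>2 / k
     \<le> measure_pmf.prob (map_pmf (coin_sum i l) (coins i l)) {z. w + z \<in> strip s x}"
proof -
  \<comment> \<open>\<open>M * sqrt k\<close> bounds the distance of both corrected coin counts from their means; \<open>L\<close> is the same in units of \<open>sqrt i\<close>.\<close>
  define M where "M = 3 * K + 2 * K * (1 + \<bar>h\<bar>) / \<bar>d\<bar> + 1"
  define t1 where "t1 = s - fst (w + coin_sum i l (b, c))"
  define t2 where "t2 = x - snd (w + coin_sum i l (b, c))"
  define m where "m = round ((t2 - of_int t1 * h) / d)"
  have sk: "sqrt k \<ge> 1" using k by simp
  have M_eq: "M = L * sqrt \<delta>" using \<delta> by (simp add: M_def L_def)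
  have M3: "M \<ge> 3 * K" using K d by (simp add: M_def)
  have L1: "L \<ge> 1"
  proof -
    have "sqrt \<delta> \<le> M" using \<delta> M3 K real_sqrt_le_1_iff[of \<delta>] by linarith
    then have "sqrt \<delta> \<le> L * sqrt \<delta>" using M_eq by simp
    then show ?thesis using \<delta> by (simp add: mult_le_cancel_right1)
  qed
  have scale: "M * sqrt k \<le> L * sqrt j" "8 * L \<le> sqrt j" if "\<delta> * k \<le> j" for j :: nat
  proof -
    have *: "sqrt \<delta> * sqrt k \<le> sqrt j"
      using that by (simp flip: real_sqrt_mult)
    then have "L * (sqrt \<delta> * sqrt k) \<le> L * sqrt j" using L1 by (intro mult_left_mono) auto
    then show "M * sqrt k \<le> L * sqrt j" "8 * L \<le> sqrt j" using * big by (simp_all add: M_eq mult.assoc)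
  qed
  have rnd: "\<bar>of_int m - (t2 - of_int t1 * h) / d\<bar> \<le> 1 / 2"
    unfolding m_def by (rule of_int_round_abs_le)
  have b0: "\<bar>real_of_int (int b + t1) - i / 2\<bar> \<le> M * sqrt k"
  proof -
    have "\<bar>real_of_int (int b + t1) - i / 2\<bar> \<le> K * sqrt k + 2 * K * sqrt k"
      using b T1 unfolding t1_def[symmetric] by simp
    also have "\<dots> = (3 * K) * sqrt k" by simp
    also have "\<dots> \<le> M * sqrt k" using M3 by (intro mult_right_mono) auto
    finally show ?thesis .
  qed
  have c0: "\<bar>real_of_int (int c + m) - l / 2\<bar> \<le> M * sqrt k"
  proof -
    have "\<bar>t2 - of_int t1 * h\<bar> \<le> \<bar>t2\<bar> + \<bar>of_int t1\<bar> * \<bar>h\<bar>"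
      by (metis abs_mult abs_triangle_ineq4)
    also have "\<dots> \<le> 2 * K * sqrt k + 2 * K * sqrt k * \<bar>h\<bar>"
      using T1 T2 unfolding t1_def t2_def by (intro add_mono mult_right_mono) auto
    finally have "\<bar>(t2 - of_int t1 * h) / d\<bar> \<le> (2 * K * sqrt k + 2 * K * sqrt k * \<bar>h\<bar>) / \<bar>d\<bar>"
      by (simp add: divide_right_mono)
    also have "\<dots> = 2 * K * (1 + \<bar>h\<bar>) / \<bar>d\<bar> * sqrt k" by (simp add: algebra_simps)
    finally have q0: "\<bar>(t2 - of_int t1 * h) / d\<bar> \<le> 2 * K * (1 + \<bar>h\<bar>) / \<bar>d\<bar> * sqrt k" .
    have "\<bar>real_of_int (int c + m) - l / 2\<bar>
        \<le> K * sqrt k + (2 * K * (1 + \<bar>h\<bar>) / \<bar>d\<bar> * sqrt k + sqrt k)"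
    proof -
      have "\<bar>c1 + m1 - l1\<bar> \<le> X + (Q + Y)"
        if "\<bar>q\<bar> \<le> Q" "\<bar>m1 - q\<bar> \<le> 1 / 2" "\<bar>c1 - l1\<bar> \<le> X" "1 \<le> Y" for c1 m1 l1 q Q X Y :: real
        using that by linarith
      from this[OF q0 rnd c sk] show ?thesis by simp
    qed
    also have "\<dots> \<le> M * sqrt k"
      unfolding M_def using K sk by (simp add: algebra_simps)
    finally show ?thesis .
  qed
  have nonneg: "j0 \<ge> 0" if "\<bar>real_of_int j0 - j / 2\<bar> \<le> M * sqrt k" "\<delta> * k \<le> j" for j0 and j :: nat
  proof -
    have "8 * (L * sqrt j) \<le> sqrt j * sqrt j"
      using mult_right_mono[OF scale(2)[OF that(2)], of "sqrt j"] by simp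
    then have "M * sqrt k \<le> j / 8" using scale(1)[OF that(2)] by simp
    then have "real_of_int j0 \<ge> 0" using that(1) by simp
    then show ?thesis by simp
  qed
  obtain b' where b': "int b + t1 = int b'" using nonneg[OF b0 i(1)] nonneg_int_cases by metis
  obtain c' where c': "int c + m = int c'" using nonneg[OF c0 l(1)] nonneg_int_cases by metis
  have lower: "exp (- 16 * L\<^sup>2) / (2 * sqrt k) \<le> pmf (binomial_pmf j (1/2)) j'"
    if "\<bar>real j' - j / 2\<bar> \<le> M * sqrt k" "\<delta> * k \<le> j" "j \<le> k" for j j'
  proof -
    have "0 < \<delta> * k" using \<delta> k by simp
    then have "real j > 0" using that(2) by linarith
    then have "exp (- 16 * L\<^sup>2) / (2 * sqrt k) \<le> exp (- 16 * L\<^sup>2) / (2 * sqrt j)"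
      using that(3) by (intro divide_left_mono) auto
    also have "\<dots> \<le> pmf (binomial_pmf j (1/2)) j'"
      using L1 scale[OF that(2)] that(1) by (intro fair_binomial_ge) auto
    finally show ?thesis .
  qed
  have in_strip: "w + coin_sum i l (b', c') \<in> strip s x"
  proof -
    have 1: "fst (w + coin_sum i l (b', c')) = s"
      using b' by (simp add: coin_sum_def t1_def)
    have b'': "real b' = real b + of_int t1" using b' by (metis of_int_add of_int_of_nat_eq)
    have c'': "real c' = real c + of_int m" using c' by (metis of_int_add of_int_of_nat_eq)
    have "snd (w + coin_sum i l (b', c')) - x = of_int t1 * h + of_int m * d - t2"
      by (simp add: coin_sum_def t2_def b'' c'' algebra_simps)
    also have "\<dots> = (of_int m - (t2 - of_int t1 * h) / d) * d"
      using d by (simp add: field_simps)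
    also have "\<bar>\<dots>\<bar> \<le> 1 / 2 * 1"
      unfolding abs_mult using rnd d by (intro mult_mono) auto
    finally show ?thesis using 1 by (simp add: strip_def)
  qed
  have "(exp (- 16 * L\<^sup>2) / 2)\<^sup>2 / k = (exp (- 16 * L\<^sup>2) / (2 * sqrt k)) * (exp (- 16 * L\<^sup>2) / (2 * sqrt k))"
    by (simp add: power2_eq_square)
  also have "\<dots> \<le> pmf (binomial_pmf i (1/2)) b' * pmf (binomial_pmf l (1/2)) c'"
    using b0 c0 i l unfolding b' c' by (intro mult_mono lower) auto
  also have "\<dots> = measure_pmf.prob (coins i l) {(b', c')}"
    by (subst measure_pmf_single) (simp add: coins_def pmf_pair del: pmf_binomial)
  also have "\<dots> \<le> measure_pmf.prob (coins i l) (coin_sum i l -` {z. w + z \<in> strip s x})"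
    using in_strip by (intro measure_pmf.finite_measure_mono) auto
  finally show ?thesis by simp
qed

text \<open>
  The nesting of the pairs separates the coin outcomes from the variables on which one conditions: the
  numbers of coins and the part \<open>w\<close> of the walk that is made without coins.
\<close>

definition joint :: "nat \<Rightarrow> nat \<Rightarrow> ((nat \<times> nat \<times> (int \<times> real)) \<times> (nat \<times> nat)) pmf" where
  "joint k1 k2 = bind_pmf (binomial_pmf k1 \<beta>1) (\<lambda>i. bind_pmf (binomial_pmf k2 \<beta>2) (\<lambda>l.
       bind_pmf (rest k1 k2 i l) (\<lambda>w. map_pmf (\<lambda>bc. ((i, l, w), bc)) (coins i l))))"

lemma conv_pow_eq_joint:
  "conv_pow (k1 + 2 * k2) D = map_pmf (\<lambda>((i, l, w), bc). w + coin_sum i l bc) (joint k1 k2)"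
  by (simp add: conv_pow_decomp joint_def map_bind_pmf map_pmf_comp conv_pmf_def)

text \<open>
  Integrating over all randomness except the coins: it suffices that the coins reach the target
  with conditional probability at least \<open>c\<close> on a good event of the remaining variables.
\<close>

lemma prob_strip_ge_good:
  assumes c: "c \<ge> 0" and good: "\<And>i l w. (i, l, w) \<in> Good \<Longrightarrow>
    c \<le> measure_pmf.prob (map_pmf (coin_sum i l) (coins i l)) {z. w + z \<in> A}"
  shows "c * measure_pmf.prob (joint k1 k2) (fst -` Good)
      \<le> measure_pmf.prob (conv_pow (k1 + 2 * k2) D) A"
proof -
  have "ennreal c * emeasure (joint k1 k2) (fst -` Good)
      = (\<integral>\<^sup>+i. \<integral>\<^sup>+l. \<integral>\<^sup>+w. ennreal c * indicator Good (i, l, w) \<partial>rest k1 k2 i l \<partial>binomial_pmf k2 \<beta>2 \<partial>binomial_pmf k1 \<beta>1)"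
  proof -
    have ind: "emeasure (measure_pmf (coins i l)) (if (i, l, w) \<in> Good then UNIV else {}) = indicator Good (i, l, w)" for i l w
      by (cases "(i, l, w) \<in> Good") auto
    show ?thesis by (simp add: joint_def vimage_def ind nn_integral_cmult)
  qed
  also have "\<dots> \<le> emeasure (conv_pow (k1 + 2 * k2) D) A"
    unfolding conv_pow_decomp emeasure_bind_pmf emeasure_conv_pmf
  proof (intro nn_integral_mono)
    fix i l w
    show "ennreal c * indicator Good (i, l, w) \<le> emeasure (map_pmf (coin_sum i l) (coins i l)) {z. w + z \<in> A}"
      using good[of i l w] by (cases "(i, l, w) \<in> Good")
        (simp_all only: measure_pmf.emeasure_eq_measure, simp_all add: ennreal_leI)
  qed
  finally show ?thesis
    using c by (simp add: measure_pmf.emeasure_eq_measure ennreal_mult[symmetric] ennreal_le_iff)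
qed

lemma joint_count_marginals:
  "map_pmf (\<lambda>z. fst (fst z)) (joint k1 k2) = binomial_pmf k1 \<beta>1"
  "map_pmf (\<lambda>z. fst (snd (fst z))) (joint k1 k2) = binomial_pmf k2 \<beta>2"
  by (simp_all add: joint_def map_bind_pmf map_pmf_comp bind_return_pmf')

text \<open>
  With probability at least \<open>1/2\<close>, there are at least \<open>\<delta> k\<close> coins of each kind, their outcomes \<open>b\<close>
  and \<open>c\<close> are within \<open>K * sqrt k\<close> of their means, and so are both coordinates of the walk: each of the six ways
  to fail has probability at most \<open>1/16\<close>, by Chebyshev's inequality for the walk and by
  Hoeffding's inequality for the binomial variables.  The existence of such an outcome depends only on
  the variables other than the coins and makes them good in the sense of \<open>coins_strip_ge\<close>.
\<close>

lemma prob_strip_ge: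
  fixes B :: real
  assumes int1: "integrable (measure_pmf D) (\<lambda>z. (real_of_int (fst z))\<^sup>2)"
    and int2: "integrable (measure_pmf D) (\<lambda>z. (snd z)\<^sup>2)"
  defines "\<mu>1 \<equiv> measure_pmf.expectation D (\<lambda>z. real_of_int (fst z))"
    and "\<mu>2 \<equiv> measure_pmf.expectation D snd"
  shows "\<exists>c>0. \<forall>\<^sub>F k in sequentially. \<forall>s x.
    \<bar>of_int s - real k * \<mu>1\<bar> \<le> B \<longrightarrow> \<bar>x - real k * \<mu>2\<bar> \<le> B \<longrightarrow>
    c / real k \<le> measure_pmf.prob (conv_pow k D) (strip s x)"
proof -
  define v1 where "v1 = measure_pmf.expectation D (\<lambda>z. (real_of_int (fst z) - \<mu>1)\<^sup>2)"
  define v2 where "v2 = measure_pmf.expectation D (\<lambda>z. (snd z - \<mu>2)\<^sup>2)"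
  have v: "v1 \<ge> 0" "v2 \<ge> 0" by (simp_all add: v1_def v2_def)
  \<comment> \<open>\<open>K\<^sup>2 \<ge> 16 * v1\<close> makes the Chebyshev bound \<open>1/16\<close>, and \<open>K \<ge> 4\<close> does the same for the coins.\<close>
  define K where "K = 4 + 16 * v1 + 16 * v2"
  have K: "K \<ge> 4" "K \<ge> 16 * v1" "K \<ge> 16 * v2" using v by (auto simp: K_def)
  have "K * 4 \<le> K * K" using K by (intro mult_left_mono) auto
  then have K2: "K\<^sup>2 \<ge> 16" "K\<^sup>2 \<ge> 16 * v1" "K\<^sup>2 \<ge> 16 * v2" using K unfolding power2_eq_square by linarith+
  define \<delta> where "\<delta> = min \<beta>1 \<beta>2 / 12"
  have \<delta>: "0 < \<delta>" "\<delta> \<le> 1" "12 * \<delta> \<le> \<beta>1" "12 * \<delta> \<le> \<beta>2" using \<beta>1 \<beta>2 by (auto simp: \<delta>_def)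
  define L where "L = (3 * K + 2 * K * (1 + \<bar>h\<bar>) / \<bar>d\<bar> + 1) / sqrt \<delta>"
  define c where "c = (exp (- 16 * L\<^sup>2) / 2)\<^sup>2"
  have c: "c > 0" by (simp add: c_def)
  have sqrt_top: "filterlim (\<lambda>k. sqrt (real k)) at_top sequentially"
    by (rule filterlim_compose[OF sqrt_at_top filterlim_real_sequentially])
  have "\<forall>\<^sub>F k in sequentially. k \<ge> 6 \<and> B \<le> sqrt k \<and> 8 * L / sqrt \<delta> \<le> sqrt k \<and> 16 / \<delta>\<^sup>2 \<le> real k"
    using sqrt_top filterlim_real_sequentially unfolding filterlim_at_top
    by (intro eventually_conj eventually_ge_at_top) auto
  then have "\<forall>\<^sub>F k in sequentially. \<forall>s x.
    \<bar>of_int s - real k * \<mu>1\<bar> \<le> B \<longrightarrow> \<bar>x - real k * \<mu>2\<bar> \<le> B \<longrightarrow>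
    (c / 2) / real k \<le> measure_pmf.prob (conv_pow k D) (strip s x)"
  proof (eventually_elim, intro allI impI)
    fix k :: nat and s :: int and x :: real
    assume k: "k \<ge> 6 \<and> B \<le> sqrt k \<and> 8 * L / sqrt \<delta> \<le> sqrt k \<and> 16 / \<delta>\<^sup>2 \<le> real k"
      and s: "\<bar>of_int s - real k * \<mu>1\<bar> \<le> B" and x: "\<bar>x - real k * \<mu>2\<bar> \<le> B"
    from k have k6: "k \<ge> 6" and kB: "B \<le> sqrt k" and kL: "8 * L \<le> sqrt \<delta> * sqrt k" and k\<delta>: "16 \<le> \<delta>\<^sup>2 * real k"
      using \<delta> by (auto simp: field_simps)
    \<comment> \<open>A third of the steps is used singly and two thirds in pairs, so that \<open>k1\<close> and \<open>k2\<close> are both of order \<open>k\<close>.\<close>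
    define k2 where "k2 = k div 3"
    define k1 where "k1 = k - 2 * k2"
    have kk: "k1 + 2 * k2 = k" by (simp add: k1_def k2_def)
    obtain t where "k = 3 * k2 + t" "t < 3"
      using that[of "k mod 3"] unfolding k2_def by simp
    then have "k \<le> 6 * k1" "k \<le> 6 * k2" "k1 \<le> k" "k2 \<le> k" using k6 kk by simp_all
    then have k12: "real k / 6 \<le> real k1" "real k / 6 \<le> real k2" "k1 \<le> k" "k2 \<le> k" by auto
    let ?J = "joint k1 k2"
    let ?T = "\<lambda>((i, l, w), bc). w + coin_sum i l bc"
    have skK: "K * sqrt k > 0" using K k6 by simp
    have "K\<^sup>2 * k > 0" using K k6 by simp
    let ?B1 = "{z. K * sqrt k \<le> \<bar>of_int (fst (?T z)) - real k * \<mu>1\<bar>}"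
    have T: "conv_pow k D = map_pmf ?T ?J" using conv_pow_eq_joint[of k1 k2] by (simp add: kk)
    have B1: "measure_pmf.prob ?J ?B1 \<le> 1 / 16"
    proof -
      have "measure_pmf.prob ?J ?B1 = measure_pmf.prob (conv_pow k D) {z. K * sqrt k \<le> \<bar>of_int (fst z) - real k * \<mu>1\<bar>}"
        by (simp add: T vimage_def)
      also have "\<dots> \<le> k * v1 / (K * sqrt k)\<^sup>2"
        unfolding \<mu>1_def v1_def using int1 skK by (intro conv_pow_chebyshev) auto
      also have "\<dots> = v1 / K\<^sup>2" using k6 by (simp add: power_mult_distrib)
      also have "\<dots> \<le> 1 / 16" using K2 by (subst pos_divide_le_eq) linarith+
      finally show ?thesis .
    qed
    let ?B2 = "{z. K * sqrt k \<le> \<bar>snd (?T z) - real k * \<mu>2\<bar>}"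
    have B2: "measure_pmf.prob ?J ?B2 \<le> 1 / 16"
    proof -
      have "measure_pmf.prob ?J ?B2 = measure_pmf.prob (conv_pow k D) {z. K * sqrt k \<le> \<bar>snd z - real k * \<mu>2\<bar>}"
        by (simp add: T vimage_def)
      also have "\<dots> \<le> k * v2 / (K * sqrt k)\<^sup>2"
        unfolding \<mu>2_def v2_def using int2 skK by (intro conv_pow_chebyshev) auto
      also have "\<dots> = v2 / K\<^sup>2" using k6 by (simp add: power_mult_distrib)
      also have "\<dots> \<le> 1 / 16" using K2 by (subst pos_divide_le_eq) linarith+
      finally show ?thesis .
    qed
    have few: "measure_pmf.prob (binomial_pmf n \<beta>) {i. real i < \<delta> * k} \<le> 1 / 16"
      if n: "real k / 6 \<le> real n" and \<beta>: "12 * \<delta> \<le> \<beta>" "0 < \<beta>" "\<beta> < 1" for n \<beta>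
    proof -
      interpret binomial_distribution n \<beta> using \<beta> by unfold_locales auto
      have n0: "n > 0" using n k6 by (cases n) auto
      have "12 * \<delta> * (real k / 6) \<le> \<beta> * real n" using n \<beta> \<delta> by (intro mult_mono) auto
      then have *: "\<delta> * k \<le> n * \<beta> - n * \<beta> / 2" by (simp add: algebra_simps)
      have "measure_pmf.prob (binomial_pmf n \<beta>) {i. real i < \<delta> * k}
          \<le> measure_pmf.prob (binomial_pmf n \<beta>) {i. real i \<le> n * \<beta> - n * \<beta> / 2}"
        using * by (intro measure_pmf.finite_measure_mono) auto
      also have "\<dots> \<le> exp (- 2 * (n * \<beta> / 2)\<^sup>2 / n)"
        using n0 \<beta> by (intro prob_le) auto
      also have "- 2 * (n * \<beta> / 2)\<^sup>2 / n = - (n * \<beta>\<^sup>2 / 2)"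
        using n0 by (simp add: power2_eq_square)
      also have "exp (- (n * \<beta>\<^sup>2 / 2)) \<le> exp (- 16)"
      proof -
        have "(12 * \<delta>)\<^sup>2 \<le> \<beta>\<^sup>2" using \<beta> \<delta> by (intro power_mono) auto
        then have "real k / 6 * (12 * \<delta>)\<^sup>2 \<le> n * \<beta>\<^sup>2" using n by (intro mult_mono) auto
        moreover have "real k / 6 * (12 * \<delta>)\<^sup>2 = 24 * (\<delta>\<^sup>2 * k)" by (simp add: power_mult_distrib)
        ultimately have "n * \<beta>\<^sup>2 \<ge> 24 * 16" using k\<delta> by linarith
        then show ?thesis by simp
      qed
      also have "exp (- 16 :: real) \<le> 1 / 16"
        using exp_ge_add_one_self[of "16::real"] by (simp add: exp_minus field_simps)
      finally show ?thesis .
    qed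
    let ?B3 = "{z. real (fst (fst z)) < \<delta> * k}"
    have B3: "measure_pmf.prob ?J ?B3 \<le> 1 / 16"
    proof -
      have "measure_pmf.prob ?J ?B3 = measure_pmf.prob (map_pmf (\<lambda>z. fst (fst z)) ?J) {i. real i < \<delta> * k}"
        by (simp add: vimage_def)
      then show ?thesis unfolding joint_count_marginals using few[OF k12(1) \<delta>(3) \<beta>1] by simp
    qed
    let ?B4 = "{z. real (fst (snd (fst z))) < \<delta> * k}"
    have B4: "measure_pmf.prob ?J ?B4 \<le> 1 / 16"
    proof -
      have "measure_pmf.prob ?J ?B4 = measure_pmf.prob (map_pmf (\<lambda>z. fst (snd (fst z))) ?J) {i. real i < \<delta> * k}"
        by (simp add: vimage_def)
      then show ?thesis unfolding joint_count_marginals using few[OF k12(2) \<delta>(4) \<beta>2] by simp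
    qed
    have coin: "measure_pmf.prob (binomial_pmf j (1/2)) {b. j \<le> k \<and> K * sqrt k \<le> \<bar>real b - j / 2\<bar>} \<le> 1 / 16" for j
    proof (cases "0 < j \<and> j \<le> k")
      case True
      interpret binomial_distribution j "1/2" by unfold_locales auto
      have "measure_pmf.prob (binomial_pmf j (1/2)) {b. j \<le> k \<and> K * sqrt k \<le> \<bar>real b - j / 2\<bar>}
          = measure_pmf.prob (binomial_pmf j (1/2)) {b. K * sqrt k \<le> \<bar>real b - real j * (1 / 2)\<bar>}"
        using True by simp
      also have "\<dots> \<le> 2 * exp (- 2 * (K * sqrt k)\<^sup>2 / j)"
        using True skK by (intro prob_abs_ge) auto
      also have "\<dots> \<le> 2 * exp (- 32)"
      proof -
        have "16 * real j \<le> K\<^sup>2 * k" using True K2 by (intro mult_mono) auto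
        then have "32 \<le> 2 * (K * sqrt k)\<^sup>2 / j" using True by (simp add: field_simps power_mult_distrib)
        then show ?thesis by simp
      qed
      also have "2 * exp (- 32 :: real) \<le> 1 / 16"
        using exp_ge_add_one_self[of "32::real"] by (simp add: exp_minus field_simps)
      finally show ?thesis .
    next
      case False
      show ?thesis
      proof (cases "j = 0")
        case True
        then show ?thesis using skK by (simp add: binomial_pmf_0 indicator_def)
      qed (use False in auto)
    qed
    \<comment> \<open>The conditions \<open>\<le> k\<close> make the conditional bound for the coins hold for all \<open>i\<close> and \<open>l\<close>; they are true almost surely.\<close>
    let ?B5 = "{z. fst (fst z) \<le> k \<and> K * sqrt k \<le> \<bar>real (fst (snd z)) - real (fst (fst z)) / 2\<bar>}"
    let ?B6 = "{z. fst (snd (fst z)) \<le> k \<and> K * sqrt k \<le> \<bar>real (snd (snd z)) - real (fst (snd (fst z))) / 2\<bar>}"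
    have cond: "measure_pmf.prob ?J A \<le> 1 / 16"
      if A: "\<And>i l w. measure_pmf.prob (coins i l) {bc. ((i, l, w), bc) \<in> A} \<le> 1 / 16" for A
    proof -
      have "emeasure ?J A \<le> (\<integral>\<^sup>+i. \<integral>\<^sup>+l. \<integral>\<^sup>+w. ennreal (1/16) \<partial>rest k1 k2 i l \<partial>binomial_pmf k2 \<beta>2 \<partial>binomial_pmf k1 \<beta>1)"
        unfolding joint_def emeasure_bind_pmf
        using A by (intro nn_integral_mono) (auto simp: vimage_def measure_pmf.emeasure_eq_measure intro: ennreal_leI)
      also have "\<dots> = ennreal (1 / 16)" by simp
      finally show ?thesis by (simp add: measure_pmf.emeasure_eq_measure)
    qed
    have B5: "measure_pmf.prob ?J ?B5 \<le> 1 / 16"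
    proof (rule cond)
      fix i l w
      have "measure_pmf.prob (coins i l) {bc. ((i, l, w), bc) \<in> ?B5}
        = measure_pmf.prob (map_pmf fst (coins i l)) {b. i \<le> k \<and> K * sqrt k \<le> \<bar>real b - i / 2\<bar>}"
        by (simp add: vimage_def)
      then show "measure_pmf.prob (coins i l) {bc. ((i, l, w), bc) \<in> ?B5} \<le> 1 / 16"
        unfolding coins_def map_fst_pair_pmf using coin[of i] by simp
    qed
    have B6: "measure_pmf.prob ?J ?B6 \<le> 1 / 16"
    proof (rule cond)
      fix i l w
      have "measure_pmf.prob (coins i l) {bc. ((i, l, w), bc) \<in> ?B6}
        = measure_pmf.prob (map_pmf snd (coins i l)) {b. l \<le> k \<and> K * sqrt k \<le> \<bar>real b - l / 2\<bar>}"
        by (simp add: vimage_def)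
      then show "measure_pmf.prob (coins i l) {bc. ((i, l, w), bc) \<in> ?B6} \<le> 1 / 16"
        unfolding coins_def map_snd_pair_pmf using coin[of l] by simp
    qed
    define Bad where "Bad = ?B1 \<union> ?B2 \<union> ?B3 \<union> ?B4 \<union> ?B5 \<union> ?B6"
    have un: "measure_pmf.prob ?J (A \<union> A') \<le> a + a'"
      if "measure_pmf.prob ?J A \<le> a" "measure_pmf.prob ?J A' \<le> a'" for A A' a a'
      using that measure_Un_le[of A ?J A'] by simp
    have "measure_pmf.prob ?J Bad \<le> 1/16 + 1/16 + 1/16 + 1/16 + 1/16 + 1/16"
      unfolding Bad_def by (intro un B1 B2 B3 B4 B5 B6)
    then have half: "measure_pmf.prob ?J (- Bad) \<ge> 1 / 2"
      using measure_pmf.prob_compl[of Bad ?J] by (simp add: Compl_eq_Diff_UNIV)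
    define Good where "Good = {(i, l, w). \<exists>b c'. ((i, l, w), (b, c')) \<notin> Bad \<and> i \<le> k \<and> l \<le> k}"
    have "measure_pmf.prob ?J (- Bad) \<le> measure_pmf.prob ?J (fst -` Good)"
    proof (rule measure_pmf.finite_measure_mono_AE)
      show "AE z in ?J. z \<in> - Bad \<longrightarrow> z \<in> fst -` Good"
      proof (subst AE_measure_pmf_iff, intro ballI impI)
        fix z assume z: "z \<in> set_pmf ?J" "z \<in> - Bad"
        obtain i l w b c' where ze: "z = ((i, l, w), (b, c'))" by (metis surj_pair)
        from z(1) have "i \<le> k1" "l \<le> k2"
          using \<beta>1 \<beta>2 unfolding ze joint_def by auto
        then show "z \<in> fst -` Good" using z(2) k12 unfolding ze Good_def by auto
      qed
    qed simp
    with half have good: "measure_pmf.prob ?J (fst -` Good) \<ge> 1 / 2" by linarith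
    have "c / k * (1 / 2) \<le> c / k * measure_pmf.prob ?J (fst -` Good)"
      using good c by (intro mult_left_mono) auto
    also have "\<dots> \<le> measure_pmf.prob (conv_pow k D) (strip s x)"
      unfolding kk[symmetric]
    proof (rule prob_strip_ge_good)
      fix i l w assume "(i, l, w) \<in> Good"
      then obtain b c' where il: "i \<le> k" "l \<le> k" and nb: "((i, l, w), (b, c')) \<notin> Bad"
        unfolding Good_def by auto
      have "sqrt k \<le> K * sqrt k" using K by (simp add: mult_le_cancel_right1)
      then have BK: "B \<le> K * sqrt k" using kB by linarith
      have nb12: "\<not> K * sqrt k \<le> \<bar>of_int (fst (w + coin_sum i l (b, c'))) - real k * \<mu>1\<bar>"
        "\<not> K * sqrt k \<le> \<bar>snd (w + coin_sum i l (b, c')) - real k * \<mu>2\<bar>"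
        using nb unfolding Bad_def by auto
      have tri: "\<bar>p - t\<bar> \<le> 2 * K * sqrt k"
        if "\<bar>p - m\<bar> \<le> B" "\<not> K * sqrt k \<le> \<bar>t - m\<bar>" for p t m :: real
        using that BK by linarith
      show "c / real (k1 + 2 * k2) \<le> measure_pmf.prob (map_pmf (coin_sum i l) (coins i l)) {z. w + z \<in> strip s x}"
        unfolding c_def L_def kk
      proof (rule coins_strip_ge[where b = b and c = c'])
        show "\<bar>of_int (s - fst (w + coin_sum i l (b, c')))\<bar> \<le> 2 * K * sqrt k"
          using tri[OF s nb12(1)] by simp
        show "\<bar>x - snd (w + coin_sum i l (b, c'))\<bar> \<le> 2 * K * sqrt k"
          using tri[OF x nb12(2)] .
        show "8 * ((3 * K + 2 * K * (1 + \<bar>h\<bar>) / \<bar>d\<bar> + 1) / sqrt \<delta>) \<le> sqrt \<delta> * sqrt (real k)"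
          using kL unfolding L_def .
      qed (use K k6 \<delta> il nb in \<open>auto simp: Bad_def\<close>)
    qed (use c in auto)
    finally show "(c / 2) / real k \<le> measure_pmf.prob (conv_pow k D) (strip s x)" by simp
  qed
  then show ?thesis using c by (intro exI[of _ "c / 2"]) auto
qed

end

section \<open>Strips far from the mean\<close>

lemma prob_pair_first_le:
  fixes X :: "'a::comm_monoid_add set"
  assumes a: "\<And>x. measure_pmf.prob q {y. x + y \<in> A} \<le> a"
  shows "measure_pmf.prob (pair_pmf p q) {z. fst z \<in> X \<and> fst z + snd z \<in> A} \<le> a * measure_pmf.prob p X"
proof -
  have a0: "0 \<le> a" using order_trans[OF measure_nonneg a] by auto
  have "emeasure (pair_pmf p q) {z. fst z \<in> X \<and> fst z + snd z \<in> A}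
      = (\<integral>\<^sup>+x. emeasure q {y. x \<in> X \<and> x + y \<in> A} \<partial>p)"
    by (simp add: pair_pmf_def vimage_def map_pmf_def[symmetric])
  also have "\<dots> \<le> (\<integral>\<^sup>+x. ennreal a * indicator X x \<partial>p)"
  proof (intro nn_integral_mono)
    fix x
    show "emeasure q {y. x \<in> X \<and> x + y \<in> A} \<le> ennreal a * indicator X x"
      using a[of x] by (cases "x \<in> X") (auto simp: measure_pmf.emeasure_eq_measure ennreal_leI)
  qed
  also have "\<dots> = ennreal (a * measure_pmf.prob p X)"
    using a0 by (simp add: nn_integral_cmult measure_pmf.emeasure_eq_measure ennreal_mult)
  finally show ?thesis using a0 by (simp add: measure_pmf.emeasure_eq_measure)
qed

lemma prob_conv_split_le:
  assumes a: "\<And>x. measure_pmf.prob q {y. x + y \<in> A} \<le> a"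
    and b: "\<And>y. measure_pmf.prob p {x. y + x \<in> A} \<le> b"
    and cover: "\<And>x y. x + y \<in> A \<Longrightarrow> x \<in> X \<or> y \<in> Y"
  shows "measure_pmf.prob (conv_pmf p q) A \<le> a * measure_pmf.prob p X + b * measure_pmf.prob q Y"
proof -
  let ?S = "{z. fst z \<in> X \<and> fst z + snd z \<in> A}" and ?T = "{z. snd z \<in> Y \<and> fst z + snd z \<in> A}"
  have "measure_pmf.prob (conv_pmf p q) A = measure_pmf.prob (pair_pmf p q) {z. fst z + snd z \<in> A}"
    by (simp add: conv_pmf_altdef vimage_def)
  also have "\<dots> \<le> measure_pmf.prob (pair_pmf p q) (?S \<union> ?T)"
    using cover by (intro measure_pmf.finite_measure_mono) auto
  also have "\<dots> \<le> measure_pmf.prob (pair_pmf p q) ?S + measure_pmf.prob (pair_pmf p q) ?T"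
    by (intro measure_Un_le) auto
  also have "measure_pmf.prob (pair_pmf p q) ?T
      = measure_pmf.prob (pair_pmf q p) {z. fst z \<in> Y \<and> fst z + snd z \<in> A}"
    by (subst pair_commute_pmf) (simp add: vimage_def case_prod_unfold add.commute)
  also have "measure_pmf.prob (pair_pmf p q) ?S \<le> a * measure_pmf.prob p X"
    using a by (rule prob_pair_first_le)
  also have "measure_pmf.prob (pair_pmf q p) {z. fst z \<in> Y \<and> fst z + snd z \<in> A} \<le> b * measure_pmf.prob q Y"
    using b by (rule prob_pair_first_le)
  finally show ?thesis by simp
qed

text \<open>
  Split the walk at half time.  If its end is \<open>\<Delta>\<close> away from the mean, one of the halves is
  \<open>\<Delta> / 2\<close> away from its own mean, which costs \<open>O(k / \<Delta>\<^sup>2)\<close>; given that half, the other one has to hit a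
  translated strip, which costs \<open>C / (k / 2 + 1)\<close>.  The factors \<open>k\<close> cancel, so the bound is uniform in \<open>k\<close>.
\<close>

lemma prob_strip_far_le:
  fixes D :: "(int \<times> real) pmf" and C :: real
  assumes C: "\<And>k s x. measure_pmf.prob (conv_pow k D) (strip s x) \<le> C / (real k + 1)"
    and int1: "integrable (measure_pmf D) (\<lambda>z. (real_of_int (fst z))\<^sup>2)"
  defines "\<mu> \<equiv> measure_pmf.expectation D (\<lambda>z. real_of_int (fst z))"
  defines "v \<equiv> measure_pmf.expectation D (\<lambda>z. (real_of_int (fst z) - \<mu>)\<^sup>2)"
  shows "measure_pmf.prob (conv_pow k D) (strip s x) * (of_int s - real k * \<mu>)\<^sup>2 \<le> 8 * C * v"
proof (cases "of_int s - real k * \<mu> = 0")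
  case True
  have "0 \<le> v" by (simp add: v_def)
  moreover have "0 \<le> C" using order_trans[OF measure_nonneg C[of 0]] by simp
  ultimately show ?thesis using True by simp
next
  case False
  define \<Delta> where "\<Delta> = \<bar>of_int s - real k * \<mu>\<bar>"
  have \<Delta>: "\<Delta> > 0" using False by (simp add: \<Delta>_def)
  define k' where "k' = k div 2"
  define k'' where "k'' = k - k'"
  obtain t where "k = 2 * k' + t" "t < 2"
    using that[of "k mod 2"] unfolding k'_def by simp
  then have k: "k = k' + k''" "k' \<le> k''" "k'' \<le> k' + 1" unfolding k''_def by simp_all
  have v0: "0 \<le> v" by (simp add: v_def)
  have C0: "0 \<le> C" using order_trans[OF measure_nonneg C[of 0]] by simp
  let ?dev = "\<lambda>j. {z. \<Delta> / 2 \<le> \<bar>of_int (fst z) - real j * \<mu>\<bar>} :: (int \<times> real) set"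
  have dev: "measure_pmf.prob (conv_pow j D) (?dev j) \<le> 4 * real j * v / \<Delta>\<^sup>2" for j
  proof -
    have "measure_pmf.prob (conv_pow j D) (?dev j) \<le> real j * v / (\<Delta> / 2)\<^sup>2"
      unfolding v_def \<mu>_def using int1 \<Delta> by (intro conv_pow_chebyshev) auto
    then show ?thesis by (simp add: power_divide mult_ac)
  qed
  have "measure_pmf.prob (conv_pow k D) (strip s x)
     \<le> C / (real k'' + 1) * measure_pmf.prob (conv_pow k' D) (?dev k')
       + C / (real k' + 1) * measure_pmf.prob (conv_pow k'' D) (?dev k'')"
    unfolding k(1) conv_pow_add
  proof (rule prob_conv_split_le)
    fix w z :: "int \<times> real" assume "w + z \<in> strip s x"
    then have "of_int (fst w) + of_int (fst z) = (of_int s :: real)" by (auto simp: strip_def)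
    then have "of_int s - real k * \<mu> = (of_int (fst w) - real k' * \<mu>) + (of_int (fst z) - real k'' * \<mu>)"
      by (simp add: k(1) algebra_simps)
    moreover have "\<bar>g + g'\<bar> / 2 \<le> \<bar>g\<bar> \<or> \<bar>g + g'\<bar> / 2 \<le> \<bar>g'\<bar>" for g g' :: real
      using abs_triangle_ineq[of g g'] by (cases "\<bar>g\<bar> \<le> \<bar>g'\<bar>") auto
    ultimately show "w \<in> ?dev k' \<or> z \<in> ?dev k''" unfolding \<Delta>_def by simp
  qed (simp_all only: strip_shift C)
  also have "\<dots> \<le> C / (real k'' + 1) * (4 * real k' * v / \<Delta>\<^sup>2) + C / (real k' + 1) * (4 * real k'' * v / \<Delta>\<^sup>2)"
    using C0 by (intro add_mono mult_left_mono dev) auto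
  also have "\<dots> = (4 * C * v / \<Delta>\<^sup>2) * (real k' / (real k'' + 1) + real k'' / (real k' + 1))"
    by (simp add: algebra_simps)
  also have "\<dots> \<le> (4 * C * v / \<Delta>\<^sup>2) * (1 + 1)"
    using k C0 v0 by (intro mult_left_mono add_mono) (auto simp: divide_le_eq)
  finally have "measure_pmf.prob (conv_pow k D) (strip s x) \<le> 8 * C * v / \<Delta>\<^sup>2" by simp
  then have "measure_pmf.prob (conv_pow k D) (strip s x) * \<Delta>\<^sup>2 \<le> 8 * C * v"
    using \<Delta> by (simp add: field_simps)
  then show ?thesis by (simp add: \<Delta>_def)
qed

section \<open>The canonical parameter and second differences\<close>

text \<open>
  The candidate is \<open>Sup {x. 0 < x \<and> Z x \<le> 1}\<close>.  Monotone convergence gives \<open>Z \<le> 1\<close> there, so the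
  series converges at this point and, by openness, also at some larger \<open>y\<close>.  The power series is
  therefore continuous at the supremum, and a value below \<open>1\<close> would allow going further.  The point \<open>y\<close> is
  part of the conclusion because it provides exponential moments.
\<close>

lemma power_series_reaches_one:
  fixes w :: "nat \<Rightarrow> real"
  defines "Z \<equiv> \<lambda>x. \<Sum>j. ennreal (w j * x ^ j)"
  assumes w0: "w 0 = 0" and wpos: "\<And>j. j \<ge> 1 \<Longrightarrow> 0 < w j"
    and nonempty: "{x. 0 < x \<and> Z x < \<infinity>} \<noteq> {}" and opn: "open {x. 0 < x \<and> Z x < \<infinity>}"
  shows "\<exists>x y. 0 < x \<and> x < y \<and> Z x = 1 \<and> summable (\<lambda>j. w j * y ^ j) \<and> (\<forall>x'. 0 < x' \<and> Z x' = 1 \<longrightarrow> x' = x)"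
proof -
  have w: "0 \<le> w j" for j using w0 wpos[of j] by (cases "j = 0") auto
  have nn: "0 \<le> w j * x ^ j" if "0 \<le> x" for x j using w that by simp
  have summ: "summable (\<lambda>j. w j * x ^ j)" if "0 \<le> x" "Z x < \<infinity>" for x
    using nn[OF that(1)] that(2) unfolding Z_def by (intro summable_suminf_not_top) auto
  have Zval: "Z x = ennreal (\<Sum>j. w j * x ^ j)" if "0 \<le> x" "summable (\<lambda>j. w j * x ^ j)" for x
    unfolding Z_def using nn[OF that(1)] that(2) by (intro suminf_ennreal2) auto
  have mono: "Z x \<le> Z y" if "0 \<le> x" "x \<le> y" for x y
    unfolding Z_def using that w
    by (intro suminf_le ennreal_leI mult_left_mono power_mono) auto
  define S where "S = {x. 0 < x \<and> Z x \<le> 1}"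
  have Sne: "S \<noteq> {}"
  proof -
    obtain y where y: "0 < y" "Z y < \<infinity>" using nonempty by auto
    then have sy: "summable (\<lambda>j. w j * y ^ j)" by (intro summ) auto
    define m where "m = (\<Sum>j. w j * y ^ j)"
    have m: "m \<ge> 0" unfolding m_def using nn y by (intro suminf_nonneg sy) auto
    define t where "t = 1 / (m + 1)"
    have t: "0 < t" "t \<le> 1" using m by (auto simp: t_def)
    have tj: "w j * (t * y) ^ j \<le> t * (w j * y ^ j)" for j
    proof (cases "j = 0")
      case False
      then have "t ^ j \<le> t ^ 1" using t by (intro power_decreasing) auto
      then have "t ^ j * (w j * y ^ j) \<le> t ^ 1 * (w j * y ^ j)" using nn y by (intro mult_right_mono) auto
      then show ?thesis by (simp add: power_mult_distrib mult_ac)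
    qed (simp add: w0)
    have sty: "summable (\<lambda>j. w j * (t * y) ^ j)"
      using tj nn[of "t * y"] t y by (intro summable_comparison_test'[OF summable_mult[OF sy, of t], of 0]) auto
    have "(\<Sum>j. w j * (t * y) ^ j) \<le> t * m"
      unfolding m_def suminf_mult[OF sy, symmetric] by (intro suminf_le tj sty summable_mult sy)
    also have "\<dots> \<le> 1" using m by (simp add: t_def)
    finally have "Z (t * y) \<le> 1"
      using t y by (subst Zval[OF _ sty]) (auto simp: ennreal_le_1)
    then have "t * y \<in> S" using t y by (simp add: S_def)
    then show ?thesis by blast
  qed
  have Sbd: "x \<le> 1 / w 1" if "x \<in> S" for x
  proof -
    have "Z x \<le> 1" "0 < x" using that by (auto simp: S_def)
    then have s: "summable (\<lambda>j. w j * x ^ j)" by (intro summ) (auto simp: less_top[symmetric] top_unique)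
    have "(\<Sum>j\<in>{1}. w j * x ^ j) \<le> (\<Sum>j. w j * x ^ j)"
      using nn \<open>0 < x\<close> by (intro sum_le_suminf s) auto
    also have "\<dots> \<le> 1" using \<open>Z x \<le> 1\<close> \<open>0 < x\<close> Zval[OF _ s] by (simp add: ennreal_le_1)
    finally show ?thesis using wpos[of 1] by (simp add: field_simps)
  qed
  then have bdd: "bdd_above S" by (meson bdd_aboveI)
  define x0 where "x0 = Sup S"
  obtain s0 where s0: "s0 \<in> S" using Sne by auto
  have x0: "0 < x0" using cSup_upper[OF s0 bdd] s0 by (simp add: x0_def S_def)
  have below: "Z x \<le> 1" if x: "0 < x" "x < x0" for x
  proof -
    obtain s where "s \<in> S" "x < s" using x(2) less_cSupD[OF Sne, of x] unfolding x0_def by blast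
    then show ?thesis using mono[of x s] x by (auto simp: S_def)
  qed
  have Zx0: "Z x0 \<le> 1"
    unfolding Z_def suminf_eq_SUP
  proof (rule SUP_least)
    fix n
    define p where "p x = (\<Sum>j<n. w j * x ^ j)" for x
    have "p x0 \<le> 1"
    proof (rule tendsto_upperbound)
      show "(p \<longlongrightarrow> p x0) (at_left x0)" unfolding p_def by (intro tendsto_intros)
      show "\<forall>\<^sub>F x in at_left x0. p x \<le> 1"
      proof (rule eventually_at_leftI[OF _ x0])
        fix x assume x: "x \<in> {0<..<x0}"
        then have Zx: "Z x \<le> 1" using below by auto
        then have s: "summable (\<lambda>j. w j * x ^ j)" using x by (intro summ) (auto simp: less_top[symmetric] top_unique)
        have "p x \<le> (\<Sum>j. w j * x ^ j)"
          unfolding p_def using nn x by (intro sum_le_suminf s) auto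
        also have "\<dots> \<le> 1" using Zx x Zval[OF _ s] by (simp add: ennreal_le_1)
        finally show "p x \<le> 1" .
      qed
    qed simp
    then show "(\<Sum>j<n. ennreal (w j * x0 ^ j)) \<le> 1"
      using nn x0 unfolding p_def by (subst sum_ennreal) (auto simp: ennreal_le_1)
  qed
  then have "x0 \<in> {x. 0 < x \<and> Z x < \<infinity>}" using x0 by (auto simp: less_top[symmetric] top_unique)
  then obtain e where e: "e > 0" "ball x0 e \<subseteq> {x. 0 < x \<and> Z x < \<infinity>}"
    using opn open_contains_ball by metis
  define y where "y = x0 + e / 2"
  have y: "x0 < y" "y \<in> ball x0 e" using e by (auto simp: y_def dist_real_def)
  then have "Z y < \<infinity>" using e by auto
  then have sy: "summable (\<lambda>j. w j * y ^ j)" using y x0 by (intro summ) auto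
  have sx: "summable (\<lambda>j. w j * x ^ j)" if "0 < x" "x \<le> y" for x
    using mono[of x y] \<open>Z y < \<infinity>\<close> that by (intro summ) auto
  define f where "f x = (\<Sum>j. w j * x ^ j)" for x
  have cont: "isCont f x0"
    unfolding f_def using y x0 by (intro isCont_powser[OF sy]) auto
  have "f x0 \<ge> 1"
  proof (rule ccontr)
    assume "\<not> f x0 \<ge> 1"
    then have "\<forall>\<^sub>F x in at x0. f x < 1"
      using cont by (intro order_tendstoD(2)[of f "f x0"]) (auto simp: isCont_def)
    then have "\<forall>\<^sub>F x in at_right x0. f x < 1" by (simp add: eventually_at_split)
    moreover have "\<forall>\<^sub>F x in at_right x0. x < y" using y by (subst eventually_at_right_field) auto
    moreover have "\<forall>\<^sub>F x in at_right x0. x0 < x" by (simp add: eventually_at_right_less)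
    ultimately have "\<forall>\<^sub>F x in at_right x0. x0 < x \<and> x < y \<and> f x < 1" by eventually_elim simp
    then obtain x where x: "x0 < x" "x < y" "f x < 1" using eventually_happens[of _ "at_right x0"] by auto
    then have "Z x \<le> 1" using x0 Zval[OF _ sx, of x] by (simp add: f_def ennreal_le_1)
    then have "x \<in> S" using x x0 by (auto simp: S_def)
    then show False using cSup_upper[OF _ bdd, of x] x by (simp add: x0_def)
  qed
  moreover have "f x0 \<le> 1" using Zx0 x0 y Zval[OF _ sx, of x0] by (simp add: f_def ennreal_le_1)
  ultimately have Z1: "Z x0 = 1" using x0 y Zval[OF _ sx, of x0] by (simp add: f_def)
  have uniq: "\<not> x < x'" if "0 < x" "Z x = 1" "Z x' = 1" for x x'
  proof
    assume lt: "x < x'"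
    have s: "summable (\<lambda>j. w j * x ^ j)" "summable (\<lambda>j. w j * x' ^ j)"
      using that lt by (auto intro!: summ)
    have eq: "(\<Sum>j. w j * x ^ j) = 1" "(\<Sum>j. w j * x' ^ j) = 1"
      using that lt Zval[OF _ s(1)] Zval[OF _ s(2)] by (auto simp: ennreal_eq_1)
    have "(\<Sum>j\<in>{1}. w j * x' ^ j - w j * x ^ j) \<le> (\<Sum>j. w j * x' ^ j - w j * x ^ j)"
      using s lt that w by (intro sum_le_suminf summable_diff) (auto intro!: mult_left_mono power_mono)
    also have "\<dots> = 0" using suminf_diff[OF s(2) s(1)] eq by simp
    finally have "w 1 * (x' - x) \<le> 0" by (simp add: algebra_simps)
    then show False using wpos[of 1] lt by (simp add: mult_le_0_iff)
  qed
  have "\<forall>x'. 0 < x' \<and> Z x' = 1 \<longrightarrow> x' = x0" using uniq Z1 x0 by (metis linorder_neqE_linordered_idom)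
  with x0 y Z1 sy show ?thesis by blast
qed

text \<open>
  The masses decay geometrically, at rate \<open>x / y\<close>.  The exponent \<open>4\<close> suffices for the squares of
  functions of quadratic growth.
\<close>

lemma integrable_polynomial_growth:
  fixes g :: "nat \<Rightarrow> real"
  assumes q: "\<And>j. pmf q j = w j * x ^ j" and x: "0 < x" "x < y" and w: "\<And>j. 0 \<le> w j"
    and sy: "summable (\<lambda>j. w j * y ^ j)" and g: "\<And>j. \<bar>g j\<bar> \<le> C * (real j + 1) ^ 4"
  shows "integrable (measure_pmf q) g"
proof -
  define \<theta> where "\<theta> = x / y"
  have \<theta>: "0 < \<theta>" "\<theta> < 1" using x by (auto simp: \<theta>_def)
  define s where "s = root 4 \<theta>"
  have s: "0 < s" "s < 1" "s ^ 4 = \<theta>" using \<theta> by (auto simp: s_def)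
  have "(\<lambda>j. real j * s ^ j + s ^ j) \<longlonglongrightarrow> 0 + 0"
    using s by (intro tendsto_add powser_times_n_limit_0 LIMSEQ_power_zero) auto
  then have "convergent (\<lambda>j. real j * s ^ j + s ^ j)" by (rule convergentI)
  from convergent_imp_Bseq[OF this] obtain B where "\<forall>j. norm (real j * s ^ j + s ^ j) \<le> B"
    by (elim BseqE) blast
  then have B: "\<bar>real j * s ^ j + s ^ j\<bar> \<le> B" for j by (simp only: real_norm_def)
  have B0: "B \<ge> 0" using order_trans[OF abs_ge_zero B[of 0]] .
  have C0: "C \<ge> 0" using order_trans[OF abs_ge_zero g[of 0]] by simp
  have bound: "(real j + 1) ^ 4 * \<theta> ^ j \<le> B ^ 4" for j
  proof -
    have "(real j + 1) ^ 4 * \<theta> ^ j = (real j * s ^ j + s ^ j) ^ 4"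
    proof -
      have "(real j * s ^ j + s ^ j) ^ 4 = ((real j + 1) * s ^ j) ^ 4" by (simp only: distrib_right mult_1)
      also have "\<dots> = (real j + 1) ^ 4 * (s ^ 4) ^ j"
        unfolding power_mult_distrib[of "real j + 1"] power_mult[symmetric] mult.commute[of j 4] ..
      finally show ?thesis by (simp only: s(3))
    qed
    also have "\<dots> \<le> B ^ 4" using B[of j] s by (intro power_mono) auto
    finally show ?thesis .
  qed
  have "summable (\<lambda>j. norm (pmf q j * g j))"
  proof (rule summable_comparison_test'[of _ 0])
    show "summable (\<lambda>j. (C * B ^ 4) * (w j * y ^ j))" by (intro summable_mult sy)
    fix j
    have "w j * x ^ j * \<bar>g j\<bar> \<le> w j * x ^ j * (C * (real j + 1) ^ 4)"
      using g w x by (intro mult_left_mono) auto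
    also have "\<dots> = C * (w j * y ^ j) * ((real j + 1) ^ 4 * \<theta> ^ j)"
    proof -
      have "x ^ j = y ^ j * \<theta> ^ j" using x by (simp add: \<theta>_def power_divide)
      then show ?thesis by (simp only: mult_ac)
    qed
    also have "\<dots> \<le> C * (w j * y ^ j) * B ^ 4"
      using bound C0 w x by (intro mult_left_mono) auto
    also have "\<dots> = C * B ^ 4 * (w j * y ^ j)" by (simp only: mult_ac)
    finally have "w j * x ^ j * \<bar>g j\<bar> \<le> C * B ^ 4 * (w j * y ^ j)" .
    moreover have "norm (norm (pmf q j * g j)) = w j * x ^ j * \<bar>g j\<bar>"
      using w[of j] x by (simp add: q abs_mult)
    ultimately show "norm (norm (pmf q j * g j)) \<le> C * B ^ 4 * (w j * y ^ j)" by (simp only:)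
  qed
  then have "integrable (count_space UNIV) (\<lambda>j. pmf q j * g j)"
    by (simp add: integrable_count_space_nat_iff)
  then show ?thesis
    unfolding measure_pmf_eq_density[of q] by (subst integrable_density) auto
qed

lemma quadratic_growth:
  fixes v :: "nat \<Rightarrow> real"
  assumes "fdiff (fdiff v) \<longlonglongrightarrow> 0"
  shows "\<exists>C. \<forall>j. \<bar>v j\<bar> \<le> C * (real j + 1)\<^sup>2"
proof -
  have "convergent (fdiff (fdiff v))" using assms by (auto simp: convergent_def)
  then obtain B where B: "\<And>j. \<bar>fdiff (fdiff v) j\<bar> \<le> B"
    using convergent_imp_Bseq BseqE by (metis real_norm_def)
  have B0: "B \<ge> 0" using order_trans[OF abs_ge_zero B[of 0]] .
  define M where "M = \<bar>fdiff v 0\<bar>"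
  have d1: "\<bar>fdiff v j\<bar> \<le> M + B * real j" for j
  proof (induction j)
    case (Suc j)
    have "fdiff v (Suc j) = fdiff v j + fdiff (fdiff v) j" by (simp add: fdiff_def)
    then show ?case using Suc B[of j] by (simp add: algebra_simps)
  qed (simp add: M_def)
  have d0: "\<bar>v j\<bar> \<le> \<bar>v 0\<bar> + real j * (M + B * real j)" for j
  proof (induction j)
    case (Suc j)
    have "v (Suc j) = v j + fdiff v j" by (simp add: fdiff_def)
    then have "\<bar>v (Suc j)\<bar> \<le> \<bar>v 0\<bar> + real j * (M + B * real j) + (M + B * real j)"
      using Suc d1[of j] by linarith
    also have "\<dots> = \<bar>v 0\<bar> + (real j + 1) * (M + B * real j)" by (simp add: algebra_simps)
    also have "\<dots> \<le> \<bar>v 0\<bar> + (real j + 1) * (M + B * (real j + 1))"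
      using B0 by (intro add_left_mono mult_left_mono) auto
    finally show ?case by (simp add: add.commute)
  qed simp
  have "\<bar>v j\<bar> \<le> (\<bar>v 0\<bar> + M + B) * (real j + 1)\<^sup>2" for j
  proof -
    have "\<bar>v 0\<bar> * 1 \<le> \<bar>v 0\<bar> * (real j + 1)\<^sup>2" by (intro mult_left_mono) auto
    moreover have "M * real j \<le> M * (real j + 1)\<^sup>2"
      by (intro mult_left_mono) (auto simp: M_def power2_eq_square algebra_simps)
    moreover have "B * (real j)\<^sup>2 \<le> B * (real j + 1)\<^sup>2"
      using B0 by (intro mult_left_mono power_mono) auto
    moreover have "\<bar>v j\<bar> \<le> \<bar>v 0\<bar> + M * real j + B * (real j)\<^sup>2"
      using d0[of j] by (simp add: algebra_simps power2_eq_square)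
    ultimately have "\<bar>v j\<bar> \<le> \<bar>v 0\<bar> * (real j + 1)\<^sup>2 + M * (real j + 1)\<^sup>2 + B * (real j + 1)\<^sup>2"
      by linarith
    then show ?thesis by (simp only: distrib_right)
  qed
  then show ?thesis by blast
qed

text \<open>
  If all the small second differences vanished, then \<open>v\<close> would eventually be affine,
  contrary to its superlinear growth.
\<close>

lemma small_second_difference:
  fixes v :: "nat \<Rightarrow> real"
  assumes d2: "fdiff (fdiff v) \<longlonglongrightarrow> 0" and sup: "filterlim (\<lambda>j. v j / real j) at_top sequentially"
  shows "\<exists>j\<ge>1. fdiff (fdiff v) j \<noteq> 0 \<and> \<bar>fdiff (fdiff v) j\<bar> \<le> 1"
proof (rule ccontr)
  assume neg: "\<not> ?thesis"
  have "\<forall>\<^sub>F j in sequentially. \<bar>fdiff (fdiff v) j\<bar> < 1"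
    using tendstoD[OF d2, of 1] by simp
  then obtain N where N: "\<And>j. j \<ge> N \<Longrightarrow> \<bar>fdiff (fdiff v) j\<bar> < 1" by (auto simp: eventually_sequentially)
  define m where "m = max N 1"
  have z: "fdiff (fdiff v) j = 0" if "j \<ge> m" for j
    using neg N[of j] that by (auto simp: m_def)
  have c: "fdiff v (m + i) = fdiff v m" for i
  proof (induction i)
    case (Suc i)
    then show ?case using z[of "m + i"] by (simp add: fdiff_def)
  qed simp
  have lin: "v (m + i) = v m + real i * fdiff v m" for i
  proof (induction i)
    case (Suc i)
    have "v (m + Suc i) = v (m + i) + fdiff v (m + i)" by (simp add: fdiff_def)
    then show ?case using Suc c[of i] by (simp add: algebra_simps)
  qed simp
  define L where "L = \<bar>v m\<bar> + \<bar>fdiff v m\<bar>"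
  have bound: "v j / real j \<le> L" if "j \<ge> m" for j
  proof -
    obtain i where i: "j = m + i" using \<open>j \<ge> m\<close> le_Suc_ex by blast
    have j1: "real j \<ge> 1" using that by (simp add: m_def)
    have "v j \<le> \<bar>v m\<bar> * 1 + real i * \<bar>fdiff v m\<bar>"
      unfolding i lin by (intro add_mono mult_left_mono) auto
    also have "\<dots> \<le> \<bar>v m\<bar> * real j + real j * \<bar>fdiff v m\<bar>"
      using j1 i by (intro add_mono mult_left_mono mult_right_mono) auto
    finally have "v j \<le> L * real j" by (simp add: L_def algebra_simps)
    then show ?thesis using j1 by (simp add: divide_le_eq)
  qed
  have "\<forall>\<^sub>F j in sequentially. L + 1 \<le> v j / real j"
    using sup by (simp add: filterlim_at_top)
  then obtain n where n: "\<And>j. j \<ge> n \<Longrightarrow> L + 1 \<le> v j / real j" by (auto simp: eventually_sequentially)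
  show False using n[of "max m n"] bound[of "max m n"] by simp
qed

text \<open>
  At the critical parameter this is part of the profile assumption.  Below it, the terms are eventually at
  most \<open>exp (- \<delta> * v j + j * ln x)\<close>, and \<open>v j / j \<rightarrow> \<infinity>\<close> makes the series converge for every \<open>x > 0\<close>.
\<close>

lemma canonical_finiteness:
  assumes prof: "profile a v" and \<gamma>: "\<gamma> \<le> gamma_crit a v"
  shows "{x. 0 < x \<and> partition_fun a v \<gamma> x < \<infinity>} \<noteq> {} \<and> open {x. 0 < x \<and> partition_fun a v \<gamma> x < \<infinity>}"
proof (cases "\<gamma> = gamma_crit a v")
  case True
  then show ?thesis using prof by (simp add: profile_def)
next
  case False
  with \<gamma> have lt: "\<gamma> < gamma_crit a v" by simp
  define \<delta> where "\<delta> = (gamma_crit a v - \<gamma>) / 2"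
  have \<delta>: "\<delta> > 0" "\<gamma> + \<delta> < gamma_crit a v" using lt by (simp_all add: \<delta>_def field_simps)
  have apos: "\<And>j. 1 \<le> j \<Longrightarrow> 0 < a j" using prof by (simp add: profile_def)
  have lim: "(\<lambda>j. - ln (a j) / v j) \<longlonglongrightarrow> gamma_crit a v"
    using prof by (simp add: profile_def gamma_crit_def convergent_LIMSEQ_iff)
  have sup: "filterlim (\<lambda>j. v j / real j) at_top sequentially" using prof by (simp add: profile_def)
  have fin: "partition_fun a v \<gamma> x < \<infinity>" if x: "0 < x" for x
  proof -
    define B where "B = (\<bar>ln x\<bar> + 1) / \<delta>"
    have B: "B > 0" using \<delta> by (simp add: B_def add_nonneg_pos)
    have "\<forall>\<^sub>F j in sequentially. norm (tilted_weight a v \<gamma> x j) \<le> exp (- 1) ^ j"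
      using order_tendstoD(1)[OF lim \<delta>(2)] filterlim_at_top[THEN iffD1, OF sup, rule_format, of B]
        eventually_ge_at_top[of 1]
    proof eventually_elim
      case (elim j)
      then have j: "real j > 0" by simp
      have vj: "B * real j \<le> v j" using elim j by (simp add: le_divide_eq)
      have vpos: "v j > 0" using B j less_le_trans[OF mult_pos_pos[OF B j] vj] by simp
      have "\<gamma> + \<delta> < (- ln (a j)) / v j" using elim by simp
      then have "(\<gamma> + \<delta>) * v j < - ln (a j)" using vpos by (simp only: pos_less_divide_eq)
      then have "ln (a j) + j * ln x + \<gamma> * v j \<le> j * \<bar>ln x\<bar> - \<delta> * v j"
        using mult_left_mono[OF abs_ge_self[of "ln x"], of "real j"] by (simp add: algebra_simps)
      also have "\<dots> \<le> j * \<bar>ln x\<bar> - \<delta> * (B * real j)"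
        using vj \<delta> by (intro diff_left_mono mult_left_mono) auto
      also have "\<delta> * (B * real j) = (\<bar>ln x\<bar> + 1) * real j" using \<delta> by (simp add: B_def)
      finally have le: "ln (a j) + j * ln x + \<gamma> * v j \<le> - real j" by (simp add: algebra_simps)
      have "x ^ j = exp (j * ln x)" using x by (simp add: exp_of_nat_mult)
      then have "tilted_weight a v \<gamma> x j = exp (ln (a j) + j * ln x + \<gamma> * v j)"
        using apos[of j] elim by (simp add: tilted_weight_def exp_add)
      also have "\<dots> \<le> exp (- real j)" using le by simp
      also have "\<dots> = exp (- 1) ^ j" by (simp add: exp_of_nat_mult[symmetric])
      finally have "tilted_weight a v \<gamma> x j \<le> exp (- 1) ^ j" .
      moreover have "0 \<le> tilted_weight a v \<gamma> x j"
        using apos[of j] x elim by (simp add: tilted_weight_def)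
      ultimately show ?case by simp
    qed
    then have "summable (tilted_weight a v \<gamma> x)"
      by (rule summable_comparison_test_ev) (intro summable_geometric, simp)
    moreover have "0 \<le> tilted_weight a v \<gamma> x j" for j
      using apos[of j] x by (auto simp: tilted_weight_def intro!: mult_nonneg_nonneg less_imp_le)
    ultimately have "partition_fun a v \<gamma> x = ennreal (suminf (tilted_weight a v \<gamma> x))"
      unfolding partition_fun_def by (intro suminf_ennreal2)
    then show ?thesis by simp
  qed
  then have eq: "{x. 0 < x \<and> partition_fun a v \<gamma> x < \<infinity>} = {0<..}" by auto
  have "(1::real) \<in> {0<..}" by simp
  then show ?thesis unfolding eq by (blast intro: open_greaterThan)
qed

text \<open>
  The consequences of the profile assumption from which the asymptotics follow.  They hold
  below and at the critical parameter alike, so no case distinction is made from here on.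
\<close>

locale canonical_model =
  fixes a v :: "nat \<Rightarrow> real" and \<gamma> x :: real and q :: "nat pmf"
  assumes apos: "\<And>j. 1 \<le> j \<Longrightarrow> 0 < a j" and x: "0 < x"
    and q: "\<And>j. pmf q j = tilted_weight a v \<gamma> x j"
    and intJ: "integrable (measure_pmf q) (\<lambda>j. (real j)\<^sup>2)"
    and intV: "integrable (measure_pmf q) (\<lambda>j. (v j)\<^sup>2)"
    and diff: "\<exists>j\<ge>1. fdiff (fdiff v) j \<noteq> 0 \<and> \<bar>fdiff (fdiff v) j\<bar> \<le> 1"

text \<open>
  The canonical fugacity lies in the interior of the domain of convergence, hence \<open>q\<close> has exponential
  moments.  Since \<open>v\<close> grows at most quadratically, \<open>v J\<close> is square integrable too.
\<close>

lemma canonical_law_model: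
  assumes prof: "profile a v" and \<gamma>: "\<gamma> \<le> gamma_crit a v"
  shows "\<exists>x. canonical_model a v \<gamma> x (canon_law a v \<gamma>)"
proof -
  have apos: "\<And>j. 1 \<le> j \<Longrightarrow> 0 < a j" using prof by (simp add: profile_def)
  define w where "w j = (if 1 \<le> j then a j * exp (\<gamma> * v j) else 0)" for j
  have tw: "tilted_weight a v \<gamma> x j = w j * x ^ j" for x j by (simp add: tilted_weight_def w_def)
  have Z: "partition_fun a v \<gamma> x = (\<Sum>j. ennreal (w j * x ^ j))" for x
    by (simp add: partition_fun_def tw)
  have w0: "w 0 = 0" and wpos: "\<And>j. 1 \<le> j \<Longrightarrow> 0 < w j" using apos by (simp_all add: w_def)
  have wnn: "0 \<le> w j" for j
    using w0 wpos[of j] by (cases "j = 0") simp_all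
  note fin = canonical_finiteness[OF prof \<gamma>, unfolded Z]
  note root = power_series_reaches_one[of w, OF w0 wpos conjunct1[OF fin] conjunct2[OF fin], folded Z]
  obtain x where "\<exists>y. 0 < x \<and> x < y \<and> partition_fun a v \<gamma> x = 1 \<and> summable (\<lambda>j. w j * y ^ j)
      \<and> (\<forall>x'. 0 < x' \<and> partition_fun a v \<gamma> x' = 1 \<longrightarrow> x' = x)"
    using root by (rule exE)
  then obtain y where y: "0 < x \<and> x < y \<and> partition_fun a v \<gamma> x = 1 \<and> summable (\<lambda>j. w j * y ^ j)
      \<and> (\<forall>x'. 0 < x' \<and> partition_fun a v \<gamma> x' = 1 \<longrightarrow> x' = x)"
    by (rule exE)
  from y have x: "0 < x" "x < y" and Z1: "partition_fun a v \<gamma> x = 1" and sy: "summable (\<lambda>j. w j * y ^ j)"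
    by blast+
  have uniq: "x' = x" if "0 < x'" "partition_fun a v \<gamma> x' = 1" for x'
    using y that by blast
  have cx: "canon_x a v \<gamma> = x"
    unfolding canon_x_def
  proof (rule the_equality)
    show "0 < x \<and> partition_fun a v \<gamma> x = 1" using x(1) Z1 by (rule conjI)
  qed (elim conjE, rule uniq)
  have q: "pmf (canon_law a v \<gamma>) j = tilted_weight a v \<gamma> x j" for j
    unfolding canon_law_def cx
  proof (subst pmf_embed_pmf)
    show "0 \<le> tilted_weight a v \<gamma> x j" for j using wnn x by (simp add: tw)
    show "(\<integral>\<^sup>+j. ennreal (tilted_weight a v \<gamma> x j) \<partial>count_space UNIV) = 1"
      using Z1 by (simp add: nn_integral_count_space_nat partition_fun_def)
  qed simp
  have d2: "fdiff (fdiff v) \<longlonglongrightarrow> 0" and sup: "filterlim (\<lambda>j. v j / real j) at_top sequentially"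
    using prof by (simp_all add: profile_def)
  obtain C where C: "\<And>j. \<bar>v j\<bar> \<le> C * (real j + 1)\<^sup>2" using quadratic_growth[OF d2] by blast
  have "canonical_model a v \<gamma> x (canon_law a v \<gamma>)"
  proof
    show "integrable (measure_pmf (canon_law a v \<gamma>)) (\<lambda>j. (real j)\<^sup>2)"
    proof (rule integrable_polynomial_growth[OF q[unfolded tw] x wnn sy])
      fix j
      have "(real j)\<^sup>2 \<le> (real j + 1) ^ 2" by (intro power_mono) auto
      also have "\<dots> \<le> (real j + 1) ^ 4" by (intro power_increasing) auto
      finally show "\<bar>(real j)\<^sup>2\<bar> \<le> 1 * (real j + 1) ^ 4" by simp
    qed
    show "integrable (measure_pmf (canon_law a v \<gamma>)) (\<lambda>j. (v j)\<^sup>2)"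
    proof (rule integrable_polynomial_growth[OF q[unfolded tw] x wnn sy])
      fix j
      have "\<bar>v j\<bar>\<^sup>2 \<le> (C * (real j + 1)\<^sup>2)\<^sup>2" by (intro power_mono C) auto
      also have "(C * u\<^sup>2)\<^sup>2 = C\<^sup>2 * u ^ 4" for u :: real
        by (simp add: power_mult_distrib)
      finally show "\<bar>(v j)\<^sup>2\<bar> \<le> C\<^sup>2 * (real j + 1) ^ 4" by simp
    qed
    show "\<exists>j\<ge>1. fdiff (fdiff v) j \<noteq> 0 \<and> \<bar>fdiff (fdiff v) j\<bar> \<le> 1"
      by (rule small_second_difference[OF d2 sup])
  qed (use apos x q in auto)
  then show ?thesis by blast
qed

lemma pmf_replicate_pmf:
  "pmf (replicate_pmf k q) js = (if length js = k then (\<Prod>j\<leftarrow>js. pmf q j) else 0)"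
proof (induction k arbitrary: js)
  case 0
  then show ?case by (cases js) auto
next
  case (Suc k)
  show ?case
  proof (cases js)
    case Nil
    then have "js \<notin> set_pmf (replicate_pmf (Suc k) q)"
      unfolding set_replicate_pmf by simp
    then have "pmf (replicate_pmf (Suc k) q) js = 0" by (simp only: set_pmf_iff not_not)
    then show ?thesis using Nil by (simp del: replicate_pmf.simps)
  next
    case (Cons j js')
    let ?c = "\<lambda>(x, xs). x # xs"
    have "pmf (replicate_pmf (Suc k) q) js = pmf (map_pmf ?c (pair_pmf q (replicate_pmf k q))) (?c (j, js'))"
      by (simp add: Cons pair_pmf_def map_pmf_def bind_assoc_pmf bind_return_pmf)
    also have "\<dots> = pmf (pair_pmf q (replicate_pmf k q)) (j, js')"
      by (rule pmf_map_inj') (auto simp: inj_def)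
    also have "\<dots> = pmf q j * (if length js' = k then (\<Prod>j\<leftarrow>js'. pmf q j) else 0)"
      unfolding pmf_pair Suc.IH ..
    also have "\<dots> = (if length js = Suc k then (\<Prod>j\<leftarrow>js. pmf q j) else 0)"
      by (simp add: Cons)
    finally show ?thesis .
  qed
qed

section \<open>Marginals of a law with controlled density\<close>

text \<open>
  Disjoint blocks of an independent sample are independent; a remainder of fewer than \<open>r\<close> entries,
  or any larger one, integrates out.
\<close>

lemma replicate_pmf_block_exp:
  fixes g :: "'a list \<Rightarrow> ennreal"
  assumes "r * L \<le> k"
  shows "(\<integral>\<^sup>+js. (\<Prod>i<L. g (take r (drop (i * r) js))) \<partial>replicate_pmf k q)
     = (\<integral>\<^sup>+xs. g xs \<partial>replicate_pmf r q) ^ L"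
  using assms
proof (induction L arbitrary: k)
  case (Suc L)
  then have k: "k = r + (k - r)" "r * L \<le> k - r" by auto
  have "(\<integral>\<^sup>+js. (\<Prod>i<Suc L. g (take r (drop (i * r) js))) \<partial>replicate_pmf k q)
    = (\<integral>\<^sup>+xs. \<integral>\<^sup>+ys. (\<Prod>i<Suc L. g (take r (drop (i * r) (xs @ ys)))) \<partial>replicate_pmf (k - r) q \<partial>replicate_pmf r q)"
    by (subst k(1), subst replicate_pmf_distrib) simp
  also have "\<dots> = (\<integral>\<^sup>+xs. g xs * (\<integral>\<^sup>+ys. (\<Prod>i<L. g (take r (drop (i * r) ys))) \<partial>replicate_pmf (k - r) q) \<partial>replicate_pmf r q)"
  proof (intro nn_integral_cong_AE, subst AE_measure_pmf_iff, intro ballI)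
    fix xs assume "xs \<in> set_pmf (replicate_pmf r q)"
    then have len: "length xs = r" by (simp add: set_replicate_pmf)
    then have "(\<integral>\<^sup>+ys. (\<Prod>i<Suc L. g (take r (drop (i * r) (xs @ ys)))) \<partial>replicate_pmf (k - r) q)
       = (\<integral>\<^sup>+ys. g xs * (\<Prod>i<L. g (take r (drop (i * r) ys))) \<partial>replicate_pmf (k - r) q)"
      by (subst prod.lessThan_Suc_shift) simp
    then show "(\<integral>\<^sup>+ys. (\<Prod>i<Suc L. g (take r (drop (i * r) (xs @ ys)))) \<partial>replicate_pmf (k - r) q)
       = g xs * (\<integral>\<^sup>+ys. (\<Prod>i<L. g (take r (drop (i * r) ys))) \<partial>replicate_pmf (k - r) q)"
      by (simp add: nn_integral_cmult)
  qed
  also have "\<dots> = (\<integral>\<^sup>+xs. g xs \<partial>replicate_pmf r q) ^ Suc L"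
    by (simp add: Suc.IH[OF k(2)] nn_integral_multc)
  finally show ?case .
qed simp

text \<open>
  A change of measure in the spirit of the Donsker--Varadhan formula.  Let \<open>F\<close> be the sum of the centred
  values of \<open>f\<close> over \<open>L\<close> disjoint blocks.  Rotation invariance gives \<open>F\<close> the \<open>\<mu>\<close>-mean \<open>L\<close> times the bias
  of \<open>f\<close>.  By Jensen's inequality, the exponential of \<open>l\<close> times this mean is at most the \<open>\<mu>\<close>-mean of \<open>exp (l * F)\<close>,
  which the density bound and Hoeffding's lemma estimate by \<open>M * exp (l\<^sup>2 * L / 2)\<close>.  The choice
  \<open>l\<^sup>2 = 2 * ln M / L\<close> balances the two factors.
\<close>

lemma block_average_le:
  fixes f :: "'a list \<Rightarrow> real"
  assumes dens: "\<And>js. pmf \<mu> js \<le> M * pmf (replicate_pmf k q) js"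
    and rot: "\<And>m. map_pmf (rotate m) \<mu> = \<mu>"
    and r: "r \<ge> 1" "r \<le> k" and M: "M > 1" and f: "\<And>xs. \<bar>f xs\<bar> \<le> 1"
  shows "measure_pmf.expectation (map_pmf (take r) \<mu>) f - measure_pmf.expectation (replicate_pmf r q) f
     \<le> sqrt (2 * ln M / real (k div r))"
proof -
  define L where "L = k div r"
  have L: "L \<ge> 1" "r * L \<le> k" using r by (auto simp: L_def Suc_le_eq div_greater_zero_iff)
  define m where "m = measure_pmf.expectation (replicate_pmf r q) f"
  define e where "e = measure_pmf.expectation (map_pmf (take r) \<mu>) f"
  define l where "l = sqrt (2 * ln M / L)"
  have l: "l > 0" using M L by (simp add: l_def)
  have l2: "l * l * L = 2 * ln M" using M L by (simp add: l_def)
  define F where "F js = (\<Sum>i<L. f (take r (drop (i * r) js)) - m)" for js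
  have int: "integrable (measure_pmf p) (h :: 'b \<Rightarrow> real)" if "\<And>x. \<bar>h x\<bar> \<le> B" for p h B
    using that by (intro measure_pmf.integrable_const_bound[where B = B]) auto
  have m1: "\<bar>m\<bar> \<le> 1"
  proof -
    have "\<bar>m\<bar> \<le> measure_pmf.expectation (replicate_pmf r q) (\<lambda>xs. \<bar>f xs\<bar>)"
      unfolding m_def by (rule integral_abs_bound)
    also have "\<dots> \<le> measure_pmf.expectation (replicate_pmf r q) (\<lambda>_. 1)"
      using f by (intro integral_mono integrable_abs int[OF f]) auto
    finally show ?thesis by simp
  qed
  have FB: "\<bar>F js\<bar> \<le> 2 * L" for js
  proof -
    have "\<bar>f xs - m\<bar> \<le> 2" for xs using f[of xs] m1 by linarith
    then have "\<bar>F js\<bar> \<le> (\<Sum>i<L. 2)"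
      unfolding F_def by (intro order_trans[OF sum_abs] sum_mono)
    then show ?thesis by simp
  qed
  have hoeff: "(\<integral>\<^sup>+xs. ennreal (exp (l * (f xs - m))) \<partial>replicate_pmf r q) \<le> ennreal (exp (l\<^sup>2 / 2))"
  proof -
    interpret interval_bounded_random_variable "measure_pmf (replicate_pmf r q)" f "-1" 1
      using f by unfold_locales (auto simp: abs_le_iff minus_le_iff)
    show ?thesis using Hoeffdings_lemma_nn_integral[OF l] by (simp add: m_def)
  qed
  have "(\<integral>\<^sup>+js. ennreal (exp (l * F js)) \<partial>replicate_pmf k q)
      = (\<integral>\<^sup>+js. (\<Prod>i<L. ennreal (exp (l * (f (take r (drop (i * r) js)) - m)))) \<partial>replicate_pmf k q)"
    by (simp add: F_def sum_distrib_left exp_sum prod_ennreal)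
  also have "\<dots> = (\<integral>\<^sup>+xs. ennreal (exp (l * (f xs - m))) \<partial>replicate_pmf r q) ^ L"
    by (rule replicate_pmf_block_exp[OF L(2)])
  also have "\<dots> \<le> ennreal (exp (l\<^sup>2 / 2)) ^ L"
    using hoeff by (rule power_mono) simp
  also have "\<dots> = ennreal M"
  proof -
    have "exp (l\<^sup>2 / 2) ^ L = exp (l * l * L / 2)"
      by (simp add: exp_of_nat_mult[symmetric] power2_eq_square mult_ac)
    also have "\<dots> = M" using l2 M by simp
    finally show ?thesis by (simp add: ennreal_power)
  qed
  finally have rep: "(\<integral>\<^sup>+js. ennreal (exp (l * F js)) \<partial>replicate_pmf k q) \<le> ennreal M" .
  have "(\<integral>\<^sup>+js. ennreal (exp (l * F js)) \<partial>\<mu>)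
      \<le> (\<integral>\<^sup>+js. ennreal M * (ennreal (pmf (replicate_pmf k q) js) * ennreal (exp (l * F js))) \<partial>count_space UNIV)"
    unfolding nn_integral_measure_pmf
  proof (intro nn_integral_mono)
    fix js
    have "ennreal (pmf \<mu> js) \<le> ennreal M * ennreal (pmf (replicate_pmf k q) js)"
      using dens[of js] M by (simp add: ennreal_mult[symmetric] ennreal_leI)
    then show "ennreal (pmf \<mu> js) * ennreal (exp (l * F js))
        \<le> ennreal M * (ennreal (pmf (replicate_pmf k q) js) * ennreal (exp (l * F js)))"
      unfolding mult.assoc[symmetric] by (rule mult_right_mono) simp
  qed
  also have "\<dots> = ennreal M * (\<integral>\<^sup>+js. ennreal (exp (l * F js)) \<partial>replicate_pmf k q)"
    unfolding nn_integral_measure_pmf by (rule nn_integral_cmult) simp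
  also have "\<dots> \<le> ennreal M * ennreal M" using rep by (rule mult_left_mono) simp
  also have "\<dots> = ennreal (M * M)" using M by (simp add: ennreal_mult)
  finally have mgf: "(\<integral>\<^sup>+js. ennreal (exp (l * F js)) \<partial>\<mu>) \<le> ennreal (M * M)" .
  define c where "c = measure_pmf.expectation \<mu> (\<lambda>js. l * F js)"
  have intF: "integrable (measure_pmf \<mu>) (\<lambda>js. l * F js)"
  proof (rule int)
    fix js show "\<bar>l * F js\<bar> \<le> l * (2 * L)"
      unfolding abs_mult using FB[of js] l by (intro mult_mono) auto
  qed
  have intE: "integrable (measure_pmf \<mu>) (\<lambda>js. exp (l * F js))"
  proof (rule int)
    fix js show "\<bar>exp (l * F js)\<bar> \<le> exp (l * (2 * L))"
      using FB[of js] l by (simp add: abs_le_iff)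
  qed
  have "exp c = measure_pmf.expectation \<mu> (\<lambda>js. exp c * (1 - c + l * F js))"
    using intF by (simp add: c_def)
  also have "\<dots> \<le> measure_pmf.expectation \<mu> (\<lambda>js. exp (l * F js))"
  proof (rule integral_mono)
    fix js
    have "exp c * (1 + (l * F js - c)) \<le> exp c * exp (l * F js - c)"
      by (intro mult_left_mono exp_ge_add_one_self) auto
    then show "exp c * (1 - c + l * F js) \<le> exp (l * F js)"
      by (simp add: exp_add[symmetric] algebra_simps)
  qed (use intF intE in auto)
  also have "\<dots> \<le> M * M"
    using mgf M by (subst (asm) nn_integral_eq_integral[OF intE]) (auto simp: ennreal_le_iff)
  finally have "c \<le> ln (M * M)" using M by (subst ln_ge_iff) auto
  then have c2: "c \<le> 2 * ln M" using M by (simp add: ln_mult)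
  have block: "measure_pmf.expectation \<mu> (\<lambda>js. f (take r (drop (i * r) js))) = e" if i: "i < L" for i
  proof -
    have "i * r + r \<le> r * L" using mult_le_mono2[of "Suc i" L r] i by (simp add: mult.commute)
    then have ik: "i * r + r \<le> k" using L by linarith
    have "measure_pmf.expectation \<mu> (\<lambda>js. f (take r (drop (i * r) js)))
      = measure_pmf.expectation \<mu> (\<lambda>js. f (take r (rotate (i * r) js)))"
    proof (intro integral_cong_AE, simp, simp, subst AE_measure_pmf_iff, intro ballI)
      fix js assume "js \<in> set_pmf \<mu>"
      then have "0 < pmf \<mu> js" by (rule pmf_positive)
      then have "js \<in> set_pmf (replicate_pmf k q)"
        using dens[of js] M by (auto simp: set_pmf_iff)
      then have "length js = k" by (simp add: set_replicate_pmf)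
      with ik r have "take r (rotate (i * r) js) = take r (drop (i * r) js)"
        by (simp add: rotate_drop_take)
      then show "f (take r (drop (i * r) js)) = f (take r (rotate (i * r) js))" by simp
    qed
    also have "\<dots> = measure_pmf.expectation (map_pmf (rotate (i * r)) \<mu>) (\<lambda>js. f (take r js))"
      by simp
    also have "\<dots> = e" unfolding rot e_def by simp
    finally show ?thesis .
  qed
  have "c = l * measure_pmf.expectation \<mu> F" unfolding c_def by (rule integral_mult_right_zero)
  also have "measure_pmf.expectation \<mu> F
      = (\<Sum>i<L. measure_pmf.expectation \<mu> (\<lambda>js. f (take r (drop (i * r) js)) - m))"
    unfolding F_def by (intro Bochner_Integration.integral_sum Bochner_Integration.integrable_diff int[OF f]) auto
  also have "\<dots> = (\<Sum>i<L. e - m)"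
  proof (intro sum.cong refl)
    fix i assume "i \<in> {..<L}"
    then show "measure_pmf.expectation \<mu> (\<lambda>js. f (take r (drop (i * r) js)) - m) = e - m"
      using block[of i] by (subst Bochner_Integration.integral_diff[OF int[OF f]]) auto
  qed
  finally have "c = l * (L * (e - m))" by simp
  with c2 l2 have "l * L * (e - m) \<le> l * L * l" by (simp add: mult_ac)
  then have "e - m \<le> l" using l L by (subst (asm) mult_le_cancel_left_pos) auto
  then show ?thesis by (simp add: e_def m_def l_def L_def)
qed

text \<open>
  The total variation distance is attained by the sign of the difference of the densities.
\<close>

lemma tv_dist_eq_expectation:
  fixes p q :: "'a pmf"
  shows "2 * tv_dist p q = measure_pmf.expectation p (\<lambda>z. sgn (pmf p z - pmf q z))
     - measure_pmf.expectation q (\<lambda>z. sgn (pmf p z - pmf q z))"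
proof -
  let ?s = "\<lambda>z. sgn (pmf p z - pmf q z)"
  have summ: "Infinite_Set_Sum.abs_summable_on (\<lambda>z. pmf p' z * ?s z) UNIV" for p' :: "'a pmf"
  proof (rule abs_summable_on_comparison_test'[of "pmf p'"])
    show "Infinite_Set_Sum.abs_summable_on (pmf p') UNIV" by (rule pmf_abs_summable)
    show "norm (pmf p' z * ?s z) \<le> pmf p' z" for z by (simp add: abs_mult sgn_if)
  qed
  have E: "measure_pmf.expectation p' ?s = infsum (\<lambda>z. pmf p' z * ?s z) UNIV" for p' :: "'a pmf"
    unfolding pmf_expectation_eq_infsetsum by (rule infsetsum_infsum[OF summ])
  have S: "(\<lambda>z. pmf p' z * ?s z) summable_on UNIV" for p' :: "'a pmf"
    using summ[of p'] abs_summable_equivalent abs_summable_summable by blast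
  have "2 * tv_dist p q = infsum (\<lambda>z. pmf p z * ?s z - pmf q z * ?s z) UNIV"
    unfolding tv_dist_def by (simp add: left_diff_distrib[symmetric] abs_sgn mult.commute)
  also have "\<dots> = infsum (\<lambda>z. pmf p z * ?s z) UNIV - infsum (\<lambda>z. pmf q z * ?s z) UNIV"
    using infsum_add[OF S[of p] summable_on_uminus[THEN iffD2, OF S[of q]]] by (simp add: infsum_uminus)
  finally show ?thesis by (simp add: E)
qed

lemma tv_dist_le:
  assumes "\<And>js. pmf \<mu> js \<le> M * pmf (replicate_pmf k q) js"
    and "\<And>m. map_pmf (rotate m) \<mu> = \<mu>"
    and "r \<ge> 1" "r \<le> k" "M > 1"
  shows "tv_dist (map_pmf (take r) \<mu>) (replicate_pmf r q) \<le> sqrt (2 * ln M / real (k div r)) / 2"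
proof -
  have "2 * tv_dist (map_pmf (take r) \<mu>) (replicate_pmf r q) \<le> sqrt (2 * ln M / real (k div r))"
    unfolding tv_dist_eq_expectation by (rule block_average_le[OF assms]) (simp add: sgn_if)
  then show ?thesis by simp
qed

section \<open>The microcanonical ensemble\<close>

context canonical_model
begin

definition mean_J :: real where "mean_J = measure_pmf.expectation q real"
definition mean_v :: real where "mean_v = measure_pmf.expectation q v"
definition walk_step :: "(int \<times> real) pmf" where "walk_step = map_pmf (\<lambda>j. (int j, v j)) q"

lemma set_q: "set_pmf q = {1..}"
proof (rule set_eqI)
  fix j
  show "j \<in> set_pmf q \<longleftrightarrow> j \<in> {1..}"
  proof (cases "1 \<le> j")
    case True
    then show ?thesis using apos[OF True] x by (simp add: set_pmf_iff q tilted_weight_def)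
  next
    case False
    then show ?thesis by (simp add: set_pmf_iff q tilted_weight_def)
  qed
qed

lemma intJ1: "integrable (measure_pmf q) real"
  by (rule measure_pmf.square_integrable_imp_integrable[OF _ intJ]) simp

lemma mean_J_ge_1: "mean_J \<ge> 1"
proof -
  have "measure_pmf.expectation q (\<lambda>_. 1 :: real) \<le> measure_pmf.expectation q real"
  proof (rule integral_mono_AE)
    show "AE j in measure_pmf q. 1 \<le> real j"
      unfolding AE_measure_pmf_iff set_q by simp
  qed (use intJ1 in auto)
  then show ?thesis by (simp add: mean_J_def)
qed

lemma integrable_D:
  "integrable (measure_pmf walk_step) (\<lambda>z. (real_of_int (fst z))\<^sup>2)"
  "integrable (measure_pmf walk_step) (\<lambda>z. (snd z)\<^sup>2)"
  using intJ intV by (simp_all add: walk_step_def)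

lemma expectation_D:
  "measure_pmf.expectation walk_step (\<lambda>z. real_of_int (fst z)) = mean_J"
  "measure_pmf.expectation walk_step snd = mean_v"
  by (simp_all add: walk_step_def mean_J_def mean_v_def)

text \<open>
  The coins: a single step chooses between \<open>1\<close> and \<open>2\<close>, and a pair of steps chooses between
  \<open>(j, j + 2)\<close> and \<open>(j + 1, j + 1)\<close>, which have the same sum and whose \<open>v\<close>-sums differ by a second difference.
\<close>

lemma local_bounds:
  "\<exists>C>0. \<exists>c>0. (\<forall>k s t. measure_pmf.prob (conv_pow k walk_step) (strip s t) \<le> C / (real k + 1)) \<and>
    (\<forall>\<^sub>F k in sequentially. \<forall>s t. \<bar>of_int s - real k * mean_J\<bar> \<le> B \<longrightarrow> \<bar>t - real k * mean_v\<bar> \<le> B \<longrightarrow>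
       c / real k \<le> measure_pmf.prob (conv_pow k walk_step) (strip s t))"
proof -
  obtain j where j: "j \<ge> 1" "fdiff (fdiff v) j \<noteq> 0" "\<bar>fdiff (fdiff v) j\<bar> \<le> 1" using diff by blast
  define d where "d = - fdiff (fdiff v) j"
  have d: "d \<noteq> 0" "\<bar>d\<bar> \<le> 1" using j by (simp_all add: d_def)
  have inD: "(int i, v i) \<in> set_pmf walk_step" if "i \<ge> 1" for i
    using that by (auto simp: walk_step_def set_q)
  have inDD: "z + z' \<in> set_pmf (conv_pmf walk_step walk_step)" if "z \<in> set_pmf walk_step" "z' \<in> set_pmf walk_step" for z z'
    using that by (auto simp: conv_pmf_def)
  have A1: "(1, v 1) \<in> set_pmf walk_step" "(1 + 1, v 1 + (v 2 - v 1)) \<in> set_pmf walk_step"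
    using inD[of 1] inD[of 2] by simp_all
  obtain \<beta>1 R1 where 1: "0 < \<beta>1" "\<beta>1 < 1"
    "walk_step = mix_pmf \<beta>1 (pmf_of_set {(1, v 1), (1 + 1, v 1 + (v 2 - v 1))}) R1"
    using mixture_with_coin[OF A1] by auto
  define y1 where "y1 = 2 * int j + 2"
  define y2 where "y2 = v j + v (j + 2)"
  have "(int j, v j) + (int (j + 2), v (j + 2)) \<in> set_pmf (conv_pmf walk_step walk_step)"
    "(int (j + 1), v (j + 1)) + (int (j + 1), v (j + 1)) \<in> set_pmf (conv_pmf walk_step walk_step)"
    using j by (intro inDD inD; simp)+
  then have A2: "(y1, y2) \<in> set_pmf (conv_pmf walk_step walk_step)" "(y1 + 0, y2 + d) \<in> set_pmf (conv_pmf walk_step walk_step)"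
    by (simp_all add: y1_def y2_def d_def fdiff_def algebra_simps)
  obtain \<beta>2 R2 where 2: "0 < \<beta>2" "\<beta>2 < 1"
    "conv_pmf walk_step walk_step = mix_pmf \<beta>2 (pmf_of_set {(y1, y2), (y1 + 0, y2 + d)}) R2"
    using mixture_with_coin[OF A2] d by auto
  interpret coin_walk walk_step 1 y1 "v 1" y2 "v 2 - v 1" d \<beta>1 \<beta>2 R1 R2
    using 1 2 d by unfold_locales auto
  show ?thesis
    using prob_strip_le prob_strip_ge[OF integrable_D, of B] unfolding expectation_D by blast
qed

lemma map_replicate_D:
  "map_pmf (\<lambda>js. (int (sum_list js), \<Sum>j\<leftarrow>js. v j)) (replicate_pmf k q) = conv_pow k walk_step"
proof (induction k)
  case (Suc k)
  have rep: "replicate_pmf (Suc k) q = bind_pmf q (\<lambda>j. map_pmf (\<lambda>js. j # js) (replicate_pmf k q))"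
    by (simp add: map_pmf_def)
  show ?case
    unfolding conv_pow.simps Suc[symmetric] rep map_bind_pmf map_pmf_comp conv_pmf_def
    by (simp add: walk_step_def bind_map_pmf)
qed (simp add: zero_prod_def)

lemma prob_micro_set:
  "measure_pmf.prob (replicate_pmf k q) (micro_set v \<rho> n k)
     = measure_pmf.prob (conv_pow k walk_step) (strip (int n) (\<rho> * real n))"
proof -
  have "measure_pmf.prob (conv_pow k walk_step) (strip (int n) (\<rho> * real n))
      = measure_pmf.prob (replicate_pmf k q)
          {js. int (sum_list js) = int n \<and> \<bar>(\<Sum>j\<leftarrow>js. v j) - \<rho> * real n\<bar> \<le> 1}"
    unfolding map_replicate_D[symmetric] by (simp add: strip_def vimage_def)
  also have "\<dots> = measure_pmf.prob (replicate_pmf k q) (micro_set v \<rho> n k)"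
    by (intro measure_pmf.finite_measure_eq_AE)
       (auto simp: AE_measure_pmf_iff set_replicate_pmf set_q micro_set_def)
  finally show ?thesis ..
qed

lemma pmf_replicate_micro:
  assumes "js \<in> micro_set v \<rho> n k"
  shows "pmf (replicate_pmf k q) js = (\<Prod>j\<leftarrow>js. a j) * (x ^ n * exp (\<gamma> * (\<Sum>j\<leftarrow>js. v j)))"
proof -
  have "(\<forall>j\<in>set js. 1 \<le> j) \<Longrightarrow> (\<Prod>j\<leftarrow>js. pmf q j) = (\<Prod>j\<leftarrow>js. a j) * (x ^ sum_list js * exp (\<gamma> * (\<Sum>j\<leftarrow>js. v j)))" for js
    by (induction js) (simp_all add: q tilted_weight_def power_add exp_add algebra_simps)
  then show ?thesis using assms by (auto simp: pmf_replicate_pmf micro_set_def)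
qed

text \<open>
  The factor that converts products of weights into probabilities for a configuration whose
  \<open>v\<close>-sum is exactly \<open>\<rho> n\<close>.
\<close>

definition scale :: "real \<Rightarrow> nat \<Rightarrow> real" where
  "scale \<rho> n = x ^ n * exp (\<gamma> * (\<rho> * real n))"

lemma scale_pos: "scale \<rho> n > 0"
  using x by (simp add: scale_def)

lemma prod_a_nonneg: "js \<in> micro_set v \<rho> n k \<Longrightarrow> 0 \<le> (\<Prod>j\<leftarrow>js. a j)"
  by (auto simp: micro_set_def intro!: prod_list_nonneg less_imp_le[OF apos])

text \<open>
  On the constraint set the \<open>v\<close>-sum differs from \<open>\<rho> n\<close> by at most \<open>1\<close>, so that replacing one by
  the other in the exponential weight costs at most a factor \<open>exp \<bar>\<gamma>\<bar>\<close>.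
\<close>

lemma pmf_replicate_micro_bounds:
  assumes js: "js \<in> micro_set v \<rho> n k"
  shows "exp (- \<bar>\<gamma>\<bar>) * scale \<rho> n * (\<Prod>j\<leftarrow>js. a j) \<le> pmf (replicate_pmf k q) js"
    and "pmf (replicate_pmf k q) js \<le> exp \<bar>\<gamma>\<bar> * scale \<rho> n * (\<Prod>j\<leftarrow>js. a j)"
proof -
  define V where "V = (\<Sum>j\<leftarrow>js. v j) - \<rho> * real n"
  have V: "\<bar>\<gamma> * V\<bar> \<le> \<bar>\<gamma>\<bar>"
    using js mult_left_mono[of "\<bar>V\<bar>" 1 "\<bar>\<gamma>\<bar>"] by (simp add: micro_set_def V_def abs_mult)
  have eq: "pmf (replicate_pmf k q) js = exp (\<gamma> * V) * (scale \<rho> n * (\<Prod>j\<leftarrow>js. a j))"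
    unfolding pmf_replicate_micro[OF js]
    by (simp add: V_def scale_def exp_add[symmetric] algebra_simps)
  have nn: "0 \<le> scale \<rho> n * (\<Prod>j\<leftarrow>js. a j)"
    using scale_pos[of \<rho> n] prod_a_nonneg[OF js] by simp
  show "exp (- \<bar>\<gamma>\<bar>) * scale \<rho> n * (\<Prod>j\<leftarrow>js. a j) \<le> pmf (replicate_pmf k q) js"
    unfolding eq mult.assoc using V by (intro mult_right_mono nn) (auto simp: abs_le_iff)
  show "pmf (replicate_pmf k q) js \<le> exp \<bar>\<gamma>\<bar> * scale \<rho> n * (\<Prod>j\<leftarrow>js. a j)"
    unfolding eq mult.assoc using V by (intro mult_right_mono nn) (auto simp: abs_le_iff)
qed

lemma micro_weight_bounds:
  shows "exp (- \<bar>\<gamma>\<bar>) * scale \<rho> n * micro_weight a v \<rho> n k \<le> measure_pmf.prob (replicate_pmf k q) (micro_set v \<rho> n k)"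
    and "measure_pmf.prob (replicate_pmf k q) (micro_set v \<rho> n k) \<le> exp \<bar>\<gamma>\<bar> * scale \<rho> n * micro_weight a v \<rho> n k"
  unfolding measure_measure_pmf_finite[OF finite_micro_set] micro_weight_def sum_distrib_left
  by (intro sum_mono pmf_replicate_micro_bounds; assumption)+

text \<open>
  Compare the maximizer with \<open>\<lfloor>n / mean_J\<rfloor>\<close>, for which the mean of the walk is within a constant of
  the target \<open>(n, \<rho> n)\<close>.  Weights and probabilities differ by factors that depend on \<open>k\<close>
  only up to \<open>exp \<bar>\<gamma>\<bar>\<close>, so the maximizer also has probability at least of order \<open>1 / n\<close>; then
  \<open>prob_strip_far_le\<close> bounds its distance from the mean.
\<close>

lemma maximizer_prob:
  fixes kk :: "nat \<Rightarrow> nat"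
  defines "\<rho> \<equiv> mean_v / mean_J"
  assumes kk: "\<And>n. 1 \<le> n \<Longrightarrow> micro_maximizer a v \<rho> n (kk n)"
  shows "\<exists>C>0. \<exists>c>0. \<forall>\<^sub>F n in sequentially.
     c / real n \<le> measure_pmf.prob (replicate_pmf (kk n) q) (micro_set v \<rho> n (kk n)) \<and>
     (real n - real (kk n) * mean_J)\<^sup>2 \<le> C * real n"
proof -
  define B where "B = mean_J + \<bar>mean_v\<bar>"
  have mean_J: "mean_J > 0" using mean_J_ge_1 by simp
  obtain C c where C: "C > 0" and c: "c > 0"
    and up: "\<And>k s t. measure_pmf.prob (conv_pow k walk_step) (strip s t) \<le> C / (real k + 1)"
    and low: "\<forall>\<^sub>F k in sequentially. \<forall>s t. \<bar>of_int s - real k * mean_J\<bar> \<le> B \<longrightarrow> \<bar>t - real k * mean_v\<bar> \<le> B \<longrightarrow>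
       c / real k \<le> measure_pmf.prob (conv_pow k walk_step) (strip s t)"
    using local_bounds[of B] by blast
  define var where "var = measure_pmf.expectation walk_step (\<lambda>z. (real_of_int (fst z) - mean_J)\<^sup>2)"
  have far: "measure_pmf.prob (conv_pow k walk_step) (strip s t) * (of_int s - real k * mean_J)\<^sup>2 \<le> 8 * C * var" for k s t
    using prob_strip_far_le[OF up integrable_D(1), of k s t] unfolding expectation_D var_def .
  define g where "g = exp (- 2 * \<bar>\<gamma>\<bar>)"
  define ks where "ks n = nat \<lfloor>real n / mean_J\<rfloor>" for n
  have "filterlim (\<lambda>n. real n / mean_J) at_top sequentially"
    using mean_J by (intro filterlim_tendsto_pos_mult_at_top[OF tendsto_const _ filterlim_real_sequentially, of "1 / mean_J", simplified]) auto
  then have "filterlim ks at_top sequentially"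
    unfolding ks_def by (intro filterlim_compose[OF filterlim_nat_sequentially] filterlim_compose[OF filterlim_floor_sequentially])
  then have ks_top: "filterlim ks sequentially sequentially" .
  have ev: "\<forall>\<^sub>F n in sequentially. n \<ge> 1 \<and> ks n \<ge> 1 \<and> (\<forall>s t. \<bar>of_int s - real (ks n) * mean_J\<bar> \<le> B \<longrightarrow>
        \<bar>t - real (ks n) * mean_v\<bar> \<le> B \<longrightarrow> c / real (ks n) \<le> measure_pmf.prob (conv_pow (ks n) walk_step) (strip s t))"
    using eventually_ge_at_top[of 1] eventually_compose_filterlim[OF low ks_top]
      eventually_compose_filterlim[OF eventually_ge_at_top[of 1] ks_top]
    by eventually_elim simp
  have "\<forall>\<^sub>F n in sequentially.
     (g * c) / real n \<le> measure_pmf.prob (replicate_pmf (kk n) q) (micro_set v \<rho> n (kk n)) \<and>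
     (real n - real (kk n) * mean_J)\<^sup>2 \<le> ((8 * C * var + 1) / (g * c)) * real n"
    using ev
  proof eventually_elim
    case (elim n)
    let ?P = "\<lambda>k. measure_pmf.prob (replicate_pmf k q) (micro_set v \<rho> n k)"
    have "real (ks n) \<le> real n / mean_J" "real n / mean_J \<le> real (ks n) + 1"
      using mean_J unfolding ks_def by (simp_all add: of_nat_nat)
    then have ksm: "0 \<le> real n - real (ks n) * mean_J" "real n - real (ks n) * mean_J \<le> mean_J"
      using mean_J by (simp_all add: field_simps)
    have "real (ks n) * 1 \<le> real (ks n) * mean_J" using mean_J_ge_1 by (intro mult_left_mono) auto
    then have ksn: "ks n \<le> n" using ksm(1) by simp
    have "\<rho> * real n - real (ks n) * mean_v = (mean_v / mean_J) * (real n - real (ks n) * mean_J)"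
      using mean_J by (simp add: \<rho>_def field_simps)
    then have "\<bar>\<rho> * real n - real (ks n) * mean_v\<bar> = \<bar>mean_v\<bar> / mean_J * (real n - real (ks n) * mean_J)"
      using ksm mean_J by (simp add: abs_mult)
    also have "\<dots> \<le> \<bar>mean_v\<bar> / mean_J * mean_J" using ksm mean_J by (intro mult_left_mono) auto
    finally have mvB: "\<bar>\<rho> * real n - real (ks n) * mean_v\<bar> \<le> B" using mean_J by (simp add: B_def)
    have mB: "\<bar>of_int (int n) - real (ks n) * mean_J\<bar> \<le> B" using ksm by (simp add: B_def)
    have "c / real n \<le> c / real (ks n)" using elim ksn c by (intro divide_left_mono) auto
    also have "\<dots> \<le> ?P (ks n)"
      unfolding prob_micro_set using elim mB mvB by blast
    finally have Pks: "c / real n \<le> ?P (ks n)" .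
    have max: "micro_weight a v \<rho> n (ks n) \<le> micro_weight a v \<rho> n (kk n)"
      using kk[of n] elim ksn unfolding micro_maximizer_def is_arg_max_def by force
    have "g * ?P (ks n) \<le> g * (exp \<bar>\<gamma>\<bar> * scale \<rho> n * micro_weight a v \<rho> n (ks n))"
      using micro_weight_bounds(2) by (intro mult_left_mono) (auto simp: g_def)
    also have "\<dots> = exp (- \<bar>\<gamma>\<bar>) * scale \<rho> n * micro_weight a v \<rho> n (ks n)"
      by (simp add: g_def mult.assoc[symmetric] exp_add[symmetric])
    also have "\<dots> \<le> exp (- \<bar>\<gamma>\<bar>) * scale \<rho> n * micro_weight a v \<rho> n (kk n)"
      using max scale_pos[of \<rho> n] by (intro mult_left_mono) auto
    also have "\<dots> \<le> ?P (kk n)" by (rule micro_weight_bounds(1))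
    finally have "g * ?P (ks n) \<le> ?P (kk n)" .
    moreover have "g * (c / real n) \<le> g * ?P (ks n)" using Pks by (intro mult_left_mono) (auto simp: g_def)
    ultimately have P: "(g * c) / real n \<le> ?P (kk n)" by simp
    have gc: "g * c > 0" using c by (simp add: g_def)
    have "(g * c) / real n * (real n - real (kk n) * mean_J)\<^sup>2 \<le> ?P (kk n) * (real n - real (kk n) * mean_J)\<^sup>2"
      using P by (intro mult_right_mono) auto
    also have "\<dots> \<le> 8 * C * var" using far[of "kk n" "int n"] unfolding prob_micro_set by simp
    finally have "(g * c) * (real n - real (kk n) * mean_J)\<^sup>2 \<le> 8 * C * var * real n"
      using elim by (simp add: field_simps)
    also have "\<dots> \<le> (8 * C * var + 1) * real n" by (intro mult_right_mono) auto
    finally have "(real n - real (kk n) * mean_J)\<^sup>2 \<le> ((8 * C * var + 1) * real n) / (g * c)"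
      using gc by (simp add: le_divide_eq mult.commute)
    with P show ?case by simp
  qed
  moreover have "g * c > 0" using c by (simp add: g_def)
  moreover have "(8 * C * var + 1) / (g * c) > 0"
    using C \<open>g * c > 0\<close> by (auto intro!: divide_pos_pos add_nonneg_pos simp: var_def)
  ultimately show ?thesis by blast
qed

lemma micro_law_density:
  assumes P: "0 < P" "P \<le> measure_pmf.prob (replicate_pmf k q) (micro_set v \<rho> n k)"
  shows "0 < micro_weight a v \<rho> n k"
    and "pmf (micro_law a v \<rho> n k) js \<le> (exp (2 * \<bar>\<gamma>\<bar>) / P) * pmf (replicate_pmf k q) js"
proof -
  let ?W = "micro_weight a v \<rho> n k"
  have PW: "P \<le> exp \<bar>\<gamma>\<bar> * scale \<rho> n * ?W" using P(2) micro_weight_bounds(2) by (rule order_trans)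
  then have "0 < exp \<bar>\<gamma>\<bar> * scale \<rho> n * ?W" using P by simp
  moreover have "0 < exp \<bar>\<gamma>\<bar> * scale \<rho> n" using scale_pos[of \<rho> n] by simp
  ultimately show W: "0 < ?W" by (rule zero_less_mult_pos)
  show "pmf (micro_law a v \<rho> n k) js \<le> (exp (2 * \<bar>\<gamma>\<bar>) / P) * pmf (replicate_pmf k q) js"
  proof (cases "js \<in> micro_set v \<rho> n k")
    case True
    let ?A = "\<Prod>j\<leftarrow>js. a j"
    have A: "0 \<le> ?A" by (rule prod_a_nonneg[OF True])
    have "pmf (micro_law a v \<rho> n k) js * P = ?A / ?W * P"
      using True by (simp add: pmf_micro_law[OF apos W])
    also have "\<dots> \<le> ?A / ?W * (exp \<bar>\<gamma>\<bar> * scale \<rho> n * ?W)"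
      using PW A W by (intro mult_left_mono) auto
    also have "\<dots> = exp \<bar>\<gamma>\<bar> * scale \<rho> n * ?A" using W by simp
    also have "\<dots> = exp (2 * \<bar>\<gamma>\<bar>) * (exp (- \<bar>\<gamma>\<bar>) * scale \<rho> n * ?A)"
      by (simp add: mult.assoc[symmetric] exp_add[symmetric])
    also have "\<dots> \<le> exp (2 * \<bar>\<gamma>\<bar>) * pmf (replicate_pmf k q) js"
      using pmf_replicate_micro_bounds(1)[OF True] by (intro mult_left_mono) auto
    finally show ?thesis using P by (simp add: field_simps)
  qed (use P in \<open>simp add: pmf_micro_law[OF apos W]\<close>)
qed

lemma micro_law_rotate:
  assumes W: "0 < micro_weight a v \<rho> n k"
  shows "map_pmf (rotate i) (micro_law a v \<rho> n k) = micro_law a v \<rho> n k"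
proof -
  have inv: "pmf (micro_law a v \<rho> n k) (rotate1 js) = pmf (micro_law a v \<rho> n k) js" for js
  proof -
    have "sum_list (rotate1 js) = sum_list js" "(\<Sum>j\<leftarrow>rotate1 js. v j) = (\<Sum>j\<leftarrow>js. v j)"
      "(\<Prod>j\<leftarrow>rotate1 js. a j) = (\<Prod>j\<leftarrow>js. a j)"
      by (cases js; simp add: add.commute mult.commute)+
    then show ?thesis by (simp add: pmf_micro_law[OF apos W] micro_set_def)
  qed
  have one: "map_pmf rotate1 (micro_law a v \<rho> n k) = micro_law a v \<rho> n k"
  proof (rule pmf_eqI)
    fix js :: "nat list"
    obtain js' where js': "js = rotate1 js'" using surj_rotate1 by (metis surjD)
    show "pmf (map_pmf rotate1 (micro_law a v \<rho> n k)) js = pmf (micro_law a v \<rho> n k) js"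
      unfolding js' inv by (rule pmf_map_inj'[OF inj_rotate1])
  qed
  show ?thesis
  proof (induction i)
    case (Suc i)
    have "rotate (Suc i) = (\<lambda>js :: nat list. rotate1 (rotate i js))" by (rule ext) simp
    then have "map_pmf (rotate (Suc i)) (micro_law a v \<rho> n k) = map_pmf rotate1 (map_pmf (rotate i) (micro_law a v \<rho> n k))"
      by (simp only: map_pmf_comp)
    then show ?case by (simp only: Suc.IH one)
  qed (simp add: rotate_def)
qed

lemma maximizer_rate:
  fixes kk :: "nat \<Rightarrow> nat"
  assumes kk: "\<And>n. 1 \<le> n \<Longrightarrow> micro_maximizer a v (mean_v / mean_J) n (kk n)"
  shows "(\<lambda>n. \<bar>real (kk n) / real n - 1 / mean_J\<bar>) \<in> O(\<lambda>n. real n powr (- 1 / 2))"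
proof -
  obtain C c where C: "C > 0" and ev: "\<forall>\<^sub>F n in sequentially.
     c / real n \<le> measure_pmf.prob (replicate_pmf (kk n) q) (micro_set v (mean_v / mean_J) n (kk n)) \<and>
     (real n - real (kk n) * mean_J)\<^sup>2 \<le> C * real n"
    using maximizer_prob[OF kk] by blast
  have mean_J: "mean_J > 0" using mean_J_ge_1 by simp
  have "\<forall>\<^sub>F n in sequentially. norm \<bar>real (kk n) / real n - 1 / mean_J\<bar> \<le> (sqrt C / mean_J) * norm (real n powr (- 1 / 2))"
    using ev eventually_ge_at_top[of 1]
  proof eventually_elim
    case (elim n)
    then have n: "real n > 0" by simp
    have "\<bar>real n - real (kk n) * mean_J\<bar> \<le> sqrt (C * real n)"
      using elim by (intro real_le_rsqrt) simp
    then have "\<bar>real n - real (kk n) * mean_J\<bar> / (mean_J * real n) \<le> sqrt (C * real n) / (mean_J * real n)"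
      using mean_J n by (intro divide_right_mono) auto
    moreover have "\<bar>real (kk n) / real n - 1 / mean_J\<bar> = \<bar>real n - real (kk n) * mean_J\<bar> / (mean_J * real n)"
    proof -
      have "real (kk n) / real n - 1 / mean_J = - ((real n - real (kk n) * mean_J) / (mean_J * real n))"
        using mean_J n by (simp add: field_simps)
      then show ?thesis using mean_J n by (simp only: abs_minus_cancel abs_divide) simp
    qed
    moreover have "sqrt (C * real n) / (mean_J * real n) = (sqrt C / mean_J) * real n powr (- 1 / 2)"
    proof -
      have "real n powr (- 1 / 2) = 1 / sqrt (real n)"
        using n powr_minus_divide[of "real n" "1 / 2"] by (simp add: powr_half_sqrt)
      moreover have "sqrt C * s / (mean_J * (s * s)) = sqrt C / mean_J * (1 / s)" if "s > 0" for s :: real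
        using that by simp
      from this[of "sqrt (real n)"] have "sqrt C * sqrt (real n) / (mean_J * real n) = sqrt C / mean_J * (1 / sqrt (real n))"
        using n by simp
      ultimately show ?thesis by (simp only: real_sqrt_mult)
    qed
    ultimately show ?case by simp
  qed
  then show ?thesis by (rule bigoI)
qed

text \<open>
  The lower bound \<open>c / n\<close> for the probability of the constraint set bounds the density by \<open>A * n\<close>, and
  there are at least \<open>n / (4 * mean_J * r)\<close> blocks, because the maximizer is at least \<open>n / (2 * mean_J)\<close>.
\<close>

lemma marginal_rate:
  fixes kk :: "nat \<Rightarrow> nat" and r :: nat
  assumes kk: "\<And>n. 1 \<le> n \<Longrightarrow> micro_maximizer a v (mean_v / mean_J) n (kk n)" and r: "r \<ge> 1"
  shows "\<forall>\<^sub>F n in sequentially. r \<le> kk n \<and> 0 < micro_weight a v (mean_v / mean_J) n (kk n)"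
    and "(\<lambda>n. tv_dist (micro_marginal a v (mean_v / mean_J) n (kk n) r) (replicate_pmf r q))
       \<in> O(\<lambda>n. (ln (real n) / real n) powr (1 / 2))"
proof -
  let ?\<rho> = "mean_v / mean_J"
  obtain C c where C: "C > 0" and c: "c > 0" and ev: "\<forall>\<^sub>F n in sequentially.
     c / real n \<le> measure_pmf.prob (replicate_pmf (kk n) q) (micro_set v ?\<rho> n (kk n)) \<and>
     (real n - real (kk n) * mean_J)\<^sup>2 \<le> C * real n"
    using maximizer_prob[OF kk] by blast
  have mean_J: "mean_J > 0" using mean_J_ge_1 by simp
  define A where "A = exp (2 * \<bar>\<gamma>\<bar>) / c"
  have A: "A > 0" using c by (simp add: A_def)
  have "\<forall>\<^sub>F n in sequentially. 4 * C \<le> real n \<and> 2 * mean_J * r \<le> real n \<and> A \<le> real n \<and> 2 / A \<le> real n"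
    using filterlim_real_sequentially unfolding filterlim_at_top by (intro eventually_conj) auto
  with ev eventually_ge_at_top[of 2]
  have main: "\<forall>\<^sub>F n in sequentially. r \<le> kk n \<and> 0 < micro_weight a v ?\<rho> n (kk n) \<and>
    tv_dist (micro_marginal a v ?\<rho> n (kk n) r) (replicate_pmf r q)
      \<le> (2 * sqrt (mean_J * r)) * (ln (real n) / real n) powr (1 / 2)"
  proof eventually_elim
    case (elim n)
    then have n: "real n \<ge> 2" by simp
    have km: "real n / 2 \<le> real (kk n) * mean_J"
    proof (rule ccontr)
      assume "\<not> real n / 2 \<le> real (kk n) * mean_J"
      then have "real n / 2 < real n - real (kk n) * mean_J" by simp
      then have "(real n / 2)\<^sup>2 < (real n - real (kk n) * mean_J)\<^sup>2" using n by (intro power_strict_mono) auto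
      also have "\<dots> \<le> C * real n" using elim by simp
      finally have "real n * real n < 4 * C * real n" by (simp add: power2_eq_square)
      then show False using elim n by (simp add: mult_less_cancel_right)
    qed
    have "2 * mean_J * real r \<le> real n" using elim by blast
    then have "mean_J * real r \<le> mean_J * real (kk n)"
      using km unfolding mult.commute[of "real (kk n)"] by linarith
    then have rk: "r \<le> kk n" using mean_J by simp
    have cn: "0 < c / real n" using c n by simp
    have P: "c / real n \<le> measure_pmf.prob (replicate_pmf (kk n) q) (micro_set v ?\<rho> n (kk n))"
      using elim by simp
    have W: "0 < micro_weight a v ?\<rho> n (kk n)" by (rule micro_law_density(1)[OF cn P])
    have "exp (2 * \<bar>\<gamma>\<bar>) / (c / real n) = A * real n" by (simp add: A_def)
    then have dens: "pmf (micro_law a v ?\<rho> n (kk n)) js \<le> (A * real n) * pmf (replicate_pmf (kk n) q) js" for js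
      using micro_law_density(2)[OF cn P, of js] by simp
    have "2 \<le> A * real n" using elim A by (simp add: divide_le_eq mult.commute)
    then have An: "1 < A * real n" by simp
    have "tv_dist (micro_marginal a v ?\<rho> n (kk n) r) (replicate_pmf r q)
       \<le> sqrt (2 * ln (A * real n) / real (kk n div r)) / 2"
      unfolding micro_marginal_def
      by (rule tv_dist_le[OF dens micro_law_rotate[OF W] r rk An])
    also have "\<dots> \<le> sqrt (16 * mean_J * r * (ln (real n) / real n)) / 2"
    proof -
      have "kk n < r + r * (kk n div r)"
        using r dividend_less_times_div[of r "kk n"] by simp
      moreover have "r * 1 \<le> r * (kk n div r)"
        using r rk by (intro mult_le_mono) (auto simp: Suc_le_eq div_greater_zero_iff)
      ultimately have "kk n \<le> 2 * r * (kk n div r)" unfolding mult.assoc by linarith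
      then have "real (kk n) \<le> 2 * real r * real (kk n div r)"
        by (metis of_nat_le_iff of_nat_mult of_nat_numeral)
      then have "mean_J * real (kk n) \<le> mean_J * (2 * real r * real (kk n div r))" using mean_J by (intro mult_left_mono) auto
      then have L: "real n \<le> 4 * mean_J * r * real (kk n div r)" using km by (simp add: mult_ac)
      have "ln (A * real n) \<le> ln (real n * real n)"
        using elim A n by (subst ln_le_cancel_iff) (auto intro: mult_right_mono)
      then have lnA: "ln (A * real n) \<le> 2 * ln (real n)" using n by (simp add: ln_mult)
      have lnn: "0 \<le> ln (real n)" using n by simp
      have D: "0 < real (kk n div r)" using r rk by (simp add: div_greater_zero_iff)
      have "2 * ln (A * real n) / real (kk n div r) \<le> 4 * ln (real n) / real (kk n div r)"
        using lnA D by (intro divide_right_mono) auto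
      also have "\<dots> = 4 * ln (real n) * (1 / real (kk n div r))" by simp
      also have "\<dots> \<le> 4 * ln (real n) * (4 * mean_J * r / real n)"
        using L D n lnn by (intro mult_left_mono) (auto simp: field_simps)
      also have "\<dots> = 16 * mean_J * r * (ln (real n) / real n)" by simp
      finally show ?thesis by simp
    qed
    also have "\<dots> = (2 * sqrt (mean_J * r)) * (ln (real n) / real n) powr (1 / 2)"
    proof -
      have "sqrt (16 * mean_J * r * (ln (real n) / real n)) = sqrt 16 * (sqrt (mean_J * r) * sqrt (ln (real n) / real n))"
        by (simp only: real_sqrt_mult mult.assoc)
      also have "sqrt 16 = (4 :: real)" using real_sqrt_abs[of 4] by simp
      finally show ?thesis using n by (simp add: powr_half_sqrt)
    qed
    finally show ?case using rk W by simp
  qed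
  then show "\<forall>\<^sub>F n in sequentially. r \<le> kk n \<and> 0 < micro_weight a v ?\<rho> n (kk n)"
    by eventually_elim simp
  show "(\<lambda>n. tv_dist (micro_marginal a v ?\<rho> n (kk n) r) (replicate_pmf r q))
       \<in> O(\<lambda>n. (ln (real n) / real n) powr (1 / 2))"
  proof (rule bigoI)
    show "\<forall>\<^sub>F n in sequentially. norm (tv_dist (micro_marginal a v ?\<rho> n (kk n) r) (replicate_pmf r q))
       \<le> (2 * sqrt (mean_J * r)) * norm ((ln (real n) / real n) powr (1 / 2))"
      using main
    proof eventually_elim
      case (elim n)
      have "0 \<le> tv_dist (micro_marginal a v ?\<rho> n (kk n) r) (replicate_pmf r q)"
        unfolding tv_dist_def by (intro divide_nonneg_nonneg infsum_nonneg) auto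
      then show ?case using elim by simp
    qed
  qed
qed

end

lemma inverse_sqrt_in_bigo:
  "(\<lambda>n. real n powr (- 1 / 2)) \<in> O(\<lambda>n. (ln (real n) / real n) powr (1 / 2))"
proof (rule bigoI[where c = 1])
  show "\<forall>\<^sub>F n in sequentially. norm (real n powr (- 1 / 2)) \<le> 1 * norm ((ln (real n) / real n) powr (1 / 2))"
    using eventually_ge_at_top[of 3]
  proof eventually_elim
    case (elim n)
    have n: "real n \<ge> 3" using elim by simp
    have "1 \<le> ln (real n)" using n e_less_272 by (subst ln_ge_iff) auto
    then have "1 / real n \<le> ln (real n) / real n" using n by (intro divide_right_mono) auto
    then have "(1 / real n) powr (1 / 2) \<le> (ln (real n) / real n) powr (1 / 2)"
      using n by (intro powr_mono2) auto
    moreover have "(1 / real n) powr (1 / 2) = real n powr (- 1 / 2)"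
      using n by (simp add: powr_divide powr_minus_divide)
    ultimately show ?case by simp
  qed
qed

theorem theorem2:
  fixes a v :: "nat \<Rightarrow> real" and \<gamma> :: real and k :: "real \<Rightarrow> nat \<Rightarrow> nat"
  assumes "profile a v"
    and "\<And>\<rho> n. 0 < \<rho> \<Longrightarrow> 1 \<le> n \<Longrightarrow> micro_maximizer a v \<rho> n (k \<rho> n)"
    and "\<gamma> \<le> gamma_crit a v"
    and "0 < canon_rho a v \<gamma>"
  shows "(\<gamma> < gamma_crit a v \<longrightarrow>
           (\<lambda>n. \<bar>real (k (canon_rho a v \<gamma>) n) / real n - canon_alpha a v \<gamma>\<bar>)
             \<in> O(\<lambda>n. real n powr (-1/2)))
       \<and> (\<gamma> = gamma_crit a v \<longrightarrow>
           (\<lambda>n. \<bar>real (k (canon_rho a v (gamma_crit a v)) n) / real n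
                  - canon_alpha a v (gamma_crit a v)\<bar>)
             \<in> O(\<lambda>n. (ln (real n) / real n) powr (1/2)))
       \<and> (\<forall>r\<ge>1.
           (\<forall>\<^sub>F n in sequentially. r \<le> k (canon_rho a v \<gamma>) n \<and>
              0 < micro_weight a v (canon_rho a v \<gamma>) n (k (canon_rho a v \<gamma>) n)) \<and>
           (\<lambda>n. tv_dist (micro_marginal a v (canon_rho a v \<gamma>) n (k (canon_rho a v \<gamma>) n) r)
                        (replicate_pmf r (canon_law a v \<gamma>)))
             \<in> O(\<lambda>n. (ln (real n) / real n) powr (1/2)))"
proof -
  obtain x where "canonical_model a v \<gamma> x (canon_law a v \<gamma>)"
    using canonical_law_model[OF assms(1,3)] by blast
  then interpret canonical_model a v \<gamma> x "canon_law a v \<gamma>" .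
  have \<rho>: "canon_rho a v \<gamma> = mean_v / mean_J" by (simp add: canon_rho_def mean_v_def mean_J_def)
  have \<alpha>: "canon_alpha a v \<gamma> = 1 / mean_J" by (simp add: canon_alpha_def mean_J_def)
  have kk: "micro_maximizer a v (mean_v / mean_J) n (k (mean_v / mean_J) n)" if "1 \<le> n" for n
    using assms(2)[OF assms(4) that] by (simp only: \<rho>)
  have rate: "(\<lambda>n. \<bar>real (k (canon_rho a v \<gamma>) n) / real n - canon_alpha a v \<gamma>\<bar>)
      \<in> O(\<lambda>n. real n powr (-1/2))"
    unfolding \<rho> \<alpha> by (rule maximizer_rate[OF kk])
  show ?thesis
  proof (intro conjI impI allI)
    assume "\<gamma> = gamma_crit a v"
    then show "(\<lambda>n. \<bar>real (k (canon_rho a v (gamma_crit a v)) n) / real n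
        - canon_alpha a v (gamma_crit a v)\<bar>) \<in> O(\<lambda>n. (ln (real n) / real n) powr (1/2))"
      using landau_o.big_trans[OF rate inverse_sqrt_in_bigo] by simp
  qed (use rate marginal_rate[OF kk] in \<open>simp_all add: \<rho>\<close>)
qed

end
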